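(* Consider the $(2,3)$ threshold access structure $\mathscr{A}=\{\mathtt{ab},\mathtt{ac},\mathtt{bc},\mathtt{abc}\}$ (all subsets of at least two of the three participants $\mathtt{a},\mathtt{b},\mathtt{c}$). For each $\ell\in\mathscr{A}$ let the channel from the dealer to the qualified set $\ell$ be the qutrit dephasing channel $$\mathcal{N}^{(\ell)}_{A\to B_\ell}(\rho)=[1-q(\ell)]\,\rho+q(\ell)\,Z\rho Z^\dagger,\qquad q(\ell)\in[0,1],$$ where $\mathcal{H}_A\cong\mathcal{H}_{B_\ell}\cong\mathbb{C}^3$ and $Z$ is the phase-flip operator. Then the quantum secret sharing capacity is $$C_{\mathrm{QSS}}(\mathscr{A})=\log 3-\max_{q\in\{q(\mathtt{ab}),\,q(\mathtt{ac}),\,q(\mathtt{bc}),\,q(\mathtt{abc})\}}H_2(q).$$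
   Context: Logarithms are base 2, and $H_2(q)=-q\log q-(1-q)\log(1-q)$ is the binary entropy. On $\mathbb{C}^3$ with basis $|0\rangle,|1\rangle,|2\rangle$, the phase-flip operator is $Z|j\rangle=e^{2\pi i j/3}|j\rangle$. "Channel" means completely positive trace-preserving map, $\mathcal{L}(\mathcal{H})$ denotes the linear operators on $\mathcal{H}$, and fidelity is $F(\rho,\sigma)=\|\sqrt\rho\sqrt\sigma\|_1^2$. The QSS setting is described by the family $\{\mathcal{N}^{(\ell)}_{A\to B_\ell}\}_{\ell\in\mathscr{A}}$ of channels from the dealer's input $A$ to the joint system $B_\ell$ of each qualified set $\ell$. A $(2^{nR},n)$ QSS code consists of a secret space $\mathcal{H}_S$ of dimension $2^{nR}$ (when this is not a positive integer, read $\max\{1,\lfloor2^{nR}\rfloor\}$), one encoding channel $\mathcal{F}_{S\to A^n}:\mathcal{L}(\mathcal{H}_S)\to\mathcal{L}(\mathcal{H}_A^{\otimes n})$, and decoding channels $\mathcal{D}^{(\ell)}:\mathcal{L}(\mathcal{H}_{B_\ell}^{\otimes n})\to\mathcal{L}(\mathcal{H}_S)$, $\ell\in\mathscr{A}$ (the decoder knows $\ell$, the encoder does not). $R\ge0$ is an achievable QSS rate if for every $\varepsilon,\delta>0$ and every sufficiently large $n$ there is a $(2^{n(R-\delta)},n)$ code with $$F\big(|\phi\rangle\langle\phi|_{S'S},\ (\mathrm{id}_{S'}\otimes\mathcal{D}^{(\ell)}\circ(\mathcal{N}^{(\ell)})^{\otimes n}\circ\mathcal{F})(|\phi\rangle\langle\phi|_{S'S})\big)\ge1-\varepsilon$$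 for all $\ell\in\mathscr{A}$ and all unit vectors $|\phi\rangle_{S'S}\in\mathcal{H}_{S'}\otimes\mathcal{H}_S$, $\mathcal{H}_{S'}\cong\mathcal{H}_S$. $C_{\mathrm{QSS}}(\mathscr{A})$ is the supremum of achievable QSS rates. *)

theory Defs
  imports
    "Jordan_Normal_Form.Schur_Decomposition"
    "HOL-Library.Extended_Real"
begin

section \<open>Operators on finite-dimensional Hilbert spaces\<close>

text \<open>
  The space of linear operators on a d-dimensional Hilbert space is \<open>carrier_mat d d\<close>.
  Tensor products use the lexicographic basis: the basis vector with indices i (first factor)
  and j (second factor, of dimension d) has index \<open>i * d + j\<close>.
\<close>

definition mat_trace :: "complex mat \<Rightarrow> complex" where
  "mat_trace A = (\<Sum>i<dim_row A. A $$ (i, i))"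

text \<open>
  The order on complex numbers is that of \<open>HOL-Library.Complex_Order\<close>, so \<open>0 \<le> z\<close>
  says that z is real and nonnegative. In particular a positive matrix is Hermitian.
\<close>
definition psd_mat :: "nat \<Rightarrow> complex mat \<Rightarrow> bool" where
  "psd_mat d A \<longleftrightarrow> A \<in> carrier_mat d d \<and> (\<forall>v \<in> carrier_vec d. 0 \<le> (A *\<^sub>v v) \<bullet>c v)"

text \<open>Meaningful only for positive matrices, which have exactly one positive square root.\<close>
definition psd_sqrt :: "complex mat \<Rightarrow> complex mat" where
  "psd_sqrt A = (THE B. psd_mat (dim_row A) B \<and> B * B = A)"

definition trace_norm :: "complex mat \<Rightarrow> real" where
  "trace_norm A = Re (mat_trace (psd_sqrt (mat_adjoint A * A)))"

definition fidelity :: "complex mat \<Rightarrow> complex mat \<Rightarrow> real" where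
  "fidelity \<rho> \<sigma> = (trace_norm (psd_sqrt \<rho> * psd_sqrt \<sigma>))\<^sup>2"

definition ket_bra :: "complex vec \<Rightarrow> complex mat" where
  "ket_bra v = mat (dim_vec v) (dim_vec v) (\<lambda>(i, j). v $ i * cnj (v $ j))"

definition kron :: "complex mat \<Rightarrow> complex mat \<Rightarrow> complex mat" where
  "kron A B = mat (dim_row A * dim_row B) (dim_col A * dim_col B)
     (\<lambda>(r, s). A $$ (r div dim_row B, s div dim_col B) * B $$ (r mod dim_row B, s mod dim_col B))"

section \<open>Linear maps between operator spaces and quantum channels\<close>

definition linear_op_map :: "nat \<Rightarrow> nat \<Rightarrow> (complex mat \<Rightarrow> complex mat) \<Rightarrow> bool" where
  "linear_op_map d e L \<longleftrightarrow>
     (\<forall>X \<in> carrier_mat d d. L X \<in> carrier_mat e e) \<and>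
     (\<forall>X \<in> carrier_mat d d. \<forall>Y \<in> carrier_mat d d. L (X + Y) = L X + L Y) \<and>
     (\<forall>c. \<forall>X \<in> carrier_mat d d. L (c \<cdot>\<^sub>m X) = c \<cdot>\<^sub>m L X)"

definition elem_mat :: "nat \<Rightarrow> nat \<Rightarrow> nat \<Rightarrow> complex mat" where
  "elem_mat d i j = mat d d (\<lambda>(r, s). if r = i \<and> s = j then 1 else 0)"

definition block_mat :: "nat \<Rightarrow> nat \<Rightarrow> nat \<Rightarrow> complex mat \<Rightarrow> complex mat" where
  "block_mat d i j X = mat d d (\<lambda>(r, s). X $$ (i * d + r, j * d + s))"

text \<open>
  The tensor product of linear maps L (from dimension \<open>d\<^sub>1\<close> to \<open>e\<^sub>1\<close>) and M (from \<open>d\<^sub>2\<close> to \<open>e\<^sub>2\<close>).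
  An operator X on the tensor product space is the sum over \<open>i, j < d\<^sub>1\<close> of
  \<open>kron (elem_mat d\<^sub>1 i j) (block_mat d\<^sub>2 i j X)\<close>, and the product map is applied to each summand.
  The sum is taken entrywise because the type of matrices is not an additive monoid.
\<close>
definition tensor_map ::
  "nat \<Rightarrow> nat \<Rightarrow> nat \<Rightarrow> nat \<Rightarrow> (complex mat \<Rightarrow> complex mat) \<Rightarrow> (complex mat \<Rightarrow> complex mat)
     \<Rightarrow> complex mat \<Rightarrow> complex mat" where
  "tensor_map d\<^sub>1 e\<^sub>1 d\<^sub>2 e\<^sub>2 L M X = mat (e\<^sub>1 * e\<^sub>2) (e\<^sub>1 * e\<^sub>2)
     (\<lambda>(r, s). \<Sum>i<d\<^sub>1. \<Sum>j<d\<^sub>1. kron (L (elem_mat d\<^sub>1 i j)) (M (block_mat d\<^sub>2 i j X)) $$ (r, s))"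

primrec tensor_power_map ::
  "nat \<Rightarrow> nat \<Rightarrow> (complex mat \<Rightarrow> complex mat) \<Rightarrow> nat \<Rightarrow> complex mat \<Rightarrow> complex mat" where
  "tensor_power_map d e L 0 = (\<lambda>X. X)"
| "tensor_power_map d e L (Suc n) = tensor_map d e (d ^ n) (e ^ n) L (tensor_power_map d e L n)"

definition completely_positive :: "nat \<Rightarrow> nat \<Rightarrow> (complex mat \<Rightarrow> complex mat) \<Rightarrow> bool" where
  "completely_positive d e L \<longleftrightarrow>
     (\<forall>k X. psd_mat (k * d) X \<longrightarrow> psd_mat (k * e) (tensor_map k k d e (\<lambda>Y. Y) L X))"

definition trace_preserving :: "nat \<Rightarrow> (complex mat \<Rightarrow> complex mat) \<Rightarrow> bool" where
  "trace_preserving d L \<longleftrightarrow> (\<forall>X \<in> carrier_mat d d. mat_trace (L X) = mat_trace X)"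

definition quantum_channel :: "nat \<Rightarrow> nat \<Rightarrow> (complex mat \<Rightarrow> complex mat) \<Rightarrow> bool" where
  "quantum_channel d e L \<longleftrightarrow>
     linear_op_map d e L \<and> completely_positive d e L \<and> trace_preserving d L"

section \<open>Quantum secret sharing\<close>

text \<open>
  An access structure is a set \<open>\<A>\<close> of qualified sets. The input system has dimension dA, the
  joint system of \<open>l \<in> \<A>\<close> has dimension \<open>dB l\<close>, and \<open>N l\<close> is the channel from the dealer to \<open>l\<close>.
\<close>

definition secret_dim :: "real \<Rightarrow> nat \<Rightarrow> nat" where
  "secret_dim R n = nat (max 1 \<lfloor>2 powr (real n * R)\<rfloor>)"

definition qss_code ::
  "'l set \<Rightarrow> nat \<Rightarrow> ('l \<Rightarrow> nat) \<Rightarrow> real \<Rightarrow> nat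
     \<Rightarrow> (complex mat \<Rightarrow> complex mat) \<Rightarrow> ('l \<Rightarrow> complex mat \<Rightarrow> complex mat) \<Rightarrow> bool" where
  "qss_code \<A> dA dB R n F D \<longleftrightarrow>
     quantum_channel (secret_dim R n) (dA ^ n) F \<and>
     (\<forall>l \<in> \<A>. quantum_channel (dB l ^ n) (secret_dim R n) (D l))"

definition qss_achievable ::
  "'l set \<Rightarrow> nat \<Rightarrow> ('l \<Rightarrow> nat) \<Rightarrow> ('l \<Rightarrow> complex mat \<Rightarrow> complex mat) \<Rightarrow> real \<Rightarrow> bool" where
  "qss_achievable \<A> dA dB N R \<longleftrightarrow> 0 \<le> R \<and>
     (\<forall>\<epsilon>>0. \<forall>\<delta>>0. \<forall>\<^sub>F n in sequentially. \<exists>F D. qss_code \<A> dA dB (R - \<delta>) n F D \<and>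
        (let s = secret_dim (R - \<delta>) n in
         \<forall>l \<in> \<A>. \<forall>\<phi> \<in> carrier_vec (s * s). \<phi> \<bullet>c \<phi> = 1 \<longrightarrow>
           fidelity (ket_bra \<phi>)
             (tensor_map s s s s (\<lambda>Y. Y) (D l \<circ> tensor_power_map dA (dB l) (N l) n \<circ> F)
                (ket_bra \<phi>))
           \<ge> 1 - \<epsilon>))"

text \<open>Extended reals make the supremum unconditionally meaningful.\<close>
definition qss_capacity ::
  "'l set \<Rightarrow> nat \<Rightarrow> ('l \<Rightarrow> nat) \<Rightarrow> ('l \<Rightarrow> complex mat \<Rightarrow> complex mat) \<Rightarrow> ereal" where
  "qss_capacity \<A> dA dB N = (SUP R \<in> {R. qss_achievable \<A> dA dB N R}. ereal R)"

section \<open>The threshold access structure and the dephasing channel\<close>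

datatype participant = Part_a | Part_b | Part_c

definition threshold_2_3 :: "participant set set" where
  "threshold_2_3 = {{Part_a, Part_b}, {Part_a, Part_c}, {Part_b, Part_c}, {Part_a, Part_b, Part_c}}"

definition phase_flip :: "complex mat" where
  "phase_flip = mat_diag 3 (\<lambda>j. exp (2 * complex_of_real pi * \<i> * of_nat j / 3))"

definition dephasing :: "real \<Rightarrow> complex mat \<Rightarrow> complex mat" where
  "dephasing p \<rho> = complex_of_real (1 - p) \<cdot>\<^sub>m \<rho>
     + complex_of_real p \<cdot>\<^sub>m (phase_flip * \<rho> * mat_adjoint phase_flip)"

text \<open>At p = 0 and p = 1 the value is 0, since the vanishing factor annihilates the logarithm.\<close>
definition binary_entropy :: "real \<Rightarrow> real" where
  "binary_entropy p = - p * log 2 p - (1 - p) * log 2 (1 - p)"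

end

theory Submission
  imports
    Defs
    "HOL-Analysis.L2_Norm"
    "HOL-Real_Asymp.Real_Asymp"
    "Jordan_Normal_Form.Spectral_Radius"
begin

text \<open>
  The n-fold dephasing channel with parameter p applies the phase operator of a random
  x in the n-th power of Z/3, whose coordinates are independent and equal to 1 with probability p
  and to 0 otherwise. By Chebyshev's inequality x lies up to small probability in a typical set of
  about \<open>2 powr (n * H)\<close> elements, each of probability about \<open>2 powr - (n * H)\<close>.

  Achievability: in the Fourier basis phase errors are translations. A linear code C with
  \<open>3 ^ k\<close> elements, built by adding one generator at a time, is chosen such that few typical errors
  of any of the channels differ from another typical error by a code word. The errors without such
  a partner are corrected perfectly. One typical set, the union over all channels, serves all of
  them, so even the decoder need not know the qualified set.

  Converse: let f x be the entanglement fidelity of the code when the phase error is x. The uniform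
  average of f over all \<open>3 ^ n\<close> errors is that of a completely dephasing, hence entanglement breaking,
  channel and so at most 1/s for a secret of dimension s. As almost all of the weight lies on errors
  of probability about \<open>2 powr - (n * H)\<close>, the fidelity is at most about \<open>2 powr - (n * H) * 3 ^ n / s\<close>.
\<close>

section \<open>Positive matrices\<close>

text \<open>Both directions rest on one reduction: against a pure state the fidelity is the
  expectation value <phi|sigma|phi>, hence linear in the output and additive over the phase errors.
  Since the fidelity is defined through square roots, this needs existence and uniqueness of
  positive square roots. In the direct part, the Kraus operators that belong to corrected errors are
  multiples of the identity on the secret, so one bound covers every input, entangled or not. The
  rate comes from packing: about \<open>2 powr (n * H)\<close> typical errors must be translated to
  nearly disjoint sets inside \<open>3 ^ n\<close> Fourier labels. A union over finitely many
  channels enlarges the set of errors by a constant factor only, so the largest entropy decides. The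
  secret dimension s is rarely a power of 3; an s-element part of a slightly larger code is
  used.\<close>

definition qform :: "nat \<Rightarrow> complex mat \<Rightarrow> (nat \<Rightarrow> complex) \<Rightarrow> complex" where
  "qform d A v = (\<Sum>i<d. \<Sum>j<d. cnj (v i) * A $$ (i, j) * v j)"

text \<open>Test vectors become plain functions, so that later ones can be written as lambda terms
  without carrier conditions; only their values below d enter.\<close>

lemma psd_mat_iff:
  "psd_mat d A \<longleftrightarrow> A \<in> carrier_mat d d \<and> (\<forall>v. 0 \<le> qform d A v)"
proof -
  have eq: "(A *\<^sub>v v) \<bullet>c v = qform d A (\<lambda>i. v $ i)"
    if A: "A \<in> carrier_mat d d" and v: "v \<in> carrier_vec d" for v
    using A v by (auto simp: qform_def scalar_prod_def sum_distrib_left sum_distrib_right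
        atLeast0LessThan algebra_simps intro!: sum.cong)
  have eq2: "qform d A v = (A *\<^sub>v vec d v) \<bullet>c vec d v" if A: "A \<in> carrier_mat d d" for v
    by (subst eq[OF A]) (auto simp: qform_def)
  show ?thesis
    unfolding psd_mat_def using eq eq2 by (metis vec_carrier)
qed

lemma psd_mat_carrier: "psd_mat d A \<Longrightarrow> A \<in> carrier_mat d d"
  by (simp add: psd_mat_def)

lemma psd_mat_qform: "psd_mat d A \<Longrightarrow> 0 \<le> qform d A v"
  by (simp add: psd_mat_iff)

text \<open>Vectors supported on two indices reduce Hermitian symmetry and the entry bound to 2 by 2
  principal submatrices.\<close>

lemma qform_two_point:
  assumes "i < d" "j < d" "i \<noteq> j"
  shows "qform d A ((\<lambda>_. 0)(i := a, j := b)) =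
    cnj a * A $$ (i, i) * a + cnj a * A $$ (i, j) * b
      + cnj b * A $$ (j, i) * a + cnj b * A $$ (j, j) * b"
proof -
  let ?v = "(\<lambda>_. 0)(i := a, j := b)"
  have S: "(\<Sum>l<d. f l * ?v l) = f i * a + f j * b" for f :: "nat \<Rightarrow> complex"
  proof -
    have "(\<Sum>l<d. f l * ?v l) = (\<Sum>l\<in>{i, j}. f l * ?v l)"
      using assms by (intro sum.mono_neutral_right) auto
    then show ?thesis using assms by simp
  qed
  have S': "(\<Sum>l<d. cnj (?v l) * f l) = cnj a * f i + cnj b * f j" for f :: "nat \<Rightarrow> complex"
  proof -
    have "(\<Sum>l<d. cnj (?v l) * f l) = (\<Sum>l\<in>{i, j}. cnj (?v l) * f l)"
      using assms by (intro sum.mono_neutral_right) auto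
    then show ?thesis using assms by simp
  qed
  have "qform d A ?v = (\<Sum>k<d. cnj (?v k) * (\<Sum>l<d. A $$ (k, l) * ?v l))"
    by (simp only: qform_def sum_distrib_left mult.assoc)
  then show ?thesis by (simp only: S S') (simp add: algebra_simps)
qed

lemma qform_one_point:
  assumes "i < d"
  shows "qform d A ((\<lambda>_. 0)(i := a)) = cnj a * A $$ (i, i) * a"
proof -
  let ?v = "(\<lambda>_. 0)(i := a)"
  have "qform d A ?v = (\<Sum>k<d. cnj (?v k) * (\<Sum>l<d. A $$ (k, l) * ?v l))"
    by (simp only: qform_def sum_distrib_left mult.assoc)
  also have "\<dots> = (\<Sum>k\<in>{i}. cnj (?v k) * (\<Sum>l<d. A $$ (k, l) * ?v l))"
    using assms by (intro sum.mono_neutral_right) auto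
  also have "(\<Sum>l<d. A $$ (i, l) * ?v l) = (\<Sum>l\<in>{i}. A $$ (i, l) * ?v l)"
    using assms by (intro sum.mono_neutral_right) auto
  then have "(\<Sum>k\<in>{i}. cnj (?v k) * (\<Sum>l<d. A $$ (k, l) * ?v l)) = cnj a * (A $$ (i, i) * a)"
    by simp
  finally show ?thesis by simp
qed

lemma psd_diag_nonneg:
  assumes "psd_mat d A" "i < d"
  shows "0 \<le> A $$ (i, i)"
  using psd_mat_qform[OF assms(1), of "(\<lambda>_. 0)(i := 1)"] qform_one_point[OF assms(2), of A 1] by simp

lemma psd_hermitian:
  assumes "psd_mat d A" "i < d" "j < d"
  shows "A $$ (j, i) = cnj (A $$ (i, j))"
proof (cases "i = j")
  case True
  then show ?thesis
    using psd_diag_nonneg[OF assms(1,2)] by (auto simp: less_eq_complex_def complex_eq_iff)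
next
  case False
  note q = psd_mat_qform[OF assms(1), of "(\<lambda>_. 0)(i := a, j := b)" for a b,
      unfolded qform_two_point[OF assms(2,3) False]]
  \<comment> \<open>The vector (1, 1) makes the sum of the two off-diagonal entries real; the vector
    (1, i) makes their difference imaginary.\<close>
  show ?thesis
    using q[of 1 1] q[of 1 \<i>] psd_diag_nonneg[OF assms(1,2)] psd_diag_nonneg[OF assms(1,3)]
    by (auto simp: less_eq_complex_def complex_eq_iff)
qed

lemma psd_diag_of_real:
  assumes "psd_mat d A" "i < d"
  shows "A $$ (i, i) = of_real (Re (A $$ (i, i)))" "0 \<le> Re (A $$ (i, i))"
  using psd_diag_nonneg[OF assms] by (auto simp: less_eq_complex_def complex_eq_iff)

lemma psd_entry_bound:
  assumes A: "psd_mat d A" and i: "i < d" and j: "j < d"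
  shows "(cmod (A $$ (i, j)))\<^sup>2 \<le> Re (A $$ (i, i)) * Re (A $$ (j, j))"
proof (cases "i = j")
  case True
  then show ?thesis
    by (metis A i norm_of_real order_refl power2_abs power2_eq_square psd_diag_of_real(1))
next
  case False
  define x y z where "x = Re (A $$ (i, i))" "y = Re (A $$ (j, j))" "z = A $$ (i, j)"
  have Aii: "A $$ (i, i) = of_real x" and Ajj: "A $$ (j, j) = of_real y"
    and x: "0 \<le> x" and y: "0 \<le> y"
    using psd_diag_of_real[OF A i] psd_diag_of_real[OF A j] by (auto simp: x_y_z_def)
  have Aji: "A $$ (j, i) = cnj z" using psd_hermitian[OF A i j] by (simp add: x_y_z_def)
  have q: "0 \<le> Re (cnj a * of_real x * a + cnj a * z * b + cnj b * cnj z * a + cnj b * of_real y * b)"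
    for a b
    using psd_mat_qform[OF A, of "(\<lambda>_. 0)(i := a, j := b)"]
    unfolding qform_two_point[OF i j False] Aii Ajj Aji
    by (auto simp: less_eq_complex_def x_y_z_def)
  have n: "(cmod z)\<^sup>2 = Re z * Re z + Im z * Im z" by (simp add: cmod_def power2_eq_square)
  \<comment> \<open>The first two vectors yield the determinant multiplied by a diagonal entry. The
    third settles \<open>y = 0\<close>, where it forces z to vanish if x does.\<close>
  have 1: "0 \<le> y * (x * y - (cmod z)\<^sup>2)"
    using q[of "of_real y" "- cnj z"] by (simp add: n algebra_simps)
  have 2: "0 \<le> x * (x * y - (cmod z)\<^sup>2)"
    using q[of "z" "- of_real x"] by (simp add: n algebra_simps)
  have 3: "0 \<le> x + (cmod z)\<^sup>2 * (y - 2)"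
    using q[of 1 "- cnj z"] by (simp add: n algebra_simps)
  have "(cmod z)\<^sup>2 \<le> x * y"
  proof (cases "y = 0")
    case True
    then show ?thesis
      by (smt (verit, best) "2" "3" mult_eq_0_iff mult_le_0_iff mult_minus_right x zero_le_power2)
  next
    case False
    then show ?thesis using 1 y by (smt (verit) mult_pos_neg)
  qed
  then show ?thesis by (simp add: x_y_z_def)
qed

lemma sum_mult_square_le:
  fixes a b :: "'i \<Rightarrow> real"
  shows "(\<Sum>i\<in>I. a i * b i)\<^sup>2 \<le> (\<Sum>i\<in>I. (a i)\<^sup>2) * (\<Sum>i\<in>I. (b i)\<^sup>2)"
proof -
  have "\<bar>\<Sum>i\<in>I. a i * b i\<bar> \<le> L2_set a I * L2_set b I"
    by (rule order_trans[OF sum_abs]) (simp add: abs_mult L2_set_mult_ineq)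
  then have "\<bar>\<Sum>i\<in>I. a i * b i\<bar>\<^sup>2 \<le> (L2_set a I * L2_set b I)\<^sup>2"
    by (rule power_mono) simp
  then show ?thesis
    by (simp add: power_mult_distrib L2_set_def sum_nonneg)
qed

text \<open>Entries are dominated by geometric means of diagonal entries, and Cauchy-Schwarz turns
  the resulting square into the product of the traces. The sum is the trace of A times the transpose
  of B, the form in which encoder and decoder meet in the converse.\<close>

lemma psd_pairing_bound:
  assumes A: "psd_mat d A" and B: "psd_mat d B"
  shows "cmod (\<Sum>i<d. \<Sum>j<d. A $$ (i, j) * B $$ (i, j))
    \<le> (\<Sum>i<d. Re (A $$ (i, i))) * (\<Sum>i<d. Re (B $$ (i, i)))"
proof -
  define a b where "a i = sqrt (Re (A $$ (i, i)))" and "b i = sqrt (Re (B $$ (i, i)))" for i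
  have ab: "(a i)\<^sup>2 = Re (A $$ (i, i))" "(b i)\<^sup>2 = Re (B $$ (i, i))" "0 \<le> a i" "0 \<le> b i"
    if "i < d" for i
    using psd_diag_of_real[OF A that] psd_diag_of_real[OF B that] by (auto simp: a_def b_def)
  have bound: "cmod (M $$ (i, j)) \<le> sqrt (Re (M $$ (i, i))) * sqrt (Re (M $$ (j, j)))"
    if "psd_mat d M" "i < d" "j < d" for M i j
    using psd_entry_bound[OF that] by (simp add: real_le_rsqrt flip: real_sqrt_mult)
  have "cmod (\<Sum>i<d. \<Sum>j<d. A $$ (i, j) * B $$ (i, j))
      \<le> (\<Sum>i<d. \<Sum>j<d. (a i * a j) * (b i * b j))"
    using bound[OF A] bound[OF B] ab
    by (intro sum_norm_le) (auto simp: norm_mult a_def b_def intro!: mult_mono)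
  also have "\<dots> = (\<Sum>i<d. a i * b i)\<^sup>2"
    by (simp add: power2_eq_square sum_product algebra_simps)
  also have "\<dots> \<le> (\<Sum>i<d. (a i)\<^sup>2) * (\<Sum>i<d. (b i)\<^sup>2)"
    by (rule sum_mult_square_le)
  finally show ?thesis using ab by simp
qed

lemma psd_gram_sum:
  assumes "A \<in> carrier_mat d d" "finite I"
    and "\<And>i j. i < d \<Longrightarrow> j < d \<Longrightarrow> A $$ (i, j) = (\<Sum>k\<in>I. w k i * cnj (w k j))"
  shows "psd_mat d A"
proof -
  have "qform d A v = (\<Sum>k\<in>I. of_real ((cmod (\<Sum>i<d. cnj (v i) * w k i))\<^sup>2))" for v
  proof -
    have "qform d A v = (\<Sum>i<d. \<Sum>j<d. \<Sum>k\<in>I. cnj (v i) * w k i * (v j * cnj (w k j)))"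
      by (simp add: qform_def assms(3) sum_distrib_left sum_distrib_right algebra_simps)
    also have "\<dots> = (\<Sum>k\<in>I. \<Sum>i<d. \<Sum>j<d. cnj (v i) * w k i * (v j * cnj (w k j)))"
      by (subst sum.swap[of _ _ I], rule sum.cong[OF refl], rule sum.swap)
    also have "\<dots> = (\<Sum>k\<in>I. (\<Sum>i<d. cnj (v i) * w k i) * cnj (\<Sum>j<d. cnj (v j) * w k j))"
      by (simp add: sum_product)
    finally show ?thesis by (simp only: complex_norm_square)
  qed
  then show ?thesis
    using assms(1) by (simp add: psd_mat_iff sum_nonneg less_eq_complex_def del: of_real_power)
qed

section \<open>Traces and square roots of positive matrices\<close>

lemma mat_mult_entry:
  assumes "A \<in> carrier_mat l m" "B \<in> carrier_mat m n" "i < l" "j < n"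
  shows "(A * B) $$ (i, j) = (\<Sum>k<m. A $$ (i, k) * B $$ (k, j))"
  using assms by (simp add: scalar_prod_def atLeast0LessThan)

lemma mat_adjoint_carrier [simp]: "A \<in> carrier_mat m n \<Longrightarrow> mat_adjoint A \<in> carrier_mat n m"
  unfolding mat_adjoint_def by (auto simp: mat_of_rows_def)

lemma mat_adjoint_dims [simp]:
  "dim_row (mat_adjoint A) = dim_col A" "dim_col (mat_adjoint A) = dim_row A"
  unfolding mat_adjoint_def by (auto simp: mat_of_rows_def)

lemma mat_adjoint_entry [simp]:
  assumes "A \<in> carrier_mat m n" "i < n" "j < m"
  shows "mat_adjoint A $$ (i, j) = cnj (A $$ (j, i))"
  using assms unfolding mat_adjoint_def by (simp add: mat_of_rows_index)

lemma mat_adjoint_involutive: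
  fixes A :: "complex mat"
  assumes "A \<in> carrier_mat m n"
  shows "mat_adjoint (mat_adjoint A) = A"
proof (rule eq_matI)
  have dims: "dim_row (mat_adjoint (mat_adjoint A)) = m" "dim_col (mat_adjoint (mat_adjoint A)) = n"
    using mat_adjoint_carrier[OF mat_adjoint_carrier[OF assms]] by auto
  show "dim_row (mat_adjoint (mat_adjoint A)) = dim_row A" "dim_col (mat_adjoint (mat_adjoint A)) = dim_col A"
    using dims assms by auto
  fix i j assume "i < dim_row A" "j < dim_col A"
  then show "mat_adjoint (mat_adjoint A) $$ (i, j) = A $$ (i, j)"
    using assms mat_adjoint_carrier[OF assms] by (subst mat_adjoint_entry) auto
qed

lemma mat_trace_eq: "A \<in> carrier_mat d d \<Longrightarrow> mat_trace A = (\<Sum>i<d. A $$ (i, i))"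
  by (simp add: mat_trace_def)

lemma mat_trace_mult_commute:
  assumes "A \<in> carrier_mat d d" "B \<in> carrier_mat d d"
  shows "mat_trace (A * B) = mat_trace (B * A)"
proof -
  have "mat_trace (A * B) = (\<Sum>i<d. \<Sum>k<d. A $$ (i, k) * B $$ (k, i))"
    using assms by (simp add: mat_trace_eq[of _ d] mat_mult_entry[OF assms] del: index_mult_mat)
  also have "\<dots> = (\<Sum>k<d. \<Sum>i<d. B $$ (k, i) * A $$ (i, k))"
    by (subst sum.swap) (simp add: mult.commute)
  finally show ?thesis
    using assms by (simp add: mat_trace_eq[of _ d] mat_mult_entry[OF assms(2,1)] del: index_mult_mat)
qed

lemma mat_trace_add:
  assumes "A \<in> carrier_mat d d" "B \<in> carrier_mat d d"
  shows "mat_trace (A + B) = mat_trace A + mat_trace B"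
  using assms by (simp add: mat_trace_eq[of _ d] sum.distrib)

text \<open>The form at v is the form of A at the adjoint of W applied to v.\<close>

lemma psd_sandwich:
  assumes A: "psd_mat d A" and W: "W \<in> carrier_mat m d"
  shows "psd_mat m (W * A * mat_adjoint W)"
proof -
  have Ac: "A \<in> carrier_mat d d" using A by (rule psd_mat_carrier)
  have Wa: "mat_adjoint W \<in> carrier_mat d m" using W by simp
  have WA: "W * A \<in> carrier_mat m d" using W Ac by simp
  have entry: "(W * A * mat_adjoint W) $$ (i, j) =
      (\<Sum>l<d. \<Sum>k<d. W $$ (i, k) * A $$ (k, l) * cnj (W $$ (j, l)))" if "i < m" "j < m" for i j
    using that by (simp add: mat_mult_entry[OF WA Wa] mat_mult_entry[OF W Ac]
        mat_adjoint_entry[OF W] sum_distrib_right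
        del: index_mult_mat)
  have "qform m (W * A * mat_adjoint W) v = qform d A (\<lambda>l. \<Sum>j<m. cnj (W $$ (j, l)) * v j)" for v
  proof -
    have "qform m (W * A * mat_adjoint W) v =
        (\<Sum>i<m. \<Sum>j<m. \<Sum>l<d. \<Sum>k<d. cnj (v i) * (W $$ (i, k) * A $$ (k, l) * cnj (W $$ (j, l))) * v j)"
      by (simp add: qform_def entry sum_distrib_left sum_distrib_right del: index_mult_mat)
    also have "\<dots> = (\<Sum>(i, j, l, k)\<in>{..<m} \<times> {..<m} \<times> {..<d} \<times> {..<d}.
        cnj (v i) * (W $$ (i, k) * A $$ (k, l) * cnj (W $$ (j, l))) * v j)"
      by (simp add: sum.cartesian_product)
    also have "\<dots> = (\<Sum>(k, l, i, j)\<in>{..<d} \<times> {..<d} \<times> {..<m} \<times> {..<m}.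
        cnj (v i) * (W $$ (i, k) * A $$ (k, l) * cnj (W $$ (j, l))) * v j)"
      by (rule sum.reindex_bij_witness[where i = "\<lambda>(k, l, i, j). (i, j, l, k)"
            and j = "\<lambda>(i, j, l, k). (k, l, i, j)"]) auto
    also have "\<dots> = (\<Sum>k<d. \<Sum>l<d. \<Sum>i<m. \<Sum>j<m.
        cnj (v i) * (W $$ (i, k) * A $$ (k, l) * cnj (W $$ (j, l))) * v j)"
      by (simp add: sum.cartesian_product)
    also have "\<dots> = qform d A (\<lambda>l. \<Sum>j<m. cnj (W $$ (j, l)) * v j)"
      by (simp add: qform_def sum_distrib_left sum_distrib_right algebra_simps)
    finally show ?thesis .
  qed
  then show ?thesis
    using psd_mat_qform[OF A] WA Wa by (simp add: psd_mat_iff)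
qed

lemma psd_trace_zero:
  assumes A: "psd_mat d A" and tr: "mat_trace A = 0"
  shows "A = 0\<^sub>m d d"
proof (rule eq_matI)
  have Ac: "A \<in> carrier_mat d d" using A by (rule psd_mat_carrier)
  show "dim_row A = dim_row (0\<^sub>m d d)" "dim_col A = dim_col (0\<^sub>m d d)" using Ac by auto
  have "(\<Sum>i<d. Re (A $$ (i, i))) = 0"
    using tr Ac by (simp add: mat_trace_eq complex_eq_iff)
  then have diag: "Re (A $$ (i, i)) = 0" if "i < d" for i
    using that psd_diag_of_real(2)[OF A] by (subst (asm) sum_nonneg_eq_0_iff) auto
  fix i j assume "i < dim_row (0\<^sub>m d d :: complex mat)" "j < dim_col (0\<^sub>m d d :: complex mat)"
  then show "A $$ (i, j) = 0\<^sub>m d d $$ (i, j)"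
    using psd_entry_bound[OF A, of i j] diag by simp
qed

text \<open>The diagonal entries of \<open>H * H\<close> are the squared norms of the rows of
  H.\<close>

lemma hermitian_square_zero:
  fixes H :: "complex mat"
  assumes H: "H \<in> carrier_mat d d" and adj: "mat_adjoint H = H" and zero: "H * H = 0\<^sub>m d d"
  shows "H = 0\<^sub>m d d"
proof (rule eq_matI)
  show "dim_row H = dim_row (0\<^sub>m d d)" "dim_col H = dim_col (0\<^sub>m d d)" using H by auto
  fix i j assume "i < dim_row (0\<^sub>m d d :: complex mat)" "j < dim_col (0\<^sub>m d d :: complex mat)"
  then have i: "i < d" and j: "j < d" by auto
  have herm: "H $$ (k, i) = cnj (H $$ (i, k))" if "k < d" for k
    using mat_adjoint_entry[OF H that i] adj by simp
  have "of_real (\<Sum>k<d. (cmod (H $$ (i, k)))\<^sup>2) = (H * H) $$ (i, i)"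
    using i herm by (simp add: mat_mult_entry[OF H H] complex_norm_square
        del: index_mult_mat of_real_power)
  then have "of_real (\<Sum>k<d. (cmod (H $$ (i, k)))\<^sup>2) = (0 :: complex)"
    using zero i by simp
  then have "(\<Sum>k<d. (cmod (H $$ (i, k)))\<^sup>2) = 0" by (simp only: of_real_eq_0_iff)
  then show "H $$ (i, j) = 0\<^sub>m d d $$ (i, j)"
    using i j by (simp add: sum_nonneg_eq_0_iff)
qed

text \<open>
  With D = B - C one has BD + DC = 0, so the traces of the positive matrices DBD and DCD add up
  to 0. Hence both vanish, their difference is the cube of D, and D = 0.
\<close>
lemma psd_square_injective:
  assumes B: "psd_mat d B" and C: "psd_mat d C" and eq: "B * B = C * C"
  shows "B = C"
proof -
  note Bc = psd_mat_carrier[OF B] and Cc = psd_mat_carrier[OF C]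
  define D where "D = B - C"
  have D: "D \<in> carrier_mat d d" unfolding D_def by (rule minus_carrier_mat[OF Cc])
  have adj: "mat_adjoint D = D"
  proof (rule eq_matI)
    show "dim_row (mat_adjoint D) = dim_row D" "dim_col (mat_adjoint D) = dim_col D"
      using D mat_adjoint_carrier[OF D] by auto
    fix i j assume "i < dim_row D" "j < dim_col D"
    then show "mat_adjoint D $$ (i, j) = D $$ (i, j)"
      using D Bc Cc psd_hermitian[OF B, of j i] psd_hermitian[OF C, of j i]
      by (simp add: mat_adjoint_entry[OF D]) (simp add: D_def)
  qed
  have DBD: "psd_mat d (D * B * D)" and DCD: "psd_mat d (D * C * D)"
    using psd_sandwich[OF B D] psd_sandwich[OF C D] adj by simp_all
  have BD: "B * D = B * B - B * C"
    unfolding D_def using Bc Cc by (rule mult_minus_distrib_mat[OF Bc])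
  have DC: "D * C = B * C - C * C"
    unfolding D_def by (rule minus_mult_distrib_mat[OF Bc Cc Cc])
  have "B * D + D * C = 0\<^sub>m d d"
    unfolding BD DC eq using Bc Cc by (intro eq_matI) auto
  then have "D * (B * D + D * C) = 0\<^sub>m d d" using D by simp
  then have sum0: "D * B * D + D * (D * C) = 0\<^sub>m d d"
    using D Bc Cc by (simp add: mult_add_distrib_mat[OF D, of "B * D" d "D * C"])
  have "mat_trace (D * (D * C)) = mat_trace (D * C * D)"
    using D Cc by (intro mat_trace_mult_commute[of _ d]) auto
  then have "mat_trace (D * B * D) + mat_trace (D * C * D) = mat_trace (0\<^sub>m d d)"
    using D Bc Cc sum0 by (metis mat_trace_add mult_carrier_mat)
  also have "\<dots> = 0" by (simp add: mat_trace_def)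
  finally have tr: "mat_trace (D * B * D) + mat_trace (D * C * D) = 0" .
  have nonneg: "0 \<le> mat_trace M" if "psd_mat d M" for M
    using psd_diag_nonneg[OF that]
    by (auto simp: mat_trace_eq[OF psd_mat_carrier[OF that]] less_eq_complex_def intro!: sum_nonneg)
  have "mat_trace (D * B * D) = 0" "mat_trace (D * C * D) = 0"
    using nonneg[OF DBD] nonneg[OF DCD] tr by (auto simp: less_eq_complex_def complex_eq_iff)
  from psd_trace_zero[OF DBD this(1)] psd_trace_zero[OF DCD this(2)]
  have z: "D * B * D = 0\<^sub>m d d" "D * C * D = 0\<^sub>m d d"
    by simp_all
  have "D * D * D = D * (B - C) * D" by (simp add: D_def)
  also have "\<dots> = D * B * D - D * C * D"
    using D Bc Cc by (simp add: mult_minus_distrib_mat[of _ d d] minus_mult_distrib_mat[of _ d d])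
  also have "\<dots> = 0\<^sub>m d d" using z by simp
  finally have DDD: "D * D * D = 0\<^sub>m d d" .
  \<comment> \<open>The vanishing cube makes the square of \<open>D * D\<close> vanish. As
    \<open>D * D\<close> and D are both Hermitian, \<open>hermitian_square_zero\<close> applies to
    \<open>D * D\<close> and then to D.\<close>
  have "(D * D) * (D * D) = (D * D * D) * D"
    by (rule assoc_mult_mat[OF mult_carrier_mat[OF D D] D D, symmetric])
  also have "\<dots> = 0\<^sub>m d d" unfolding DDD by (rule left_mult_zero_mat[OF D])
  finally have "(D * D) * (D * D) = 0\<^sub>m d d" .
  note sq = this
  have adjDD: "mat_adjoint (D * D) = D * D"
  proof (rule eq_matI)
    have DD: "D * D \<in> carrier_mat d d" using D by simp
    show "dim_row (mat_adjoint (D * D)) = dim_row (D * D)" "dim_col (mat_adjoint (D * D)) = dim_col (D * D)"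
      using D by simp_all
    have h: "cnj (D $$ (a, b)) = D $$ (b, a)" if "a < d" "b < d" for a b
      using mat_adjoint_entry[OF D that(2,1)] unfolding adj by (rule sym)
    fix i j assume "i < dim_row (D * D)" "j < dim_col (D * D)"
    then have "i < d" "j < d" using D by simp_all
    then show "mat_adjoint (D * D) $$ (i, j) = (D * D) $$ (i, j)"
      unfolding mat_adjoint_entry[OF DD \<open>i < d\<close> \<open>j < d\<close>] mat_mult_entry[OF D D \<open>i < d\<close> \<open>j < d\<close>]
        mat_mult_entry[OF D D \<open>j < d\<close> \<open>i < d\<close>] cnj_sum complex_cnj_mult
      by (intro sum.cong refl) (simp add: h mult.commute)
  qed
  have "D = 0\<^sub>m d d"
    by (rule hermitian_square_zero[OF D adj hermitian_square_zero[OF mult_carrier_mat[OF D D] adjDD sq]])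
  then have entry: "D $$ (i, j) = 0" if "i < d" "j < d" for i j using that by simp
  show ?thesis
  proof (rule eq_matI)
    show "dim_row B = dim_row C" "dim_col B = dim_col C" using Bc Cc by auto
    fix i j assume "i < dim_row C" "j < dim_col C"
    then show "B $$ (i, j) = C $$ (i, j)" using entry[of i j] Bc Cc by (simp add: D_def)
  qed
qed

section \<open>Existence of positive square roots\<close>

definition diag_extend :: "nat \<Rightarrow> complex \<Rightarrow> complex mat \<Rightarrow> complex mat" where
  "diag_extend m c M = mat (Suc m) (Suc m) (\<lambda>(i, j).
     if i = 0 \<and> j = 0 then c else if i = 0 \<or> j = 0 then 0 else M $$ (i - 1, j - 1))"

lemma diag_extend_carrier [simp]: "diag_extend m c M \<in> carrier_mat (Suc m) (Suc m)"
  by (simp add: diag_extend_def)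

lemma qform_diag_extend:
  "qform (Suc m) (diag_extend m c M) v = cnj (v 0) * c * v 0 + qform m M (\<lambda>i. v (Suc i))"
  unfolding qform_def sum.lessThan_Suc_shift by (simp add: diag_extend_def)

lemma psd_diag_extend_iff:
  assumes "M \<in> carrier_mat m m"
  shows "psd_mat (Suc m) (diag_extend m c M) \<longleftrightarrow> 0 \<le> c \<and> psd_mat m M"
proof
  assume psd: "psd_mat (Suc m) (diag_extend m c M)"
  have "0 \<le> qform m M v" for v
    using psd_mat_qform[OF psd, of "case_nat 0 v"] by (simp add: qform_diag_extend)
  moreover have "0 \<le> c"
    using psd_mat_qform[OF psd, of "case_nat 1 (\<lambda>_. 0)"] unfolding qform_diag_extend by (simp add: qform_def)
  ultimately show "0 \<le> c \<and> psd_mat m M" using assms by (simp add: psd_mat_iff)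
next
  assume a: "0 \<le> c \<and> psd_mat m M"
  have "0 \<le> cnj (v 0) * c * v 0" for v :: "nat \<Rightarrow> complex"
  proof -
    have "0 \<le> Re c * ((Re (v 0))\<^sup>2 + (Im (v 0))\<^sup>2)" using a by (simp add: less_eq_complex_def)
    then show ?thesis using a by (simp add: less_eq_complex_def power2_eq_square algebra_simps)
  qed
  then show "psd_mat (Suc m) (diag_extend m c M)"
    using a psd_mat_qform by (auto simp: psd_mat_iff qform_diag_extend)
qed

lemma diag_extend_mult:
  assumes "M \<in> carrier_mat m m" "M' \<in> carrier_mat m m"
  shows "diag_extend m c M * diag_extend m c' M' = diag_extend m (c * c') (M * M')"
proof (rule eq_matI)
  note car = diag_extend_carrier[of m c M] diag_extend_carrier[of m c' M']
  fix i j assume "i < dim_row (diag_extend m (c * c') (M * M'))"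
    "j < dim_col (diag_extend m (c * c') (M * M'))"
  then have ij: "i < Suc m" "j < Suc m" by (auto simp: diag_extend_def)
  then show "(diag_extend m c M * diag_extend m c' M') $$ (i, j) = diag_extend m (c * c') (M * M') $$ (i, j)"
    unfolding mat_mult_entry[OF car ij] sum.lessThan_Suc_shift
    by (cases i; cases j) (simp_all add: diag_extend_def mat_mult_entry[OF assms] del: index_mult_mat(1))
qed (simp_all add: diag_extend_def)

text \<open>An eigenvector is completed to a basis and orthogonalized. Gram-Schmidt keeps the first
  vector, so after division by the norms the first column is still an eigenvector.\<close>

lemma unitary_with_eigenvector:
  fixes A :: "complex mat"
  assumes A: "A \<in> carrier_mat n n" and n: "n \<noteq> 0"
  obtains W e where "W \<in> carrier_mat n n" "mat_adjoint W * W = 1\<^sub>m n"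
    "\<And>k. k < n \<Longrightarrow> (A * W) $$ (k, 0) = e * W $$ (k, 0)"
proof -
  obtain e where "eigenvalue A e"
    using spectrum_non_empty[OF A] n by (auto simp: spectrum_def)
  then obtain v where ev: "eigenvector A v e" by (auto simp: eigenvalue_def)
  then have v: "v \<in> carrier_vec n" and v0: "v \<noteq> 0\<^sub>v n" and eq: "A *\<^sub>v v = e \<cdot>\<^sub>v v"
    using A unfolding eigenvector_def by auto
  define b where "b = basis_completion v"
  define ws where "ws = gram_schmidt n b"
  interpret cof_vec_space n "TYPE(complex)" .
  from basis_completion[OF v v0, folded b_def]
  have dist_b: "distinct b" and indep: "\<not> lin_dep (set b)" and b: "set b \<subseteq> carrier_vec n"
    and hdb: "hd b = v" and len_b: "length b = n" by auto
  from hdb len_b n obtain vs where bv: "b = v # vs" by (cases b) auto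
  from gram_schmidt_result[OF b dist_b indep refl, folded ws_def]
  have ws: "set ws \<subseteq> carrier_vec n" "corthogonal ws" "length ws = n"
    by (auto simp: len_b)
  from gram_schmidt_hd[OF v, of vs, folded bv] have hdws: "hd ws = v" unfolding ws_def .
  then have ws0: "ws ! 0 = v" using n ws(3) by (cases ws) auto
  have wsc: "ws ! j \<in> carrier_vec n" if "j < n" for j using ws that by auto
  define N where "N j = (\<Sum>k<n. (cmod ((ws ! j) $ k))\<^sup>2)" for j
  have sp: "(ws ! i) \<bullet>c (ws ! j) = (\<Sum>k<n. (ws ! i) $ k * cnj ((ws ! j) $ k))" if "i < n" "j < n" for i j
    using wsc[OF that(1)] wsc[OF that(2)] by (simp add: scalar_prod_def atLeast0LessThan)
  have spN: "(ws ! j) \<bullet>c (ws ! j) = of_real (N j)" if "j < n" for j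
    using that by (simp add: sp N_def complex_norm_square del: of_real_power)
  have orth: "(\<Sum>k<n. (ws ! i) $ k * cnj ((ws ! j) $ k)) = (if i = j then of_real (N j) else 0)"
    if "i < n" "j < n" for i j
    using sp[OF that] spN[OF that(2)] ws(2,3) that corthogonalD[OF ws(2), of i j] by (auto simp: sp)
  have Npos: "N j > 0" if "j < n" for j
  proof -
    have "N j \<noteq> 0" using corthogonalD[OF ws(2), of j j] that ws(3) spN[OF that] by auto
    moreover have "N j \<ge> 0" by (simp add: N_def sum_nonneg)
    ultimately show ?thesis by simp
  qed
  define W where "W = mat n n (\<lambda>(k, j). (ws ! j) $ k / of_real (sqrt (N j)))"
  have W: "W \<in> carrier_mat n n" by (simp add: W_def)
  have "mat_adjoint W * W = 1\<^sub>m n"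
  proof (rule eq_matI)
    fix i j assume "i < dim_row (1\<^sub>m n :: complex mat)" "j < dim_col (1\<^sub>m n :: complex mat)"
    then have ij: "i < n" "j < n" by auto
    have "(mat_adjoint W * W) $$ (i, j) = (\<Sum>k<n. mat_adjoint W $$ (i, k) * W $$ (k, j))"
      using ij by (rule mat_mult_entry[OF mat_adjoint_carrier[OF W] W])
    also have "\<dots> = (\<Sum>k<n. (ws ! j) $ k * cnj ((ws ! i) $ k)) / of_real (sqrt (N i) * sqrt (N j))"
      using ij by (simp add: mat_adjoint_entry[OF W] sum_divide_distrib) (simp add: W_def mult.commute)
    also have "\<dots> = 1\<^sub>m n $$ (i, j)"
      using ij Npos[OF ij(1)] by (cases "i = j") (simp_all add: orth flip: of_real_mult)
    finally show "(mat_adjoint W * W) $$ (i, j) = 1\<^sub>m n $$ (i, j)" .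
  qed (use W in auto)
  moreover have "(A * W) $$ (k, 0) = e * W $$ (k, 0)" if k: "k < n" for k
  proof -
    have n0: "0 < n" using n by simp
    have "(\<Sum>l<n. A $$ (k, l) * v $ l) = (A *\<^sub>v v) $ k"
      using A v k by (simp add: scalar_prod_def atLeast0LessThan)
    then have "(\<Sum>l<n. A $$ (k, l) * v $ l) = e * v $ k" using eq v k by simp
    then have "(\<Sum>l<n. A $$ (k, l) * v $ l) / of_real (sqrt (N 0)) = e * (v $ k / of_real (sqrt (N 0)))"
      by simp
    then show ?thesis
      using n0 k ws0 by (simp add: mat_mult_entry[OF A W] sum_divide_distrib del: index_mult_mat(1))
        (simp add: W_def)
  qed
  ultimately show thesis using that W by blast
qed

text \<open>Induction on the dimension. In an orthonormal basis that starts with an eigenvector, the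
  first column is a multiple of the first basis vector and Hermitian symmetry clears the first row
  as well. Then \<open>diag_extend\<close> splits off a nonnegative scalar, and the remaining block
  is covered by induction.\<close>

lemma psd_sqrt_exists:
  assumes "psd_mat n A"
  shows "\<exists>B. psd_mat n B \<and> B * B = A"
  using assms
proof (induction n arbitrary: A)
  case 0
  then have "A * A = A" by (intro eq_matI) (auto simp: psd_mat_def)
  then show ?case using 0 by blast
next
  case (Suc m)
  define n where "n = Suc m"
  have A: "psd_mat n A" and Ac: "A \<in> carrier_mat n n"
    using Suc.prems psd_mat_carrier by (auto simp: n_def)
  obtain W e where W: "W \<in> carrier_mat n n" and WW: "mat_adjoint W * W = 1\<^sub>m n"
    and ev: "\<And>k. k < n \<Longrightarrow> (A * W) $$ (k, 0) = e * W $$ (k, 0)"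
    using unitary_with_eigenvector[OF Ac] by (auto simp: n_def)
  define V where "V = mat_adjoint W"
  have V: "V \<in> carrier_mat n n" and adjV: "mat_adjoint V = W" and VW: "V * W = 1\<^sub>m n"
    using W WW by (auto simp: V_def mat_adjoint_involutive)
  have WV: "W * V = 1\<^sub>m n" using mat_mult_left_right_inverse[OF V W VW] .
  define A' where "A' = V * A * W"
  have A': "psd_mat n A'" using psd_sandwich[OF A V] by (simp add: A'_def adjV)
  note A'c = psd_mat_carrier[OF A']
  have A'0: "A' $$ (i, 0) = (if i = 0 then e else 0)" if i: "i < n" for i
  proof -
    have n0: "0 < n" by (simp add: n_def)
    have AW: "A * W \<in> carrier_mat n n" using Ac W by simp
    have "A' = V * (A * W)" using V Ac W by (simp add: A'_def)
    then have "A' $$ (i, 0) = (\<Sum>k<n. V $$ (i, k) * (A * W) $$ (k, 0))"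
      using mat_mult_entry[OF V AW i n0] by simp
    also have "\<dots> = e * (\<Sum>k<n. V $$ (i, k) * W $$ (k, 0))"
      by (simp add: ev sum_distrib_left algebra_simps del: index_mult_mat(1))
    also have "\<dots> = e * (V * W) $$ (i, 0)" using mat_mult_entry[OF V W i n0] by simp
    finally show ?thesis using i by (simp add: VW n_def)
  qed
  have A'0': "A' $$ (0, Suc j) = 0" if "Suc j < n" for j
    using psd_hermitian[OF A' that, of 0] A'0[OF that] by (simp add: n_def)
  define A3 where "A3 = mat m m (\<lambda>(i, j). A' $$ (Suc i, Suc j))"
  have A3c: "A3 \<in> carrier_mat m m" by (simp add: A3_def)
  have A'eq: "A' = diag_extend m e A3"
  proof (rule eq_matI)
    show "dim_row A' = dim_row (diag_extend m e A3)" "dim_col A' = dim_col (diag_extend m e A3)"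
      using A'c by (auto simp: diag_extend_def n_def)
    fix i j assume "i < dim_row (diag_extend m e A3)" "j < dim_col (diag_extend m e A3)"
    then have ij: "i < n" "j < n" by (auto simp: n_def diag_extend_def)
    show "A' $$ (i, j) = diag_extend m e A3 $$ (i, j)"
      using ij A'0[of i] A'0'[of "j - 1"]
      by (cases i; cases j) (simp_all add: diag_extend_def A3_def n_def)
  qed
  then have e: "0 \<le> e" and A3: "psd_mat m A3"
    using A' A3c psd_diag_extend_iff by (auto simp: n_def)
  obtain B3 where B3: "psd_mat m B3" "B3 * B3 = A3" using Suc.IH[OF A3] by blast
  note B3c = psd_mat_carrier[OF B3(1)]
  define r where "r = complex_of_real (sqrt (Re e))"
  have r: "0 \<le> r" "r * r = e"
    using e by (auto simp: r_def less_eq_complex_def complex_eq_iff)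
  define B' where "B' = diag_extend m r B3"
  have B': "psd_mat n B'" using psd_diag_extend_iff[OF B3c] r B3 by (simp add: B'_def n_def)
  have B'B': "B' * B' = A'" using diag_extend_mult[OF B3c B3c] r B3 by (simp add: B'_def A'eq)
  note B'c = psd_mat_carrier[OF B']
  define B where "B = W * B' * V"
  have "psd_mat n B" using psd_sandwich[OF B' W] by (simp add: B_def V_def)
  moreover have "B * B = A"
  proof -
    have "B * B = W * B' * (V * W) * (B' * V)"
      using W V B'c by (simp add: B_def assoc_mult_mat[of _ n n _ n _ n])
    also have "\<dots> = W * (B' * B') * V"
      using W V B'c by (simp add: VW assoc_mult_mat[of _ n n _ n _ n])
    also have "\<dots> = (W * V) * A * (W * V)"
      unfolding B'B' A'_def using W V Ac by (simp add: assoc_mult_mat[of _ n n _ n _ n])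
    finally show ?thesis using Ac by (simp add: WV)
  qed
  ultimately show ?case by (auto simp: n_def)
qed

section \<open>Fidelity with a pure state\<close>

lemma psd_sqrt_eqI:
  assumes "psd_mat d B" "B * B = A"
  shows "psd_sqrt A = B"
  unfolding psd_sqrt_def
proof (rule the_equality)
  have dim: "dim_row A = d" using assms psd_mat_carrier[OF assms(1)] by auto
  show "psd_mat (dim_row A) B \<and> B * B = A" using assms dim by simp
  show "C = B" if "psd_mat (dim_row A) C \<and> C * C = A" for C
    by (rule psd_square_injective[of d]) (use that assms dim in simp_all)
qed

lemma psd_sqrt_props:
  assumes "psd_mat d A"
  shows "psd_mat d (psd_sqrt A)" "psd_sqrt A * psd_sqrt A = A"
  using psd_sqrt_exists[OF assms] psd_sqrt_eqI by auto

lemma ket_bra_carrier: "v \<in> carrier_vec d \<Longrightarrow> ket_bra v \<in> carrier_mat d d"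
  by (auto simp: ket_bra_def)

lemma ket_bra_entry:
  "v \<in> carrier_vec d \<Longrightarrow> i < d \<Longrightarrow> j < d \<Longrightarrow> ket_bra v $$ (i, j) = v $ i * cnj (v $ j)"
  by (auto simp: ket_bra_def)

lemma psd_ket_bra: "v \<in> carrier_vec d \<Longrightarrow> psd_mat d (ket_bra v)"
  by (rule psd_gram_sum[where I = "{()}" and w = "\<lambda>_. ($) v"]) (auto simp: ket_bra_carrier ket_bra_entry)

lemma cscalar_self_eq:
  "v \<in> carrier_vec d \<Longrightarrow> v \<bullet>c v = of_real (\<Sum>i<d. (cmod (v $ i))\<^sup>2)"
  by (simp add: scalar_prod_def atLeast0LessThan complex_norm_square del: of_real_power)

lemma ket_bra_square:
  assumes v: "v \<in> carrier_vec d"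
  shows "ket_bra v * ket_bra v = (v \<bullet>c v) \<cdot>\<^sub>m ket_bra v"
proof (rule eq_matI)
  note c = ket_bra_carrier[OF v]
  fix i j assume "i < dim_row ((v \<bullet>c v) \<cdot>\<^sub>m ket_bra v)" "j < dim_col ((v \<bullet>c v) \<cdot>\<^sub>m ket_bra v)"
  then have ij: "i < d" "j < d" using c by auto
  have "(ket_bra v * ket_bra v) $$ (i, j) = (\<Sum>k<d. v $ k * cnj (v $ k)) * (v $ i * cnj (v $ j))"
    unfolding mat_mult_entry[OF c c ij] using ij
    by (simp add: ket_bra_entry[OF v] sum_distrib_left sum_distrib_right algebra_simps)
  then show "(ket_bra v * ket_bra v) $$ (i, j) = ((v \<bullet>c v) \<cdot>\<^sub>m ket_bra v) $$ (i, j)"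
    using ij v c by (simp add: ket_bra_entry[OF v] scalar_prod_def atLeast0LessThan)
qed (use ket_bra_carrier[OF v] in auto)

text \<open>The square root of a rank-one positive matrix is the matrix itself divided by the norm
  of w, and the trace of that root is the norm.\<close>

lemma trace_norm_rank_one:
  assumes M: "M \<in> carrier_mat d d" and w: "w \<in> carrier_vec d"
    and eq: "mat_adjoint M * M = ket_bra w"
  shows "(trace_norm M)\<^sup>2 = (\<Sum>i<d. (cmod (w $ i))\<^sup>2)"
proof -
  define N where "N = (\<Sum>i<d. (cmod (w $ i))\<^sup>2)"
  have N: "N \<ge> 0" by (simp add: N_def sum_nonneg)
  \<comment> \<open>For \<open>N = 0\<close> the factor is 0 because division by 0 yields 0;
    \<open>ket_bra w\<close> then vanishes too.\<close>
  define B where "B = complex_of_real (1 / sqrt N) \<cdot>\<^sub>m ket_bra w"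
  note c = ket_bra_carrier[OF w]
  have "psd_mat d B"
  proof (rule psd_gram_sum[where I = "{()}" and w = "\<lambda>_ i. of_real (sqrt (1 / sqrt N)) * w $ i"])
    have "complex_of_real (sqrt (1 / sqrt N)) * complex_of_real (sqrt (1 / sqrt N)) = of_real (1 / sqrt N)"
      using N by (simp flip: of_real_mult)
    then show "B $$ (i, j) = (\<Sum>k\<in>{()}. of_real (sqrt (1 / sqrt N)) * w $ i * cnj (of_real (sqrt (1 / sqrt N)) * w $ j))"
      if "i < d" "j < d" for i j
      using that c by (simp add: B_def ket_bra_entry[OF w] algebra_simps)
  qed (use c in \<open>auto simp: B_def\<close>)
  moreover have "B * B = ket_bra w"
  proof (cases "N = 0")
    case True
    then have w0: "w $ i = 0" if "i < d" for i
      using that by (simp add: N_def sum_nonneg_eq_0_iff)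
    then have k0: "ket_bra w $$ (i, j) = 0" if "i < d" "j < d" for i j
      using that by (simp add: ket_bra_entry[OF w])
    show ?thesis
    proof (rule eq_matI)
      have Bc: "B \<in> carrier_mat d d" using c by (simp add: B_def)
      fix i j assume "i < dim_row (ket_bra w)" "j < dim_col (ket_bra w)"
      then have ij: "i < d" "j < d" using c by auto
      have "B $$ (a, b) = 0" if "a < d" "b < d" for a b
        using that c by (simp add: B_def True)
      then show "(B * B) $$ (i, j) = ket_bra w $$ (i, j)"
        unfolding mat_mult_entry[OF Bc Bc ij] k0[OF ij] using ij by simp
    qed (use c in \<open>auto simp: B_def\<close>)
  next
    case False
    have "B * B = (of_real (1 / sqrt N) * of_real (1 / sqrt N)) \<cdot>\<^sub>m (ket_bra w * ket_bra w)"
      unfolding B_def mult_smult_assoc_mat[OF c smult_carrier_mat[OF c]] mult_smult_distrib[OF c c]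
      using c by (intro eq_matI) simp_all

    also have "\<dots> = of_real (1 / N * N) \<cdot>\<^sub>m ket_bra w"
      unfolding ket_bra_square[OF w] cscalar_self_eq[OF w] N_def[symmetric]
      using N by (intro eq_matI) (simp_all flip: of_real_mult)
    finally show ?thesis using False c by (metis divide_self_if eq_matI index_smult_mat mult.left_neutral nonzero_eq_divide_eq of_real_1)
  qed
  ultimately have "psd_sqrt (mat_adjoint M * M) = B"
    unfolding eq by (rule psd_sqrt_eqI)
  then have "trace_norm M = Re (mat_trace B)" by (simp add: trace_norm_def)
  also have "mat_trace B = of_real (1 / sqrt N * N)"
    using c by (simp add: mat_trace_eq[of _ d] B_def ket_bra_entry[OF w] N_def complex_norm_square
      sum_distrib_left sum_divide_distrib del: of_real_power)
  finally have "trace_norm M = sqrt N"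
    using N by (simp add: real_div_sqrt)
  then show ?thesis using N by (simp add: N_def)
qed

text \<open>The projection P onto \<phi> is its own square root. With S the root of \<sigma>, the
  squared modulus of \<open>P * S\<close> is \<open>S * P * S\<close>, the rank-one matrix of the
  vector S \<phi>; so the fidelity is the squared norm of S \<phi>, which is the expectation of
  \<sigma>.\<close>

lemma fidelity_ket_bra:
  assumes \<phi>: "\<phi> \<in> carrier_vec d" and unit: "\<phi> \<bullet>c \<phi> = 1" and \<sigma>: "psd_mat d \<sigma>"
  shows "of_real (fidelity (ket_bra \<phi>) \<sigma>) = qform d \<sigma> (($) \<phi>)"
proof -
  define P where "P = ket_bra \<phi>"
  have P: "psd_mat d P" and Pc: "P \<in> carrier_mat d d"
    using psd_ket_bra[OF \<phi>] ket_bra_carrier[OF \<phi>] by (simp_all add: P_def)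
  have PP: "P * P = P" using ket_bra_square[OF \<phi>] unit Pc unfolding P_def by (intro eq_matI) simp_all
  have sP: "psd_sqrt P = P" using P PP by (rule psd_sqrt_eqI)
  define S where "S = psd_sqrt \<sigma>"
  have S: "psd_mat d S" and SS: "S * S = \<sigma>"
    using psd_sqrt_props[OF \<sigma>] by (simp_all add: S_def)
  note Sc = psd_mat_carrier[OF S]
  define w where "w = vec d (\<lambda>i. \<Sum>j<d. S $$ (i, j) * \<phi> $ j)"
  have w: "w \<in> carrier_vec d" by (simp add: w_def)
  have PS: "P * S \<in> carrier_mat d d" using Pc Sc by simp
  have herm: "cnj (S $$ (i, j)) = S $$ (j, i)" if "i < d" "j < d" for i j
    using psd_hermitian[OF S that] by simp
  have PSe: "(P * S) $$ (k, j) = \<phi> $ k * cnj (w $ j)" if "k < d" "j < d" for k j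
    using that unfolding mat_mult_entry[OF Pc Sc that]
    by (simp add: P_def ket_bra_entry[OF \<phi>] w_def herm sum_distrib_left algebra_simps)
  have unit': "(\<Sum>k<d. cnj (\<phi> $ k) * \<phi> $ k) = 1"
    using unit \<phi> by (simp add: scalar_prod_def atLeast0LessThan mult.commute)
  have "mat_adjoint (P * S) * (P * S) = ket_bra w"
  proof (rule eq_matI)
    fix i j assume "i < dim_row (ket_bra w)" "j < dim_col (ket_bra w)"
    then have ij: "i < d" "j < d" using ket_bra_carrier[OF w] by auto
    have "(mat_adjoint (P * S) * (P * S)) $$ (i, j)
        = (\<Sum>k<d. mat_adjoint (P * S) $$ (i, k) * (P * S) $$ (k, j))"
      using ij by (rule mat_mult_entry[OF mat_adjoint_carrier[OF PS] PS])
    also have "\<dots> = (\<Sum>k<d. cnj (\<phi> $ k) * \<phi> $ k) * (w $ i * cnj (w $ j))"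
      using ij by (simp add: mat_adjoint_entry[OF PS] PSe sum_distrib_left sum_distrib_right algebra_simps
          del: index_mult_mat(1))
    finally show "(mat_adjoint (P * S) * (P * S)) $$ (i, j) = ket_bra w $$ (i, j)"
      using ij by (simp add: unit' ket_bra_entry[OF w])
  qed (use ket_bra_carrier[OF w] PS in auto)
  then have "fidelity P \<sigma> = (\<Sum>i<d. (cmod (w $ i))\<^sup>2)"
    unfolding fidelity_def sP S_def[symmetric] using trace_norm_rank_one[OF PS w] by simp
  then have "of_real (fidelity P \<sigma>) = (\<Sum>k<d. cnj (w $ k) * w $ k)"
    by (simp add: complex_norm_square mult.commute del: of_real_power)
  also have "\<dots> = (\<Sum>k<d. \<Sum>i<d. \<Sum>j<d. cnj (\<phi> $ i) * (S $$ (i, k) * S $$ (k, j)) * \<phi> $ j)"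
  proof (rule sum.cong[OF refl])
    fix k assume "k \<in> {..<d}"
    then have "cnj (w $ k) = (\<Sum>i<d. cnj (\<phi> $ i) * S $$ (i, k))" "w $ k = (\<Sum>j<d. S $$ (k, j) * \<phi> $ j)"
      by (simp_all add: w_def herm mult.commute)
    then show "cnj (w $ k) * w $ k = (\<Sum>i<d. \<Sum>j<d. cnj (\<phi> $ i) * (S $$ (i, k) * S $$ (k, j)) * \<phi> $ j)"
      by (simp only: sum_product mult.assoc)
  qed
  also have "\<dots> = (\<Sum>i<d. \<Sum>j<d. \<Sum>k<d. cnj (\<phi> $ i) * (S $$ (i, k) * S $$ (k, j)) * \<phi> $ j)"
    by (subst sum.swap, rule sum.cong[OF refl], rule sum.swap)
  also have "\<dots> = qform d \<sigma> (($) \<phi>)"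
    by (simp add: qform_def SS[symmetric] mat_mult_entry[OF Sc Sc] sum_distrib_left sum_distrib_right
        del: index_mult_mat(1))
  finally show ?thesis by (simp add: P_def)
qed

section \<open>Linear maps, Kraus maps and channels\<close>

lemma sum_lessThan_mult_split:
  fixes f :: "nat \<Rightarrow> 'a :: comm_monoid_add"
  shows "(\<Sum>r<m * n. f r) = (\<Sum>i<m. \<Sum>j<n. f (i * n + j))"
proof -
  have "(\<Sum>j<n. f (i * n + j)) = sum f {i * n..<i * n + n}" for i
    by (rule sum.reindex_bij_witness[where i = "\<lambda>r. r - i * n" and j = "\<lambda>j. i * n + j"]) auto
  then show ?thesis by (simp add: sum.nat_group)
qed

lemma pair_index_less: "i < (m :: nat) \<Longrightarrow> j < n \<Longrightarrow> i * n + j < m * n"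
  using mult_le_mono1[of "Suc i" m n] by simp

lemma elem_mat_carrier [simp]: "elem_mat d i j \<in> carrier_mat d d"
  by (simp add: elem_mat_def)

lemma elem_mat_entry [simp]:
  "r < d \<Longrightarrow> s < d \<Longrightarrow> elem_mat d i j $$ (r, s) = of_bool (r = i \<and> s = j)"
  by (simp add: elem_mat_def)

lemma block_mat_carrier [simp]: "block_mat d i j X \<in> carrier_mat d d"
  by (simp add: block_mat_def)

lemma block_mat_entry [simp]:
  "r < d \<Longrightarrow> s < d \<Longrightarrow> block_mat d i j X $$ (r, s) = X $$ (i * d + r, j * d + s)"
  by (simp add: block_mat_def)

lemma tensor_map_carrier [simp]:
  "tensor_map d\<^sub>1 e\<^sub>1 d\<^sub>2 e\<^sub>2 L M X \<in> carrier_mat (e\<^sub>1 * e\<^sub>2) (e\<^sub>1 * e\<^sub>2)"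
  by (simp add: tensor_map_def)

text \<open>Next to the identity on the first factor the double sum collapses: L acts on each block
  separately.\<close>

lemma tensor_id_entry:
  assumes L: "\<And>Y. Y \<in> carrier_mat d d \<Longrightarrow> L Y \<in> carrier_mat e e"
    and r: "r < k * e" and s: "s < k * e"
  shows "tensor_map k k d e (\<lambda>Y. Y) L X $$ (r, s)
    = L (block_mat d (r div e) (s div e) X) $$ (r mod e, s mod e)"
proof -
  have e: "0 < e" using r by (cases e) auto
  have re: "r div e < k" "s div e < k" "r mod e < e" "s mod e < e"
    using r s e by (simp_all add: less_mult_imp_div_less)
  have LB: "L (block_mat d i j X) \<in> carrier_mat e e" for i j by (rule L) simp
  have "tensor_map k k d e (\<lambda>Y. Y) L X $$ (r, s) = (\<Sum>i<k. \<Sum>j<k.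
      of_bool (r div e = i \<and> s div e = j) * L (block_mat d i j X) $$ (r mod e, s mod e))"
    using r s re carrier_matD[OF LB] by (simp add: tensor_map_def kron_def elem_mat_def of_bool_def)
  also have "\<dots> = (\<Sum>i<k. if i = r div e then \<Sum>j<k. if j = s div e
      then L (block_mat d i j X) $$ (r mod e, s mod e) else 0 else 0)"
    by (intro sum.cong refl) (auto intro!: sum.cong sum.neutral)
  finally show ?thesis using re by simp
qed

lemma linear_op_map_carrier:
  "linear_op_map d e L \<Longrightarrow> X \<in> carrier_mat d d \<Longrightarrow> L X \<in> carrier_mat e e"
  by (simp add: linear_op_map_def)

lemma linear_op_map_expand:
  assumes L: "linear_op_map d e L" and X: "X \<in> carrier_mat d d" and ab: "a < e" "b < e"
  shows "L X $$ (a, b) = (\<Sum>c<d. \<Sum>c'<d. X $$ (c, c') * L (elem_mat d c c') $$ (a, b))"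
proof -
  \<comment> \<open>\<open>R S\<close> keeps only the entries with index in S; induction over S
    takes the place of a sum of matrices.\<close>
  define R where "R S = mat d d (\<lambda>p. if p \<in> S then X $$ p else 0)" for S
  have Rc: "R S \<in> carrier_mat d d" for S by (simp add: R_def)
  have add: "L (Y + Z) = L Y + L Z" if "Y \<in> carrier_mat d d" "Z \<in> carrier_mat d d" for Y Z
    using L that by (simp add: linear_op_map_def)
  have smult: "L (z \<cdot>\<^sub>m Y) = z \<cdot>\<^sub>m L Y" if "Y \<in> carrier_mat d d" for z Y
    using L that by (simp add: linear_op_map_def)
  note car = linear_op_map_carrier[OF L]
  have "L (R S) $$ (a, b) = (\<Sum>p\<in>S. X $$ p * L (elem_mat d (fst p) (snd p)) $$ (a, b))"
    if "finite S" "S \<subseteq> {..<d} \<times> {..<d}" for S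
    using that
  proof (induction S)
    case empty
    have "R {} = 0 \<cdot>\<^sub>m R {}" by (intro eq_matI) (auto simp: R_def)
    then have "L (R {}) = 0 \<cdot>\<^sub>m L (R {})" using smult[OF Rc] by metis
    then have "L (R {}) $$ (a, b) = 0 * L (R {}) $$ (a, b)"
      using car[OF Rc] ab by (metis carrier_matD index_smult_mat(1))
    then show ?case by simp
  next
    case (insert p S)
    obtain i j where p: "p = (i, j)" by (cases p)
    have "R (insert p S) = X $$ p \<cdot>\<^sub>m elem_mat d i j + R S"
      using insert by (intro eq_matI) (auto simp: R_def elem_mat_def p)
    then have "L (R (insert p S)) = X $$ p \<cdot>\<^sub>m L (elem_mat d i j) + L (R S)"
      by (simp add: add smult Rc)
    then show ?case
      using insert ab car[OF Rc, of S] car[of "elem_mat d i j"] by (simp add: p)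
  qed
  from this[of "{..<d} \<times> {..<d}"]
  have "L (R ({..<d} \<times> {..<d})) $$ (a, b)
      = (\<Sum>p\<in>{..<d} \<times> {..<d}. X $$ p * L (elem_mat d (fst p) (snd p)) $$ (a, b))" by simp
  moreover have "R ({..<d} \<times> {..<d}) = X" using X by (intro eq_matI) (auto simp: R_def)
  ultimately show ?thesis by (simp add: sum.cartesian_product split_def)
qed

lemma tensor_id_comp:
  assumes L: "\<And>Y. Y \<in> carrier_mat d d \<Longrightarrow> L Y \<in> carrier_mat e e"
    and M: "\<And>Y. Y \<in> carrier_mat e e \<Longrightarrow> M Y \<in> carrier_mat f f"
  shows "tensor_map k k d f (\<lambda>Y. Y) (M \<circ> L) X
    = tensor_map k k e f (\<lambda>Y. Y) M (tensor_map k k d e (\<lambda>Y. Y) L X)"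
proof (rule eq_matI)
  let ?T = "tensor_map k k d e (\<lambda>Y. Y) L X"
  have comp_car: "(M \<circ> L) Y \<in> carrier_mat f f" if "Y \<in> carrier_mat d d" for Y using L M that by simp
  have block: "block_mat e i j ?T = L (block_mat d i j X)" if "i < k" "j < k" for i j
  proof (rule eq_matI)
    have LB: "L (block_mat d i j X) \<in> carrier_mat e e" by (rule L) simp
    then show "dim_row (block_mat e i j ?T) = dim_row (L (block_mat d i j X))"
      "dim_col (block_mat e i j ?T) = dim_col (L (block_mat d i j X))" by (auto simp: block_mat_def)
    fix a b assume "a < dim_row (L (block_mat d i j X))" "b < dim_col (L (block_mat d i j X))"
    then have ab: "a < e" "b < e" using LB by auto
    then show "block_mat e i j ?T $$ (a, b) = L (block_mat d i j X) $$ (a, b)"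
      using that by (simp add: tensor_id_entry[where L = L, OF L] pair_index_less)
  qed
  fix r s assume "r < dim_row (tensor_map k k e f (\<lambda>Y. Y) M ?T)" "s < dim_col (tensor_map k k e f (\<lambda>Y. Y) M ?T)"
  then have rs: "r < k * f" "s < k * f" by (simp_all add: tensor_map_def)
  then have "r div f < k" "s div f < k" by (simp_all add: less_mult_imp_div_less)
  then show "tensor_map k k d f (\<lambda>Y. Y) (M \<circ> L) X $$ (r, s) = tensor_map k k e f (\<lambda>Y. Y) M ?T $$ (r, s)"
    using rs by (simp add: tensor_id_entry[where L = "M \<circ> L", OF comp_car] tensor_id_entry[where L = M, OF M] block)
qed (simp_all add: tensor_map_def)

lemma quantum_channelD:
  assumes "quantum_channel d e L"
  shows "linear_op_map d e L"
    and "\<And>X. X \<in> carrier_mat d d \<Longrightarrow> L X \<in> carrier_mat e e"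
    and "\<And>k X. psd_mat (k * d) X \<Longrightarrow> psd_mat (k * e) (tensor_map k k d e (\<lambda>Y. Y) L X)"
    and "\<And>X. X \<in> carrier_mat d d \<Longrightarrow> mat_trace (L X) = mat_trace X"
  using assms linear_op_map_carrier
  by (auto simp: quantum_channel_def completely_positive_def trace_preserving_def)

lemma quantum_channel_comp:
  assumes L: "quantum_channel d e L" and M: "quantum_channel e f M"
  shows "quantum_channel d f (M \<circ> L)"
proof -
  have "linear_op_map d f (M \<circ> L)"
    using quantum_channelD(1)[OF L] quantum_channelD(1)[OF M] by (simp add: linear_op_map_def)
  moreover have "completely_positive d f (M \<circ> L)"
    unfolding completely_positive_def
    using quantum_channelD(3)[OF L] quantum_channelD(3)[OF M]
    by (simp add: tensor_id_comp[where L = L and M = M, OF quantum_channelD(2)[OF L] quantum_channelD(2)[OF M]])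
  moreover have "trace_preserving d (M \<circ> L)"
    using quantum_channelD(2,4)[OF L] quantum_channelD(4)[OF M] by (simp add: trace_preserving_def)
  ultimately show ?thesis by (simp add: quantum_channel_def)
qed

lemma tensor_id_cong:
  assumes "\<And>Y. Y \<in> carrier_mat d d \<Longrightarrow> L Y = M Y"
  shows "tensor_map k k d e (\<lambda>Y. Y) L X = tensor_map k k d e (\<lambda>Y. Y) M X"
  using assms by (simp add: tensor_map_def)

lemma quantum_channel_cong:
  assumes eq: "\<And>Y. Y \<in> carrier_mat d d \<Longrightarrow> L Y = M Y" and L: "quantum_channel d e L"
  shows "quantum_channel d e M"
proof -
  have "linear_op_map d e M"
    using quantum_channelD(1)[OF L] by (simp add: linear_op_map_def eq[symmetric])
  moreover have "completely_positive d e M"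
    using quantum_channelD(3)[OF L]
    by (simp add: completely_positive_def tensor_id_cong[where L = L and M = M, OF eq, symmetric])
  moreover have "trace_preserving d M"
    using quantum_channelD(4)[OF L] by (simp add: trace_preserving_def eq[symmetric])
  ultimately show ?thesis by (simp add: quantum_channel_def)
qed

section \<open>Maps in Kraus form\<close>

definition kraus_map ::
  "nat \<Rightarrow> nat \<Rightarrow> 'i set \<Rightarrow> ('i \<Rightarrow> nat \<Rightarrow> nat \<Rightarrow> complex) \<Rightarrow> complex mat \<Rightarrow> complex mat" where
  "kraus_map d e I K X = mat e e (\<lambda>(a, b). \<Sum>\<kappa>\<in>I. \<Sum>c<d. \<Sum>c'<d. K \<kappa> a c * X $$ (c, c') * cnj (K \<kappa> b c'))"

lemma kraus_map_carrier [simp]: "kraus_map d e I K X \<in> carrier_mat e e"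
  by (simp add: kraus_map_def)

lemma kraus_map_entry:
  "a < e \<Longrightarrow> b < e \<Longrightarrow> kraus_map d e I K X $$ (a, b)
    = (\<Sum>\<kappa>\<in>I. \<Sum>c<d. \<Sum>c'<d. K \<kappa> a c * X $$ (c, c') * cnj (K \<kappa> b c'))"
  by (simp add: kraus_map_def)

lemma kraus_map_linear: "linear_op_map d e (kraus_map d e I K)"
  unfolding linear_op_map_def
  by (auto intro!: eq_matI simp: kraus_map_def algebra_simps sum.distrib sum_distrib_left)

text \<open>The vector on the right is the adjoint of a Kraus operator, tensored with the identity,
  applied to v. Complete positivity can be read off, and later the fidelity is split into
  contributions of single Kraus operators.\<close>

lemma qform_tensor_kraus:
  "qform (k * e) (tensor_map k k d e (\<lambda>Y. Y) (kraus_map d e I K) X) v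
    = (\<Sum>\<kappa>\<in>I. qform (k * d) X (\<lambda>r. \<Sum>a<e. cnj (K \<kappa> a (r mod d)) * v (r div d * e + a)))"
proof -
  let ?t = "\<lambda>\<kappa> i a j b c c'. cnj (v (i * e + a)) * (K \<kappa> a c * X $$ (i * d + c, j * d + c') * cnj (K \<kappa> b c'))
      * v (j * e + b)"
  have "qform (k * e) (tensor_map k k d e (\<lambda>Y. Y) (kraus_map d e I K) X) v =
      (\<Sum>i<k. \<Sum>a<e. \<Sum>j<k. \<Sum>b<e. \<Sum>\<kappa>\<in>I. \<Sum>c<d. \<Sum>c'<d. ?t \<kappa> i a j b c c')"
    unfolding qform_def sum_lessThan_mult_split
    by (intro sum.cong refl)
      (simp add: tensor_id_entry[where L = "kraus_map d e I K"] pair_index_less kraus_map_entry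
        sum_distrib_left sum_distrib_right)
  also have "\<dots> = (\<Sum>(i, a, j, b, \<kappa>, c, c')\<in>{..<k} \<times> {..<e} \<times> {..<k} \<times> {..<e} \<times> I \<times> {..<d} \<times> {..<d}.
      ?t \<kappa> i a j b c c')"
    by (simp add: sum.cartesian_product)
  also have "\<dots> = (\<Sum>(\<kappa>, i, c, j, c', a, b)\<in>I \<times> {..<k} \<times> {..<d} \<times> {..<k} \<times> {..<d} \<times> {..<e} \<times> {..<e}.
      ?t \<kappa> i a j b c c')"
    by (rule sum.reindex_bij_witness[where i = "\<lambda>(\<kappa>, i, c, j, c', a, b). (i, a, j, b, \<kappa>, c, c')"
          and j = "\<lambda>(i, a, j, b, \<kappa>, c, c'). (\<kappa>, i, c, j, c', a, b)"]) auto
  also have "\<dots> = (\<Sum>\<kappa>\<in>I. \<Sum>i<k. \<Sum>c<d. \<Sum>j<k. \<Sum>c'<d. \<Sum>a<e. \<Sum>b<e. ?t \<kappa> i a j b c c')"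
    by (simp add: sum.cartesian_product)
  also have "\<dots> = (\<Sum>\<kappa>\<in>I. qform (k * d) X (\<lambda>r. \<Sum>a<e. cnj (K \<kappa> a (r mod d)) * v (r div d * e + a)))"
    unfolding qform_def sum_lessThan_mult_split
  proof (intro sum.cong refl)
    fix \<kappa> i c j c' assume "c \<in> {..<d}" "c' \<in> {..<d}"
    then show "(\<Sum>a<e. \<Sum>b<e. ?t \<kappa> i a j b c c') =
        cnj (\<Sum>a<e. cnj (K \<kappa> a ((i * d + c) mod d)) * v ((i * d + c) div d * e + a)) * X $$ (i * d + c, j * d + c') *
        (\<Sum>a<e. cnj (K \<kappa> a ((j * d + c') mod d)) * v ((j * d + c') div d * e + a))"
      by (simp add: sum_distrib_left sum_distrib_right mult_ac)
  qed
  finally show ?thesis .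
qed

lemma complex_sum_nonneg:
  fixes f :: "'i \<Rightarrow> complex"
  shows "(\<And>i. i \<in> I \<Longrightarrow> 0 \<le> f i) \<Longrightarrow> 0 \<le> (\<Sum>i\<in>I. f i)"
  by (auto simp: less_eq_complex_def intro!: sum_nonneg)

lemma kraus_map_channel:
  assumes tp: "\<And>c c'. c < d \<Longrightarrow> c' < d \<Longrightarrow>
      (\<Sum>\<kappa>\<in>I. \<Sum>a<e. cnj (K \<kappa> a c) * K \<kappa> a c') = of_bool (c = c')"
  shows "quantum_channel d e (kraus_map d e I K)"
proof -
  have "completely_positive d e (kraus_map d e I K)"
    by (auto simp: completely_positive_def psd_mat_iff qform_tensor_kraus intro!: complex_sum_nonneg)
  moreover have "trace_preserving d (kraus_map d e I K)"
    unfolding trace_preserving_def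
  proof
    fix X :: "complex mat" assume X: "X \<in> carrier_mat d d"
    have "mat_trace (kraus_map d e I K X)
        = (\<Sum>a<e. \<Sum>\<kappa>\<in>I. \<Sum>c<d. \<Sum>c'<d. X $$ (c, c') * (cnj (K \<kappa> a c') * K \<kappa> a c))"
      by (simp add: mat_trace_eq[of _ e] kraus_map_entry mult_ac)
    also have "\<dots> = (\<Sum>(a, \<kappa>, c, c')\<in>{..<e} \<times> I \<times> {..<d} \<times> {..<d}. X $$ (c, c') * (cnj (K \<kappa> a c') * K \<kappa> a c))"
      by (simp add: sum.cartesian_product)
    also have "\<dots> = (\<Sum>(c, c', \<kappa>, a)\<in>{..<d} \<times> {..<d} \<times> I \<times> {..<e}. X $$ (c, c') * (cnj (K \<kappa> a c') * K \<kappa> a c))"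
      by (rule sum.reindex_bij_witness[where i = "\<lambda>(c, c', \<kappa>, a). (a, \<kappa>, c, c')"
          and j = "\<lambda>(a, \<kappa>, c, c'). (c, c', \<kappa>, a)"]) auto
    also have "\<dots> = (\<Sum>c<d. \<Sum>c'<d. X $$ (c, c') * (\<Sum>\<kappa>\<in>I. \<Sum>a<e. cnj (K \<kappa> a c') * K \<kappa> a c))"
      by (simp only: sum.cartesian_product[symmetric] sum_distrib_left)
    also have "\<dots> = (\<Sum>c<d. \<Sum>c'<d. if c' = c then X $$ (c, c') else 0)"
      by (intro sum.cong refl) (auto simp: tp)
    also have "\<dots> = mat_trace X" using X by (simp add: mat_trace_eq[of _ d])
    finally show "mat_trace (kraus_map d e I K X) = mat_trace X" .
  qed
  ultimately show ?thesis using kraus_map_linear by (auto simp: quantum_channel_def)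
qed

lemma kraus_map_comp:
  "kraus_map e f J M (kraus_map d e I K X)
    = kraus_map d f (J \<times> I) (\<lambda>(j, i) a c. \<Sum>b<e. M j a b * K i b c) X"
proof (rule eq_matI)
  fix a a' assume "a < dim_row (kraus_map d f (J \<times> I) (\<lambda>(j, i) a c. \<Sum>b<e. M j a b * K i b c) X)"
    "a' < dim_col (kraus_map d f (J \<times> I) (\<lambda>(j, i) a c. \<Sum>b<e. M j a b * K i b c) X)"
  then have a: "a < f" "a' < f" by (simp_all add: kraus_map_def)
  let ?t = "\<lambda>j i b b' c c'. M j a b * (K i b c * X $$ (c, c') * cnj (K i b' c')) * cnj (M j a' b')"
  have "kraus_map e f J M (kraus_map d e I K X) $$ (a, a') =
      (\<Sum>j\<in>J. \<Sum>b<e. \<Sum>b'<e. \<Sum>i\<in>I. \<Sum>c<d. \<Sum>c'<d. ?t j i b b' c c')"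
    using a by (simp add: kraus_map_entry sum_distrib_left sum_distrib_right)
  also have "\<dots> = (\<Sum>(j, b, b', i, c, c')\<in>J \<times> {..<e} \<times> {..<e} \<times> I \<times> {..<d} \<times> {..<d}. ?t j i b b' c c')"
    by (simp add: sum.cartesian_product)
  also have "\<dots> = (\<Sum>(j, i, c, c', b, b')\<in>J \<times> I \<times> {..<d} \<times> {..<d} \<times> {..<e} \<times> {..<e}. ?t j i b b' c c')"
    by (rule sum.reindex_bij_witness[where i = "\<lambda>(j, i, c, c', b, b'). (j, b, b', i, c, c')"
          and j = "\<lambda>(j, b, b', i, c, c'). (j, i, c, c', b, b')"]) auto
  also have "\<dots> = (\<Sum>j\<in>J. \<Sum>i\<in>I. \<Sum>c<d. \<Sum>c'<d. \<Sum>b<e. \<Sum>b'<e. ?t j i b b' c c')"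
    by (simp add: sum.cartesian_product)
  also have "\<dots> = (\<Sum>j\<in>J. \<Sum>i\<in>I. \<Sum>c<d. \<Sum>c'<d.
      (\<Sum>b<e. M j a b * K i b c) * X $$ (c, c') * cnj (\<Sum>b'<e. M j a' b' * K i b' c'))"
    by (intro sum.cong refl) (simp add: sum_distrib_left sum_distrib_right mult_ac)
  also have "\<dots> = (\<Sum>\<kappa>\<in>J \<times> I. \<Sum>c<d. \<Sum>c'<d.
      (case \<kappa> of (j, i) \<Rightarrow> \<lambda>a c. \<Sum>b<e. M j a b * K i b c) a c * X $$ (c, c') *
      cnj ((case \<kappa> of (j, i) \<Rightarrow> \<lambda>a c. \<Sum>b<e. M j a b * K i b c) a' c'))"
    by (subst sum.cartesian_product) (simp add: split_def)
  finally show "kraus_map e f J M (kraus_map d e I K X) $$ (a, a')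
      = kraus_map d f (J \<times> I) (\<lambda>(j, i) a c. \<Sum>b<e. M j a b * K i b c) X $$ (a, a')"
    using a by (simp add: kraus_map_entry)
qed (simp_all add: kraus_map_def)

lemma sum_of_bool_eq_mult:
  fixes f :: "nat \<Rightarrow> complex"
  assumes "x < d"
  shows "(\<Sum>r<d. of_bool (r = x) * f r) = f x"
proof -
  have "(\<Sum>r<d. of_bool (r = x) * f r) = (\<Sum>r<d. if r = x then f r else 0)"
    by (intro sum.cong refl) simp
  then show ?thesis using assms by simp
qed

text \<open>The form at v equals the form of A at the vector that adds up v over the fibres of g, so
  g may repeat indices.\<close>

lemma psd_reindex:
  assumes A: "psd_mat d A" and g: "\<And>i. i < m \<Longrightarrow> g i < d"
  shows "psd_mat m (mat m m (\<lambda>(i, j). A $$ (g i, g j)))"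
proof -
  have "qform m (mat m m (\<lambda>(i, j). A $$ (g i, g j))) v
      = qform d A (\<lambda>r. \<Sum>i<m. of_bool (r = g i) * v i)" for v
  proof -
    let ?t = "\<lambda>r s i j. of_bool (r = g i) * (of_bool (s = g j) * (cnj (v i) * A $$ (r, s) * v j))"
    have cnj_b: "cnj (of_bool P) = of_bool P" for P by simp
    have "qform d A (\<lambda>r. \<Sum>i<m. of_bool (r = g i) * v i) = (\<Sum>r<d. \<Sum>s<d. \<Sum>j<m. \<Sum>i<m. ?t r s i j)"
      unfolding qform_def cnj_sum complex_cnj_mult cnj_b sum_distrib_left sum_distrib_right
      by (intro sum.cong refl) (simp only: mult_ac)
    also have "\<dots> = (\<Sum>(r, s, j, i)\<in>{..<d} \<times> {..<d} \<times> {..<m} \<times> {..<m}. ?t r s i j)"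
      by (simp only: sum.cartesian_product)
    also have "\<dots> = (\<Sum>(i, j, r, s)\<in>{..<m} \<times> {..<m} \<times> {..<d} \<times> {..<d}. ?t r s i j)"
      by (rule sum.reindex_bij_witness[where i = "\<lambda>(i, j, r, s). (r, s, j, i)"
          and j = "\<lambda>(r, s, j, i). (i, j, r, s)"]) auto
    also have "\<dots> = (\<Sum>i<m. \<Sum>j<m. \<Sum>r<d. of_bool (r = g i) * (\<Sum>s<d. of_bool (s = g j) *
        (cnj (v i) * A $$ (r, s) * v j)))"
      by (simp only: sum.cartesian_product[symmetric] sum_distrib_left)
    also have "\<dots> = qform m (mat m m (\<lambda>(i, j). A $$ (g i, g j))) v"
      by (simp add: qform_def sum_of_bool_eq_mult g del: sum_of_bool_mult_eq)
    finally show ?thesis by simp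
  qed
  then show ?thesis using psd_mat_qform[OF A] by (simp add: psd_mat_iff)
qed

text \<open>The proof applies the channel to half of the unnormalized maximally entangled vector.\<close>
lemma psd_choi_submatrix:
  assumes L: "quantum_channel d e L"
    and g: "\<And>x. x < m \<Longrightarrow> i x < d \<and> a x < e"
  shows "psd_mat m (mat m m (\<lambda>(x, y). L (elem_mat d (i x) (i y)) $$ (a x, a y)))"
proof -
  define \<Omega> :: "complex vec" where "\<Omega> = vec (d * d) (\<lambda>r. of_bool (r div d = r mod d))"
  have \<Omega>: "\<Omega> \<in> carrier_vec (d * d)" by (simp add: \<Omega>_def)
  have \<Omega>_entry: "\<Omega> $ (r * d + a) = of_bool (r = a)" if "r < d" "a < d" for r a
    using that by (simp add: \<Omega>_def pair_index_less)
  have block: "block_mat d r s (ket_bra \<Omega>) = elem_mat d r s" if "r < d" "s < d" for r s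
    using that by (intro eq_matI) (auto simp: block_mat_def elem_mat_def ket_bra_entry[OF \<Omega>]
        pair_index_less \<Omega>_entry)
  define C where "C = tensor_map d d d e (\<lambda>Y. Y) L (ket_bra \<Omega>)"
  have C: "psd_mat (d * e) C"
    unfolding C_def by (rule quantum_channelD(3)[OF L psd_ket_bra[OF \<Omega>]])
  have "psd_mat m (mat m m (\<lambda>(x, y). C $$ (i x * e + a x, i y * e + a y)))"
    using C by (rule psd_reindex) (use g in \<open>simp add: pair_index_less\<close>)
  moreover have "C $$ (i x * e + a x, i y * e + a y) = L (elem_mat d (i x) (i y)) $$ (a x, a y)"
    if "x < m" "y < m" for x y
    using g[OF that(1)] g[OF that(2)]
    by (simp add: C_def tensor_id_entry[where L = L, OF quantum_channelD(2)[OF L]] pair_index_less block)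
  then have "mat m m (\<lambda>(x, y). C $$ (i x * e + a x, i y * e + a y))
      = mat m m (\<lambda>(x, y). L (elem_mat d (i x) (i y)) $$ (a x, a y))"
    by (intro eq_matI) simp_all
  ultimately show ?thesis by simp
qed

section \<open>Dephasing as random phase errors\<close>

definition omega :: complex where
  "omega = exp (2 * complex_of_real pi * \<i> / 3)"

lemma omega_cubed: "omega ^ 3 = 1"
proof -
  have "omega ^ 3 = exp (of_nat 3 * (2 * complex_of_real pi * \<i> / 3))"
    unfolding omega_def by (rule exp_of_nat_mult[symmetric])
  then show ?thesis using exp_two_pi_i' by (simp add: mult_ac)
qed

lemma omega_cnj: "omega * cnj omega = 1"
proof -
  have cis: "omega = cis (2 * pi / 3)" by (simp add: omega_def cis_conv_exp mult_ac)
  show ?thesis unfolding cis cis_cnj cis_mult by simp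
qed

lemma cnj_omega: "cnj omega = omega\<^sup>2"
proof -
  have "cnj omega = omega ^ 3 * cnj omega" by (simp add: omega_cubed)
  also have "\<dots> = omega\<^sup>2 * (omega * cnj omega)" by (simp add: power2_eq_square power3_eq_cube)
  finally show ?thesis by (simp add: omega_cnj)
qed

lemma omega_sum: "1 + omega + omega\<^sup>2 = 0"
proof -
  have "omega \<noteq> 1"
  proof
    assume "omega = 1"
    then have "Re omega = 1" by simp
    moreover have "Re omega = cos (2 * pi / 3)" by (simp add: omega_def Re_exp)
    ultimately show False by (simp add: cos_120)
  qed
  moreover have "(omega - 1) * (1 + omega + omega\<^sup>2) = omega ^ 3 - 1"
    by (simp add: algebra_simps power2_eq_square power3_eq_cube)
  ultimately show ?thesis by (simp add: omega_cubed)
qed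

lemma phase_flip_entry:
  assumes "i < 3" "j < 3"
  shows "phase_flip $$ (i, j) = (if i = j then omega ^ i else 0)"
proof -
  have "exp (2 * complex_of_real pi * \<i> * of_nat k / 3) = omega ^ k" for k
    unfolding omega_def exp_of_nat_mult[symmetric] by (simp add: mult_ac)
  then show ?thesis using assms by (simp add: phase_flip_def mat_diag_def)
qed

lemma phase_flip_carrier [simp]: "phase_flip \<in> carrier_mat 3 3"
  by (simp add: phase_flip_def mat_diag_def)

text \<open>
  A number below \<open>3 ^ n\<close> encodes a vector in the n-th power of Z/3 by its base 3 digits. The most
  significant digit belongs to the first tensor factor, as in the basis of tensor products.
\<close>

definition bern3 :: "real \<Rightarrow> nat \<Rightarrow> real" where
  "bern3 p i = (if i = 0 then 1 - p else if i = 1 then p else 0)"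

primrec bern :: "real \<Rightarrow> nat \<Rightarrow> nat \<Rightarrow> real" where
  "bern p 0 x = 1"
| "bern p (Suc n) x = bern3 p (x div 3 ^ n) * bern p n (x mod 3 ^ n)"

text \<open>The characters of the n-th power of Z/3: omega raised to the inner product of the digit
  vectors of x and r. As a function of r this is the diagonal of the phase operator of x, and also,
  up to normalization, the Fourier basis vector with label x.\<close>

primrec chi :: "nat \<Rightarrow> nat \<Rightarrow> nat \<Rightarrow> complex" where
  "chi 0 x r = 1"
| "chi (Suc n) x r = omega ^ ((x div 3 ^ n) * (r div 3 ^ n)) * chi n (x mod 3 ^ n) (r mod 3 ^ n)"

text \<open>Digitwise addition without carry. The result lies below \<open>3 ^ n\<close> for all
  arguments, so that associativity and compatibility with \<open>chi\<close> hold without range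
  conditions.\<close>

primrec trit_add :: "nat \<Rightarrow> nat \<Rightarrow> nat \<Rightarrow> nat" where
  "trit_add 0 x y = 0"
| "trit_add (Suc n) x y = ((x div 3 ^ n + y div 3 ^ n) mod 3) * 3 ^ n
    + trit_add n (x mod 3 ^ n) (y mod 3 ^ n)"

section \<open>Arithmetic of ternary words and their characters\<close>

lemma sum3: "(\<Sum>i<(3::nat). f i) = f 0 + f 1 + f 2"
  by (simp add: numeral_3_eq_3 numeral_2_eq_2 add.assoc)

lemma less3_cases: "i < 3 \<Longrightarrow> i = 0 \<or> i = 1 \<or> i = (2 :: nat)"
  by auto

lemma pow3_split:
  fixes x :: nat
  assumes "x < 3 ^ Suc n"
  obtains i j where "x = i * 3 ^ n + j" "i < 3" "j < 3 ^ n" "x div 3 ^ n = i" "x mod 3 ^ n = j"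
proof -
  have "x div 3 ^ n < 3" using assms by (simp add: less_mult_imp_div_less)
  then show thesis by (intro that[of "x div 3 ^ n" "x mod 3 ^ n"]) (rule div_mult_mod_eq[symmetric], simp_all)
qed

lemma pow3_sum: "(\<Sum>x<3 ^ Suc n. f x) = (\<Sum>i<3. \<Sum>j<3 ^ n. f (i * 3 ^ n + j :: nat))"
  using sum_lessThan_mult_split[of f 3 "3 ^ n"] by simp

lemma chi_commute: "chi n x r = chi n r x"
  by (induction n arbitrary: x r) (simp_all add: mult.commute)

lemma omega_power_mod: "omega ^ (k mod 3) = omega ^ k"
proof -
  have "omega ^ k = omega ^ (3 * (k div 3) + k mod 3)" by simp
  also have "\<dots> = omega ^ (k mod 3)" unfolding power_add power_mult omega_cubed by simp
  finally show ?thesis by simp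
qed

lemma trit_add_less: "trit_add n x y < 3 ^ n"
proof (induction n arbitrary: x y)
  case (Suc n)
  then show ?case using pair_index_less[of _ 3 _ "3 ^ n"] by simp
qed simp

lemma trit_add_split:
  "trit_add (Suc n) x y div 3 ^ n = (x div 3 ^ n + y div 3 ^ n) mod 3"
  "trit_add (Suc n) x y mod 3 ^ n = trit_add n (x mod 3 ^ n) (y mod 3 ^ n)"
  using trit_add_less[of n "x mod 3 ^ n" "y mod 3 ^ n"] by simp_all

lemma chi_trit_add: "chi n (trit_add n x y) r = chi n x r * chi n y r"
proof (induction n arbitrary: x y r)
  case (Suc n)
  have "omega ^ ((x div 3 ^ n + y div 3 ^ n) mod 3 * (r div 3 ^ n))
      = omega ^ (x div 3 ^ n * (r div 3 ^ n)) * omega ^ (y div 3 ^ n * (r div 3 ^ n))"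
    by (simp add: power_mult omega_power_mod power_add power_mult_distrib)
  then show ?case
    unfolding chi.simps trit_add_split by (simp add: Suc.IH mult_ac)
qed simp

lemma trit_add_commute: "trit_add n x y = trit_add n y x"
  by (induction n arbitrary: x y) (simp_all add: add.commute)

lemma trit_add_assoc: "trit_add n (trit_add n x y) z = trit_add n x (trit_add n y z)"
proof (induction n arbitrary: x y z)
  case (Suc n)
  show ?case
    unfolding trit_add.simps(2)[of n "trit_add (Suc n) x y" z] trit_add.simps(2)[of n x "trit_add (Suc n) y z"]
      trit_add_split
    by (simp add: Suc.IH mod_simps add.assoc)
qed simp

lemma trit_add_zero: "x < 3 ^ n \<Longrightarrow> trit_add n 0 x = x"
proof (induction n arbitrary: x)
  case (Suc n)
  have "x div 3 ^ n < 3" using Suc.prems by (simp add: less_mult_imp_div_less)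
  then show ?case using div_mult_mod_eq[of x "3 ^ n"] by (simp add: Suc.IH)
qed simp

text \<open>Characteristic 3 replaces subtraction: the inverse of x is
  \<open>trit_add n x x\<close>, and every cancellation below is carried out by adding twice
  more.\<close>

lemma trit_add_triple: "trit_add n x (trit_add n x x) = 0"
proof (induction n arbitrary: x)
  case (Suc n)
  have "(k + (k + k) mod 3) mod 3 = 0" for k :: nat by presburger
  then show ?case
    unfolding trit_add.simps(2)[of n x "trit_add (Suc n) x x"] trit_add_split by (simp only: Suc.IH)
qed simp

text \<open>Both sides factor over the digits. For a single digit there are nine cases, all
  consequences of \<open>omega_sum\<close> and \<open>omega_cubed\<close>.\<close>

lemma chi_orthogonal:
  assumes "x < 3 ^ n" "y < 3 ^ n"
  shows "(\<Sum>r<3 ^ n. chi n x r * cnj (chi n y r)) = (if x = y then 3 ^ n else 0)"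
  using assms
proof (induction n arbitrary: x y)
  case (Suc n)
  obtain i j where x: "x = i * 3 ^ n + j" "i < 3" "j < 3 ^ n" "x div 3 ^ n = i" "x mod 3 ^ n = j"
    using pow3_split[OF Suc.prems(1)] .
  obtain k l where y: "y = k * 3 ^ n + l" "k < 3" "l < 3 ^ n" "y div 3 ^ n = k" "y mod 3 ^ n = l"
    using pow3_split[OF Suc.prems(2)] .
  have base: "(\<Sum>a<(3::nat). omega ^ (i * a) * cnj (omega ^ (k * a))) = (if i = k then 3 else 0)"
  proof -
    have o4: "omega ^ 4 = omega" using omega_cubed by (simp add: eval_nat_numeral)
    have oo: "omega * omega = omega\<^sup>2" "omega * omega\<^sup>2 = 1" "omega\<^sup>2 * omega = 1"
      "omega\<^sup>2 * omega\<^sup>2 = omega" "1 + (omega + omega\<^sup>2) = 0" "1 + (omega\<^sup>2 + omega) = 0"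
      using omega_cubed o4 omega_sum by (simp_all add: power2_eq_square power3_eq_cube eval_nat_numeral algebra_simps)
    have o8: "omega ^ 8 = omega\<^sup>2" "omega ^ 10 = omega"
      using omega_power_mod[of 8] omega_power_mod[of 10] by simp_all
    show ?thesis
      using less3_cases[OF x(2)] less3_cases[OF y(2)]
      by (elim disjE) (simp_all add: sum3 cnj_omega oo o4 o8 power_mult[symmetric] add.assoc del: power_mult power2_eq_square)
  qed
  have "(\<Sum>r<3 ^ Suc n. chi (Suc n) x r * cnj (chi (Suc n) y r)) =
      (\<Sum>a<3. \<Sum>b<3 ^ n. (omega ^ (i * a) * cnj (omega ^ (k * a))) * (chi n j b * cnj (chi n l b)))"
    unfolding pow3_sum by (intro sum.cong refl) (simp add: x(4,5) y(4,5))
  also have "\<dots> = (\<Sum>a<(3::nat). omega ^ (i * a) * cnj (omega ^ (k * a))) * (\<Sum>b<3 ^ n. chi n j b * cnj (chi n l b))"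
    by (simp only: sum_product)
  also have "\<dots> = (if i = k then 3 else 0) * (if j = l then 3 ^ n else 0)"
    by (simp only: base Suc.IH[OF x(3) y(3)])
  also have "\<dots> = (if x = y then 3 ^ Suc n else 0)"
  proof -
    have "x = y \<longleftrightarrow> i = k \<and> j = l" using x y by metis
    then show ?thesis by auto
  qed
  finally show ?case .
qed simp

lemma chi_unit: "chi n x r * cnj (chi n x r) = 1"
proof (induction n arbitrary: x r)
  case (Suc n)
  have "omega ^ k * cnj (omega ^ k) = 1" for k
    by (simp add: omega_cnj power_mult_distrib[symmetric])
  then show ?case using Suc.IH by (simp add: mult_ac)
qed simp

lemma bern3_nonneg: "0 \<le> p \<Longrightarrow> p \<le> 1 \<Longrightarrow> 0 \<le> bern3 p i"
  by (simp add: bern3_def)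

lemma bern_nonneg: "0 \<le> p \<Longrightarrow> p \<le> 1 \<Longrightarrow> 0 \<le> bern p n x"
  by (induction n arbitrary: x) (simp_all add: bern3_nonneg)

lemma bern_sum: "(\<Sum>x<3 ^ n. bern p n x) = 1"
proof (induction n)
  case (Suc n)
  have "(\<Sum>x<3 ^ Suc n. bern p (Suc n) x) = (\<Sum>i<3. \<Sum>j<3 ^ n. bern3 p i * bern p n j)"
    unfolding pow3_sum by (intro sum.cong refl) simp
  also have "\<dots> = (\<Sum>i<3. bern3 p i) * (\<Sum>j<3 ^ n. bern p n j)"
    by (simp only: sum_product)
  finally show ?case by (simp add: Suc.IH sum3 bern3_def)
qed simp

section \<open>Kraus form of the n-fold dephasing channel\<close>

lemma dephasing_carrier:
  "X \<in> carrier_mat 3 3 \<Longrightarrow> dephasing p X \<in> carrier_mat 3 3"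
  unfolding dephasing_def
  by (intro add_carrier_mat smult_carrier_mat mult_carrier_mat[of _ 3 3] mat_adjoint_carrier phase_flip_carrier)

lemma dephasing_entry:
  assumes X: "X \<in> carrier_mat 3 3" and ij: "i < 3" "j < 3"
  shows "dephasing p X $$ (i, j) = (\<Sum>x<3. of_real (bern3 p x) * omega ^ (x * i) * cnj (omega ^ (x * j))) * X $$ (i, j)"
proof -
  have PX: "phase_flip * X \<in> carrier_mat 3 3" using X by (intro mult_carrier_mat) auto
  have "(phase_flip * X * mat_adjoint phase_flip) $$ (i, j) =
      (\<Sum>l<3. (\<Sum>k<3. phase_flip $$ (i, k) * X $$ (k, l)) * cnj (phase_flip $$ (j, l)))"
    using ij by (simp add: mat_mult_entry[OF PX mat_adjoint_carrier[OF phase_flip_carrier]]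
        mat_mult_entry[OF phase_flip_carrier X] mat_adjoint_entry[OF phase_flip_carrier] del: index_mult_mat(1))
  also have "\<dots> = omega ^ i * X $$ (i, j) * cnj (omega ^ j)"
    using less3_cases[OF ij(1)] less3_cases[OF ij(2)] by (elim disjE) (simp_all add: sum3 phase_flip_entry)
  finally have "(phase_flip * X * mat_adjoint phase_flip) $$ (i, j) = omega ^ i * X $$ (i, j) * cnj (omega ^ j)" .
  then show ?thesis
    using X ij carrier_matD[OF mult_carrier_mat[OF PX mat_adjoint_carrier[OF phase_flip_carrier]]]
    by (simp add: dephasing_def sum3 bern3_def algebra_simps del: index_mult_mat(1))
qed

text \<open>Dephasing multiplies matrices entrywise (a Schur multiplier). This is the factor at
  entry (r, s): the Fourier transform of the error distribution at the digitwise difference r -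
  s.\<close>

definition dephasing_factor :: "real \<Rightarrow> nat \<Rightarrow> nat \<Rightarrow> nat \<Rightarrow> complex" where
  "dephasing_factor p n r s = (\<Sum>x<3 ^ n. of_real (bern p n x) * chi n x r * cnj (chi n x s))"

lemma dephasing_power_carrier:
  "X \<in> carrier_mat (3 ^ n) (3 ^ n) \<Longrightarrow> tensor_power_map 3 3 (dephasing p) n X \<in> carrier_mat (3 ^ n) (3 ^ n)"
  by (cases n) (simp_all add: tensor_map_def)

lemma dephasing_power_entry:
  assumes "X \<in> carrier_mat (3 ^ n) (3 ^ n)" "r < 3 ^ n" "s < 3 ^ n"
  shows "tensor_power_map 3 3 (dephasing p) n X $$ (r, s) = dephasing_factor p n r s * X $$ (r, s)"
  using assms
proof (induction n arbitrary: X r s)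
  case 0
  then show ?case by (simp add: dephasing_factor_def)
next
  case (Suc n)
  let ?N = "tensor_power_map 3 3 (dephasing p) n"
  obtain a b where r: "r = a * 3 ^ n + b" "a < 3" "b < 3 ^ n" "r div 3 ^ n = a" "r mod 3 ^ n = b"
    using pow3_split[OF Suc.prems(2)] .
  obtain c d where s: "s = c * 3 ^ n + d" "c < 3" "d < 3 ^ n" "s div 3 ^ n = c" "s mod 3 ^ n = d"
    using pow3_split[OF Suc.prems(3)] .
  define m where "m = (\<Sum>x<3. of_real (bern3 p x) * omega ^ (x * a) * cnj (omega ^ (x * c)))"
  have NB: "?N (block_mat (3 ^ n) i j X) \<in> carrier_mat (3 ^ n) (3 ^ n)" for i j
    by (rule dephasing_power_carrier) simp
  have DE: "dephasing p (elem_mat 3 i j) \<in> carrier_mat 3 3" for i j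
    by (rule dephasing_carrier) simp
  have "tensor_power_map 3 3 (dephasing p) (Suc n) X $$ (r, s) =
      (\<Sum>i<3. \<Sum>j<3. dephasing p (elem_mat 3 i j) $$ (a, c) * ?N (block_mat (3 ^ n) i j X) $$ (b, d))"
    using Suc.prems r(4,5) s(4,5) carrier_matD[OF NB] carrier_matD[OF DE]
    by (simp add: tensor_map_def kron_def)
  also have "\<dots> = (\<Sum>i<3. \<Sum>j<3. of_bool (i = a) * (of_bool (j = c) * (m * (dephasing_factor p n b d * X $$ (i * 3 ^ n + b, j * 3 ^ n + d)))))"
    using r(2,3) s(2,3)
    by (intro sum.cong refl)
      (simp add: dephasing_entry[OF elem_mat_carrier] Suc.IH block_mat_carrier flip: m_def, simp add: m_def)
  also have "\<dots> = m * (dephasing_factor p n b d * X $$ (a * 3 ^ n + b, c * 3 ^ n + d))"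
    using r(2) s(2) by (simp only: sum_distrib_left[symmetric] sum_of_bool_eq_mult)
  also have "m * dephasing_factor p n b d = dephasing_factor p (Suc n) r s"
  proof -
    have "m * dephasing_factor p n b d = (\<Sum>x<3. \<Sum>y<3 ^ n.
        (of_real (bern3 p x) * omega ^ (x * a) * cnj (omega ^ (x * c))) * (of_real (bern p n y) * chi n y b * cnj (chi n y d)))"
      by (simp only: m_def dephasing_factor_def sum_product)
    also have "\<dots> = dephasing_factor p (Suc n) r s"
      unfolding dephasing_factor_def pow3_sum
      by (intro sum.cong refl) (simp add: r(4,5) s(4,5) mult_ac)
    finally show ?thesis .
  qed
  then have "m * (dephasing_factor p n b d * X $$ (a * 3 ^ n + b, c * 3 ^ n + d)) = dephasing_factor p (Suc n) r s * X $$ (r, s)"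
    using r(1) s(1) by (simp only: mult.assoc[symmetric])
  finally show ?case .
qed

definition phase_kraus :: "nat \<Rightarrow> nat \<Rightarrow> nat \<Rightarrow> nat \<Rightarrow> complex" where
  "phase_kraus n x a c = of_bool (a = c) * chi n x c"

lemma phase_kraus_map_entry:
  assumes "a < d" "b < d"
  shows "kraus_map d d I (\<lambda>x a c. w x * phase_kraus n x a c) X $$ (a, b)
    = (\<Sum>x\<in>I. w x * cnj (w x) * (chi n x a * cnj (chi n x b))) * X $$ (a, b)"
proof -
  have "kraus_map d d I (\<lambda>x a c. w x * phase_kraus n x a c) X $$ (a, b) =
      (\<Sum>x\<in>I. \<Sum>c<d. of_bool (c = a) * (\<Sum>c'<d. of_bool (c' = b) *
        (w x * cnj (w x) * (chi n x c * cnj (chi n x c')) * X $$ (c, c'))))"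
    using assms unfolding kraus_map_entry[OF assms] sum_distrib_left
    by (intro sum.cong refl) (auto simp: phase_kraus_def)
  also have "\<dots> = (\<Sum>x\<in>I. w x * cnj (w x) * (chi n x a * cnj (chi n x b)) * X $$ (a, b))"
    using assms by (simp only: sum_of_bool_eq_mult)
  finally show ?thesis by (simp only: sum_distrib_right)
qed

lemma phase_kraus_channel:
  assumes "(\<Sum>x\<in>I. w x * cnj (w x)) = 1"
  shows "quantum_channel d d (kraus_map d d I (\<lambda>x a c. w x * phase_kraus n x a c))"
proof (rule kraus_map_channel)
  fix c c' assume c: "c < d" "c' < d"
  have "(\<Sum>x\<in>I. \<Sum>a<d. cnj (w x * phase_kraus n x a c) * (w x * phase_kraus n x a c')) =
      (\<Sum>x\<in>I. \<Sum>a<d. of_bool (a = c) * (w x * cnj (w x) * (cnj (chi n x c) * chi n x c') * of_bool (a = c')))"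
    by (intro sum.cong refl) (auto simp: phase_kraus_def)
  also have "\<dots> = (\<Sum>x\<in>I. w x * cnj (w x) * (cnj (chi n x c) * chi n x c') * of_bool (c = c'))"
    using c by (simp only: sum_of_bool_eq_mult)
  also have "\<dots> = (\<Sum>x\<in>I. w x * cnj (w x)) * of_bool (c = c')"
    unfolding sum_distrib_right
    by (intro sum.cong refl) (auto simp: chi_unit mult.commute[of "cnj (chi n _ _)"])
  finally show "(\<Sum>x\<in>I. \<Sum>a<d. cnj (w x * phase_kraus n x a c) * (w x * phase_kraus n x a c')) = of_bool (c = c')"
    using assms by simp
qed

lemma dephasing_power_kraus:
  assumes p: "0 \<le> p" "p \<le> 1" and X: "X \<in> carrier_mat (3 ^ n) (3 ^ n)"
  shows "tensor_power_map 3 3 (dephasing p) n X = kraus_map (3 ^ n) (3 ^ n) {..<3 ^ n}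
    (\<lambda>x a c. of_real (sqrt (bern p n x)) * phase_kraus n x a c) X"
proof (rule eq_matI)
  have sq: "of_real (sqrt (bern p n x)) * cnj (of_real (sqrt (bern p n x))) = complex_of_real (bern p n x)" for x
    using bern_nonneg[OF p] by (simp flip: of_real_mult)
  fix a b assume "a < dim_row (kraus_map (3 ^ n) (3 ^ n) {..<3 ^ n}
      (\<lambda>x a c. of_real (sqrt (bern p n x)) * phase_kraus n x a c) X)"
    "b < dim_col (kraus_map (3 ^ n) (3 ^ n) {..<3 ^ n}
      (\<lambda>x a c. of_real (sqrt (bern p n x)) * phase_kraus n x a c) X)"
  then have ab: "a < 3 ^ n" "b < 3 ^ n" by (simp_all add: kraus_map_def)
  show "tensor_power_map 3 3 (dephasing p) n X $$ (a, b) = kraus_map (3 ^ n) (3 ^ n) {..<3 ^ n}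
    (\<lambda>x a c. of_real (sqrt (bern p n x)) * phase_kraus n x a c) X $$ (a, b)"
    unfolding dephasing_power_entry[OF X ab] phase_kraus_map_entry[OF ab] sq dephasing_factor_def
    by (simp add: mult.assoc)
qed (use dephasing_power_carrier[OF X] in \<open>auto simp: kraus_map_def\<close>)

lemma dephasing_power_channel:
  assumes p: "0 \<le> p" "p \<le> 1"
  shows "quantum_channel (3 ^ n) (3 ^ n) (tensor_power_map 3 3 (dephasing p) n)"
proof (rule quantum_channel_cong)
  show "quantum_channel (3 ^ n) (3 ^ n) (kraus_map (3 ^ n) (3 ^ n) {..<3 ^ n}
      (\<lambda>x a c. of_real (sqrt (bern p n x)) * phase_kraus n x a c))"
  proof (rule phase_kraus_channel)
    have "(\<Sum>x<3 ^ n. of_real (sqrt (bern p n x)) * cnj (of_real (sqrt (bern p n x))))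
        = complex_of_real (\<Sum>x<3 ^ n. bern p n x)"
      using bern_nonneg[OF p] by (simp flip: of_real_mult)
    then show "(\<Sum>x<3 ^ n. of_real (sqrt (bern p n x)) * cnj (of_real (sqrt (bern p n x)))) = (1 :: complex)"
      by (simp add: bern_sum)
  qed
qed (rule dephasing_power_kraus[OF p, symmetric])

section \<open>Typical phase errors\<close>

text \<open>
  The value at an outcome of probability 0 is junk (the logarithm of 0 is 0).
\<close>
definition info3 :: "real \<Rightarrow> nat \<Rightarrow> real" where
  "info3 p i = - log 2 (bern3 p i)"

primrec info :: "real \<Rightarrow> nat \<Rightarrow> nat \<Rightarrow> real" where
  "info p 0 x = 0"
| "info p (Suc n) x = info3 p (x div 3 ^ n) + info p n (x mod 3 ^ n)"

lemma bern_eq_powr_info: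
  assumes "0 \<le> p" "p \<le> 1" "bern p n x \<noteq> 0"
  shows "bern p n x = 2 powr (- info p n x)"
  using assms(3)
proof (induction n arbitrary: x)
  case (Suc n)
  then have "bern3 p (x div 3 ^ n) \<noteq> 0" "bern p n (x mod 3 ^ n) = 2 powr (- info p n (x mod 3 ^ n))"
    by auto
  moreover from this have "bern3 p (x div 3 ^ n) = 2 powr (- info3 p (x div 3 ^ n))"
    using bern3_nonneg[OF assms(1,2), of "x div 3 ^ n"] by (simp add: info3_def)
  ultimately show ?case by (simp add: powr_add[symmetric])
qed simp

lemma info3_mean: "(\<Sum>i<3. bern3 p i * info3 p i) = binary_entropy p"
  by (simp add: sum3 bern3_def info3_def binary_entropy_def)

definition info_variance :: "real \<Rightarrow> real" where
  "info_variance p = (\<Sum>i<3. bern3 p i * (info3 p i - binary_entropy p)\<^sup>2)"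

text \<open>The deviation of a word is the sum of the deviations of its first digit and of the rest,
  which are independent. Both have mean 0, so the cross term vanishes and variances add.\<close>

lemma info_moments:
  "(\<Sum>x<3 ^ n. bern p n x * (info p n x - real n * binary_entropy p)) = 0"
  "(\<Sum>x<3 ^ n. bern p n x * (info p n x - real n * binary_entropy p)\<^sup>2) = real n * info_variance p"
proof (induction n)
  case (Suc n)
  let ?H = "binary_entropy p"
  let ?f = "\<lambda>i. info3 p i - ?H" and ?g = "\<lambda>j. info p n j - real n * ?H"
  have split: "info p (Suc n) (i * 3 ^ n + j) - real (Suc n) * ?H = ?f i + ?g j" if "j < 3 ^ n" for i j
    using that by (simp add: algebra_simps)
  have sum_b: "(\<Sum>i<3. bern3 p i) = 1" by (simp add: sum3 bern3_def)
  have mean: "(\<Sum>i<3. bern3 p i * ?f i) = 0"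
    using info3_mean[of p] sum_b by (simp add: algebra_simps sum_subtractf flip: sum_distrib_left)
  have prod: "(\<Sum>x<3 ^ Suc n. bern p (Suc n) x * F (info p (Suc n) x - real (Suc n) * ?H))
      = (\<Sum>i<3. \<Sum>j<3 ^ n. bern3 p i * bern p n j * F (?f i + ?g j))" for F :: "real \<Rightarrow> real"
    unfolding pow3_sum by (intro sum.cong refl) (simp only: split lessThan_iff, simp)
  have S: "(\<Sum>i<3. \<Sum>j<3 ^ n. (bern3 p i * u i) * (bern p n j * v j))
      = (\<Sum>i<3. bern3 p i * u i) * (\<Sum>j<3 ^ n. bern p n j * v j)" for u v
    by (simp only: sum_product)
  have "(\<Sum>x<3 ^ Suc n. bern p (Suc n) x * (info p (Suc n) x - real (Suc n) * ?H)) =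
      (\<Sum>i<3. \<Sum>j<3 ^ n. (bern3 p i * ?f i) * (bern p n j * 1)) + (\<Sum>i<3. \<Sum>j<3 ^ n. (bern3 p i * 1) * (bern p n j * ?g j))"
    unfolding prod[of "\<lambda>x. x"] sum.distrib[symmetric] by (intro sum.cong refl) (simp only: ring_distribs mult_ac mult_1_right)
  also have "\<dots> = 0" unfolding S using mean Suc.IH(1) by simp
  finally show "(\<Sum>x<3 ^ Suc n. bern p (Suc n) x * (info p (Suc n) x - real (Suc n) * ?H)) = 0" .
  have "(\<Sum>x<3 ^ Suc n. bern p (Suc n) x * (info p (Suc n) x - real (Suc n) * ?H)\<^sup>2) =
      (\<Sum>i<3. \<Sum>j<3 ^ n. (bern3 p i * (?f i)\<^sup>2) * (bern p n j * 1))
      + (\<Sum>i<3. \<Sum>j<3 ^ n. (bern3 p i * ?f i) * (bern p n j * (2 * ?g j)))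
      + (\<Sum>i<3. \<Sum>j<3 ^ n. (bern3 p i * 1) * (bern p n j * (?g j)\<^sup>2))"
    unfolding prod[of "\<lambda>x. x\<^sup>2"] sum.distrib[symmetric]
    by (intro sum.cong refl) (simp only: power2_sum ring_distribs mult_ac mult_1_right)
  also have "\<dots> = info_variance p + real n * info_variance p"
    unfolding S using mean Suc.IH(2) sum_b bern_sum[of p n] by (simp add: info_variance_def)
  finally show "(\<Sum>x<3 ^ Suc n. bern p (Suc n) x * (info p (Suc n) x - real (Suc n) * ?H)\<^sup>2)
      = real (Suc n) * info_variance p" by (simp add: algebra_simps)
qed simp_all

text \<open>The deviation is demanded only at outcomes of positive probability, since
  \<open>info\<close> is meaningless elsewhere and such outcomes carry no weight.\<close>

lemma bern_concentration:
  assumes p: "0 \<le> p" "p \<le> 1" and n: "0 < n" and \<eta>: "0 < \<eta>"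
    and S: "S \<subseteq> {..<3 ^ n}"
    and dev: "\<And>x. x \<in> S \<Longrightarrow> bern p n x \<noteq> 0 \<Longrightarrow> real n * \<eta> \<le> \<bar>info p n x - real n * binary_entropy p\<bar>"
  shows "(\<Sum>x\<in>S. bern p n x) \<le> info_variance p / (real n * \<eta>\<^sup>2)"
proof -
  let ?d = "\<lambda>x. info p n x - real n * binary_entropy p"
  have "(real n * \<eta>)\<^sup>2 * (\<Sum>x\<in>S. bern p n x) \<le> (\<Sum>x\<in>S. bern p n x * (?d x)\<^sup>2)"
    unfolding sum_distrib_left
  proof (rule sum_mono)
    fix x assume x: "x \<in> S"
    show "(real n * \<eta>)\<^sup>2 * bern p n x \<le> bern p n x * (?d x)\<^sup>2"
    proof (cases "bern p n x = 0")
      case False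
      have "(real n * \<eta>)\<^sup>2 \<le> (?d x)\<^sup>2"
        using dev[OF x False] \<eta> by (metis abs_le_square_iff abs_of_nonneg mult_nonneg_nonneg of_nat_0_le_iff order_less_imp_le)
      then show ?thesis using bern_nonneg[OF p, of n x] by (simp add: mult.commute mult_left_mono)
    qed simp
  qed
  also have "\<dots> \<le> (\<Sum>x<3 ^ n. bern p n x * (?d x)\<^sup>2)"
    using S bern_nonneg[OF p] by (intro sum_mono2) auto
  also have "\<dots> = real n * info_variance p" by (rule info_moments(2))
  finally have "(\<Sum>x\<in>S. bern p n x) \<le> real n * info_variance p / (real n * \<eta>)\<^sup>2"
    using n \<eta> by (simp add: pos_le_divide_eq mult.commute)
  also have "\<dots> = info_variance p / (real n * \<eta>\<^sup>2)"
    using n by (simp add: power2_eq_square)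
  finally show ?thesis .
qed

text \<open>This tail is the weight outside the typical set, lost in the direct part. The opposite
  tail, \<open>bern_large_weight\<close>, serves the converse.\<close>

lemma bern_small_weight:
  assumes p: "0 \<le> p" "p \<le> 1" and n: "0 < n" and \<eta>: "0 < \<eta>"
  shows "(\<Sum>x | x < 3 ^ n \<and> bern p n x < 2 powr (- (real n * (binary_entropy p + \<eta>))). bern p n x)
    \<le> info_variance p / (real n * \<eta>\<^sup>2)"
proof (rule bern_concentration[OF p n \<eta>])
  fix x assume "x \<in> {x. x < 3 ^ n \<and> bern p n x < 2 powr (- (real n * (binary_entropy p + \<eta>)))}"
    and nz: "bern p n x \<noteq> 0"
  then have "real n * (binary_entropy p + \<eta>) < info p n x"
    using bern_eq_powr_info[OF p nz] by simp
  then show "real n * \<eta> \<le> \<bar>info p n x - real n * binary_entropy p\<bar>" by (simp add: algebra_simps)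
qed auto

lemma bern_large_weight:
  assumes p: "0 \<le> p" "p \<le> 1" and n: "0 < n" and \<eta>: "0 < \<eta>"
  shows "(\<Sum>x | x < 3 ^ n \<and> 2 powr (- (real n * (binary_entropy p - \<eta>))) < bern p n x. bern p n x)
    \<le> info_variance p / (real n * \<eta>\<^sup>2)"
proof (rule bern_concentration[OF p n \<eta>])
  fix x assume "x \<in> {x. x < 3 ^ n \<and> 2 powr (- (real n * (binary_entropy p - \<eta>))) < bern p n x}"
    and nz: "bern p n x \<noteq> 0"
  then have "info p n x < real n * (binary_entropy p - \<eta>)"
    using bern_eq_powr_info[OF p nz] by simp
  then show "real n * \<eta> \<le> \<bar>info p n x - real n * binary_entropy p\<bar>" by (simp add: algebra_simps)
qed auto

section \<open>Linear ternary codes\<close>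

text \<open>Closure under addition makes C a linear subspace over Z/3, because the inverse of c is c
  + c and there are no other nonzero scalars than 1 and 2.\<close>

definition trit_code :: "nat \<Rightarrow> nat set \<Rightarrow> bool" where
  "trit_code n C \<longleftrightarrow> C \<subseteq> {..<3 ^ n} \<and> 0 \<in> C \<and> (\<forall>c\<in>C. \<forall>d\<in>C. trit_add n c d \<in> C)"

text \<open>The other members of E in the coset e + C, which a decoder that learns only the coset
  cannot tell from e.\<close>

definition collisions :: "nat \<Rightarrow> nat set \<Rightarrow> nat set \<Rightarrow> nat \<Rightarrow> nat set" where
  "collisions n E C e = {e' \<in> E. e' \<noteq> e \<and> (\<exists>c\<in>C. e' = trit_add n e c)}"

text \<open>Collisions are counted, not merely detected: the count is a sum over pairs of errors,
  which can be averaged over generators pair by pair.\<close>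

definition collision_weight :: "nat \<Rightarrow> nat set \<Rightarrow> (nat \<Rightarrow> real) \<Rightarrow> nat set \<Rightarrow> real" where
  "collision_weight n E w C = (\<Sum>e\<in>E. w e * real (card (collisions n E C e)))"

lemma trit_add_left_commute: "trit_add n x (trit_add n y z) = trit_add n y (trit_add n x z)"
  by (metis trit_add_assoc trit_add_commute)

lemmas trit_add_ac = trit_add_assoc trit_add_commute trit_add_left_commute

lemma trit_add_triple_left:
  "y < 3 ^ n \<Longrightarrow> trit_add n x (trit_add n x (trit_add n x y)) = y"
  by (metis trit_add_assoc trit_add_triple trit_add_zero)

text \<open>D is the span of C and v, the union of the cosets of 0, v and 2 v. They are disjoint
  because v is not in C.\<close>

lemma trit_code_extend:
  assumes C: "trit_code n C" and card: "card C = 3 ^ k" and v: "v < 3 ^ n" "v \<notin> C"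
  defines "D \<equiv> C \<union> (\<lambda>c. trit_add n c v) ` C \<union> (\<lambda>c. trit_add n c (trit_add n v v)) ` C"
  shows "trit_code n D" "card D = 3 ^ Suc k"
proof -
  let ?A = "trit_add n"
  have CG: "c < 3 ^ n" if "c \<in> C" for c using C that by (auto simp: trit_code_def)
  have Cadd: "?A c d \<in> C" if "c \<in> C" "d \<in> C" for c d using C that by (auto simp: trit_code_def)
  have C0: "0 \<in> C" using C by (simp add: trit_code_def)
  have fin: "finite C" using C by (auto simp: trit_code_def intro: finite_subset)
  have mem: "x \<in> D \<longleftrightarrow> x \<in> C \<or> (\<exists>c\<in>C. x = ?A c v) \<or> (\<exists>c\<in>C. x = ?A c (?A v v))" for x
    by (auto simp: D_def)
  have vv: "?A c (?A v (?A v v)) = c" if "c < 3 ^ n" for c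
    using that trit_add_triple[of n v] trit_add_zero[of c n] by (simp add: trit_add_commute[of n c])
  have inv1: "?A (?A c v) (?A v v) = c" and inv2: "?A (?A c (?A v v)) v = c" if "c \<in> C" for c
    using vv[OF CG[OF that]] by (simp_all only: trit_add_ac)
  have inj1: "c = d" if "c \<in> C" "d \<in> C" "?A c v = ?A d v" for c d
    by (metis inv1 that)
  have inj2: "c = d" if "c \<in> C" "d \<in> C" "?A c (?A v v) = ?A d (?A v v)" for c d
    by (metis inv2 that)
  \<comment> \<open>Adding c twice to c + v leaves v, which would then belong to C.\<close>
  have notC1: "?A c v \<notin> C" if "c \<in> C" for c
  proof
    assume "?A c v \<in> C"
    then have "?A c (?A c (?A c v)) \<in> C" using that Cadd by blast
    then show False using v by (simp add: trit_add_triple_left)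
  qed
  have notC2: "?A c (?A v v) \<notin> C" if "c \<in> C" for c
  proof
    assume "?A c (?A v v) \<in> C"
    \<comment> \<open>Here c + 2 (c + 2 v) = 3 c + 4 v = v.\<close>
    then have "?A c (?A (?A c (?A v v)) (?A c (?A v v))) \<in> C" using that Cadd by blast
    also have "?A c (?A (?A c (?A v v)) (?A c (?A v v))) = ?A c (?A c (?A c (?A v (?A v (?A v v)))))"
      by (simp only: trit_add_ac)
    also have "\<dots> = v" using v by (simp add: trit_add_triple_left)
    finally show False using v by simp
  qed
  have disj: "?A c v \<noteq> ?A d (?A v v)" if "c \<in> C" "d \<in> C" for c d
  proof
    assume eq: "?A c v = ?A d (?A v v)"
    have "c = ?A (?A c v) (?A v v)" using vv[OF CG[OF that(1)]] by (simp only: trit_add_ac)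
    also have "\<dots> = ?A d (?A v (?A v (?A v v)))" unfolding eq by (simp only: trit_add_ac)
    also have "\<dots> = ?A d v" using v by (simp add: trit_add_triple_left)
    finally show False using notC1[OF that(2)] that(1) by simp
  qed
  show "trit_code n D"
    unfolding trit_code_def
  proof (intro conjI ballI)
    show "D \<subseteq> {..<3 ^ n}" using CG by (auto simp: D_def trit_add_less)
    show "0 \<in> D" using C0 by (simp add: D_def)
    fix x y assume "x \<in> D" "y \<in> D"
    then obtain c d where cd: "c \<in> C" "d \<in> C"
      and x: "x = c \<or> x = ?A c v \<or> x = ?A c (?A v v)" and y: "y = d \<or> y = ?A d v \<or> y = ?A d (?A v v)"
      unfolding mem by blast
    have "?A c d \<in> C" using cd by (rule Cadd)
    have "?A x y \<in> {?A c d, ?A (?A c d) v, ?A (?A c d) (?A v v)}"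
    proof -
      have 1: "?A (?A c v) (?A d (?A v v)) = ?A c d" "?A (?A c (?A v v)) (?A d v) = ?A c d"
        using vv[OF trit_add_less, of c d] by (simp_all only: trit_add_ac)
      have 2: "?A (?A c (?A v v)) (?A d (?A v v)) = ?A (?A c d) v"
      proof -
        have "?A (?A c (?A v v)) (?A d (?A v v)) = ?A (?A c d) (?A v (?A v (?A v v)))"
          by (simp only: trit_add_ac)
        then show ?thesis using v by (simp add: trit_add_triple_left)
      qed
      have 3: "?A c (?A d v) = ?A (?A c d) v" "?A c (?A d (?A v v)) = ?A (?A c d) (?A v v)"
        "?A (?A c v) d = ?A (?A c d) v" "?A (?A c v) (?A d v) = ?A (?A c d) (?A v v)"
        "?A (?A c (?A v v)) d = ?A (?A c d) (?A v v)"
        by (simp_all only: trit_add_ac)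
      show ?thesis using x y by (elim disjE) (simp_all only: 1 2 3 insert_iff simp_thms)
    qed
    then have "?A x y = ?A c d \<or> ?A x y = ?A (?A c d) v \<or> ?A x y = ?A (?A c d) (?A v v)"
      by (simp only: insert_iff empty_iff simp_thms)
    then show "?A x y \<in> D" unfolding mem using Cadd[OF cd] by metis
  qed
  have "card D = card C + card ((\<lambda>c. ?A c v) ` C) + card ((\<lambda>c. ?A c (?A v v)) ` C)"
  proof -
    have "C \<inter> (\<lambda>c. ?A c v) ` C = {}" using notC1 by blast
    moreover have "(C \<union> (\<lambda>c. ?A c v) ` C) \<inter> (\<lambda>c. ?A c (?A v v)) ` C = {}"
      using notC2 disj by blast
    ultimately show ?thesis
      unfolding D_def using fin by (simp add: card_Un_disjoint)
  qed
  also have "\<dots> = 3 * card C"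
    using inj1 inj2 by (simp add: card_image inj_on_def)
  finally show "card D = 3 ^ Suc k" using card by simp
qed

text \<open>
  For e' - e outside C, at most 2 |C| choices of v put e' - e into the span of C and v. Averaging
  over all v outside C therefore bounds the increase for some v.
\<close>
lemma collision_weight_extend:
  assumes C: "trit_code n C" and card: "card C = 3 ^ k" and k: "k < n"
    and E: "E \<subseteq> {..<3 ^ n}" and w: "\<And>e. e \<in> E \<Longrightarrow> 0 \<le> w e"
  obtains D where "trit_code n D" "card D = 3 ^ Suc k"
    "collision_weight n E w D \<le> collision_weight n E w C + 3 * 3 ^ k * real (card E) * sum w E / 3 ^ n"
proof -
  let ?A = "trit_add n"
  have CG: "C \<subseteq> {..<3 ^ n}" using C by (auto simp: trit_code_def)
  have finC: "finite C" and finE: "finite E" using CG E by (auto intro: finite_subset)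
  define V where "V = {..<3 ^ n} - C"
  have finV: "finite V" by (simp add: V_def)
  have "card V = 3 ^ n - 3 ^ k" using CG finC card by (simp add: V_def card_Diff_subset)
  moreover have "(3::nat) ^ k \<le> 3 ^ n" using k by simp
  ultimately have "real (card V) = 3 ^ n - 3 ^ k" by (simp add: of_nat_diff)
  moreover have "(3::real) * 3 ^ k \<le> 3 ^ n" using power_increasing[of "Suc k" n "3 :: real"] k by simp
  \<comment> \<open>Since C fills at most a third of the space, V has at least two thirds of all
    words. This turns the 2 of the two new cosets into the 3 of the bound.\<close>
  ultimately have V: "2 * 3 ^ n \<le> 3 * real (card V)" by simp
  then have Vpos: "0 < real (card V)" by (smt (verit) zero_less_power)
  define D where "D v = C \<union> (\<lambda>c. ?A c v) ` C \<union> (\<lambda>c. ?A c (?A v v)) ` C" for v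
  \<comment> \<open>These are the generators v that put e' - e into C + v and into C + 2 v. Solving
    for v gives one candidate per code word c: v = e' + 2 e + 2 c and v = 2 e' + e + c
    respectively.\<close>
  define P Q where "P e e' = {v. v < 3 ^ n \<and> (\<exists>c\<in>C. e' = ?A e (?A c v))}"
    and "Q e e' = {v. v < 3 ^ n \<and> (\<exists>c\<in>C. e' = ?A e (?A c (?A v v)))}" for e e'
  have PQ: "card (P e e') \<le> 3 ^ k" "card (Q e e') \<le> 3 ^ k" for e e'
  proof -
    have "P e e' \<subseteq> (\<lambda>c. ?A (?A e e) (?A (?A c c) e')) ` C"
    proof
      fix v assume "v \<in> P e e'"
      then obtain c where c: "c \<in> C" "e' = ?A e (?A c v)" and v: "v < 3 ^ n" by (auto simp: P_def)
      have "?A (?A e e) (?A (?A c c) e') = ?A e (?A e (?A e (?A c (?A c (?A c v)))))"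
        unfolding c by (simp only: trit_add_ac)
      also have "\<dots> = v" using v by (simp add: trit_add_triple_left)
      finally show "v \<in> (\<lambda>c. ?A (?A e e) (?A (?A c c) e')) ` C" using c by force
    qed
    then show "card (P e e') \<le> 3 ^ k"
      using surj_card_le[OF finC] card by metis
    have "Q e e' \<subseteq> (\<lambda>c. ?A e (?A c (?A e' e'))) ` C"
    proof
      fix v assume "v \<in> Q e e'"
      then obtain c where c: "c \<in> C" "e' = ?A e (?A c (?A v v))" and v: "v < 3 ^ n" by (auto simp: Q_def)
      have "?A e (?A c (?A e' e')) = ?A e (?A e (?A e (?A c (?A c (?A c (?A v (?A v (?A v v))))))))"
        unfolding c by (simp only: trit_add_ac)
      also have "\<dots> = v" using v by (simp add: trit_add_triple_left)
      finally show "v \<in> (\<lambda>c. ?A e (?A c (?A e' e'))) ` C" using c by force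
    qed
    then show "card (Q e e') \<le> 3 ^ k"
      using surj_card_le[OF finC] card by metis
  qed
  have coll: "real (card (collisions n E (D v) e)) \<le> real (card (collisions n E C e))
      + (\<Sum>e'\<in>E. of_bool (v \<in> P e e') + of_bool (v \<in> Q e e'))" if "v \<in> V" for v e
  proof -
    have v: "v < 3 ^ n" using that by (simp add: V_def)
    have "collisions n E (D v) e \<subseteq> collisions n E C e \<union> ({e' \<in> E. v \<in> P e e'} \<union> {e' \<in> E. v \<in> Q e e'})"
      using v by (auto simp: collisions_def D_def P_def Q_def)
    then have "card (collisions n E (D v) e) \<le> card (collisions n E C e \<union> ({e' \<in> E. v \<in> P e e'} \<union> {e' \<in> E. v \<in> Q e e'}))"
      using finE by (intro card_mono) (auto simp: collisions_def)
    also have "\<dots> \<le> card (collisions n E C e) + (card {e' \<in> E. v \<in> P e e'} + card {e' \<in> E. v \<in> Q e e'})"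
      by (meson add_left_mono card_Un_le le_trans)
    finally have "real (card (collisions n E (D v) e)) \<le> real (card (collisions n E C e))
        + (real (card {e' \<in> E. v \<in> P e e'}) + real (card {e' \<in> E. v \<in> Q e e'}))"
      by linarith
    moreover have "real (card {e' \<in> E. R e'}) = (\<Sum>e'\<in>E. of_bool (R e'))" for R
      using finE by (simp add: of_bool_def sum.If_cases Int_def)
    ultimately show ?thesis by (simp add: sum.distrib)
  qed
  have "(\<Sum>v\<in>V. collision_weight n E w (D v))
      \<le> (\<Sum>v\<in>V. \<Sum>e\<in>E. w e * (real (card (collisions n E C e)) + (\<Sum>e'\<in>E. of_bool (v \<in> P e e') + of_bool (v \<in> Q e e'))))"
    unfolding collision_weight_def using coll w by (intro sum_mono mult_left_mono) auto
  also have "\<dots> = (\<Sum>v\<in>V. collision_weight n E w C)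
      + (\<Sum>v\<in>V. \<Sum>e\<in>E. w e * (\<Sum>e'\<in>E. of_bool (v \<in> P e e') + of_bool (v \<in> Q e e')))"
    by (simp add: collision_weight_def distrib_left sum.distrib)
  also have "(\<Sum>v\<in>V. \<Sum>e\<in>E. w e * (\<Sum>e'\<in>E. of_bool (v \<in> P e e') + of_bool (v \<in> Q e e')))
      = (\<Sum>e\<in>E. w e * (\<Sum>v\<in>V. \<Sum>e'\<in>E. of_bool (v \<in> P e e') + of_bool (v \<in> Q e e')))"
    by (subst sum.swap) (simp only: sum_distrib_left)
  also have "\<dots> = (\<Sum>e\<in>E. w e * (\<Sum>e'\<in>E. \<Sum>v\<in>V. of_bool (v \<in> P e e') + of_bool (v \<in> Q e e')))"
    by (subst sum.swap) simp
  also have "\<dots> \<le> (\<Sum>e\<in>E. w e * (\<Sum>e'\<in>E. 2 * 3 ^ k))"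
  proof (intro sum_mono mult_left_mono w)
    fix e e'
    have S: "(\<Sum>v\<in>V. of_bool (v \<in> R)) \<le> real (card R)" if "finite R" for R
    proof -
      have "(\<Sum>v\<in>V. of_bool (v \<in> R)) = real (card (V \<inter> R))"
        using finV by (simp add: of_bool_def sum.If_cases Int_def)
      then show ?thesis using that by (simp add: card_mono)
    qed
    have "real (card (P e e')) \<le> 3 ^ k" "real (card (Q e e')) \<le> 3 ^ k"
      using PQ[of e e'] by (metis of_nat_le_iff of_nat_numeral of_nat_power)+
    moreover have "finite (P e e')" "finite (Q e e')" by (simp_all add: P_def Q_def)
    ultimately show "(\<Sum>v\<in>V. of_bool (v \<in> P e e') + of_bool (v \<in> Q e e')) \<le> (2 * 3 ^ k :: real)"
      using S[of "P e e'"] S[of "Q e e'"] unfolding sum.distrib by linarith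
  qed
  also have "\<dots> = 2 * 3 ^ k * real (card E) * sum w E"
    by (simp add: sum_distrib_right[symmetric] mult_ac)
  finally have avg: "(\<Sum>v\<in>V. collision_weight n E w (D v))
      \<le> real (card V) * collision_weight n E w C + 2 * 3 ^ k * real (card E) * sum w E" by simp
  let ?B = "3 * 3 ^ k * real (card E) * sum w E / 3 ^ n"
  have "\<exists>v\<in>V. collision_weight n E w (D v) \<le> collision_weight n E w C + ?B"
  proof (rule ccontr)
    assume "\<not> ?thesis"
    then have "(\<Sum>v\<in>V. collision_weight n E w C + ?B) < (\<Sum>v\<in>V. collision_weight n E w (D v))"
      using finV Vpos by (intro sum_strict_mono) (auto simp: not_le)
    then have "real (card V) * ?B < 2 * 3 ^ k * real (card E) * sum w E"
      using avg by (simp add: distrib_left)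
    moreover have "2 * 3 ^ k * real (card E) * sum w E \<le> real (card V) * ?B"
    proof -
      have W: "0 \<le> 3 ^ k * real (card E) * sum w E / 3 ^ n" using w by (simp add: sum_nonneg)
      have "(2 * 3 ^ n) * (3 ^ k * real (card E) * sum w E / 3 ^ n) \<le> 3 * real (card V) * (3 ^ k * real (card E) * sum w E / 3 ^ n)"
        using V W by (rule mult_right_mono)
      then show ?thesis by (simp add: mult_ac)
    qed
    ultimately show False by linarith
  qed
  then obtain v where v: "v \<in> V" "collision_weight n E w (D v) \<le> collision_weight n E w C + ?B" by blast
  then have "v < 3 ^ n" "v \<notin> C" by (auto simp: V_def)
  from trit_code_extend[OF C card this] v(2) show thesis
    by (intro that[of "D v"]) (simp_all add: D_def)
qed

text \<open>The increments 3 * \<open>3 ^ j\<close> for j < k form a geometric series, which is the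
  origin of 3/2 * \<open>3 ^ k\<close>. The induction starts with the code {0}, which has no
  collisions.\<close>

lemma trit_code_exists:
  assumes E: "E \<subseteq> {..<3 ^ n}" and w: "\<And>e. e \<in> E \<Longrightarrow> 0 \<le> w e" and k: "k \<le> n"
  obtains C where "trit_code n C" "card C = 3 ^ k"
    "collision_weight n E w C \<le> 3 / 2 * 3 ^ k * real (card E) * sum w E / 3 ^ n"
proof -
  have "\<exists>C. trit_code n C \<and> card C = 3 ^ k \<and>
      collision_weight n E w C \<le> 3 / 2 * 3 ^ k * real (card E) * sum w E / 3 ^ n"
    using k
  proof (induction k)
    case 0
    have z: "trit_add n e 0 = e" if "e \<in> E" for e
      using E that trit_add_zero[of e n] by (auto simp: trit_add_commute[of n e])
    have "collisions n E {0} e = {}" if "e \<in> E" for e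
      using z[OF that] by (auto simp: collisions_def)
    then have "collision_weight n E w {0} = 0" by (simp add: collision_weight_def)
    moreover have "trit_code n {0}" by (simp add: trit_code_def trit_add_zero)
    moreover have "0 \<le> 3 / 2 * 3 ^ 0 * real (card E) * sum w E / 3 ^ n" using w by (simp add: sum_nonneg)
    ultimately show ?case by (intro exI[of _ "{0}"]) simp
  next
    case (Suc k)
    then obtain C where C: "trit_code n C" "card C = 3 ^ k"
      "collision_weight n E w C \<le> 3 / 2 * 3 ^ k * real (card E) * sum w E / 3 ^ n" by auto
    obtain D where "trit_code n D" "card D = 3 ^ Suc k"
      "collision_weight n E w D \<le> collision_weight n E w C + 3 * 3 ^ k * real (card E) * sum w E / 3 ^ n"
      using collision_weight_extend[where w = w, OF C(1,2) _ E] w Suc.prems by (metis Suc_le_eq)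
    then show ?case using C(3) by (intro exI[of _ D]) (simp add: field_simps)
  qed
  then show thesis using that by blast
qed

section \<open>The converse\<close>

definition max_entangled :: "nat \<Rightarrow> complex vec" where
  "max_entangled s = vec (s * s) (\<lambda>r. of_bool (r div s = r mod s) / of_real (sqrt (real s)))"

lemma max_entangled_carrier [simp]: "max_entangled s \<in> carrier_vec (s * s)"
  by (simp add: max_entangled_def)

lemma max_entangled_dim [simp]: "dim_vec (max_entangled s) = s * s"
  by (simp add: max_entangled_def)

lemma max_entangled_entry:
  "i < s \<Longrightarrow> a < s \<Longrightarrow> max_entangled s $ (i * s + a) = of_bool (a = i) / of_real (sqrt (real s))"
  by (auto simp: max_entangled_def pair_index_less)

lemma max_entangled_unit:
  assumes "0 < s"
  shows "max_entangled s \<bullet>c max_entangled s = 1"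
proof -
  have "max_entangled s \<bullet>c max_entangled s
      = (\<Sum>r<s * s. max_entangled s $ r * cnj (max_entangled s $ r))"
    by (simp add: scalar_prod_def atLeast0LessThan)
  also have "\<dots> = (\<Sum>i<s. \<Sum>a<s. of_bool (a = i) * (1 / of_real (real s)))"
    unfolding sum_lessThan_mult_split
    by (intro sum.cong refl) (simp add: max_entangled_entry flip: of_real_mult)
  also have "\<dots> = (\<Sum>i<s. 1 / of_real (real s))"
    by (intro sum.cong refl sum_of_bool_eq_mult) simp
  finally show ?thesis using assms by simp
qed

text \<open>The entanglement fidelity of T multiplied by the square of s, which is a linear
  expression in T.\<close>

definition diagonal_sum :: "nat \<Rightarrow> (complex mat \<Rightarrow> complex mat) \<Rightarrow> complex" where
  "diagonal_sum s T = (\<Sum>i<s. \<Sum>k<s. T (elem_mat s i k) $$ (i, k))"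

lemma max_entangled_fidelity:
  assumes T: "quantum_channel s s T" and s: "0 < s"
  shows "of_real (fidelity (ket_bra (max_entangled s))
      (tensor_map s s s s (\<lambda>Y. Y) T (ket_bra (max_entangled s)))) = diagonal_sum s T / of_nat (s * s)"
proof -
  let ?\<phi> = "max_entangled s" and ?\<sigma> = "tensor_map s s s s (\<lambda>Y. Y) T (ket_bra (max_entangled s))"
  have sq: "of_real (sqrt (real s)) * of_real (sqrt (real s)) = (of_nat s :: complex)"
    by (simp flip: of_real_mult)
  have block: "block_mat s i k (ket_bra ?\<phi>) = (1 / of_nat s) \<cdot>\<^sub>m elem_mat s i k" if "i < s" "k < s" for i k
    using that by (intro eq_matI)
      (auto simp: elem_mat_def block_mat_def ket_bra_entry[OF max_entangled_carrier] pair_index_less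
        max_entangled_entry sq)
  have Tb: "T (block_mat s i k (ket_bra ?\<phi>)) $$ (a, b) = T (elem_mat s i k) $$ (a, b) / of_nat s"
    if "i < s" "k < s" "a < s" "b < s" for i k a b
  proof -
    have "T (block_mat s i k (ket_bra ?\<phi>)) = (1 / of_nat s) \<cdot>\<^sub>m T (elem_mat s i k)"
      unfolding block[OF that(1,2)] using quantum_channelD(1)[OF T] by (simp add: linear_op_map_def)
    then show ?thesis using quantum_channelD(2)[OF T, of "elem_mat s i k"] that by simp
  qed
  have "psd_mat (s * s) ?\<sigma>"
    by (rule quantum_channelD(3)[OF T psd_ket_bra[OF max_entangled_carrier]])
  then have "of_real (fidelity (ket_bra ?\<phi>) ?\<sigma>) = qform (s * s) ?\<sigma> (($) ?\<phi>)"
    by (rule fidelity_ket_bra[OF max_entangled_carrier max_entangled_unit[OF s]])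
  also have "\<dots> = (\<Sum>i<s. \<Sum>a<s. \<Sum>k<s. \<Sum>b<s. of_bool (a = i) * (of_bool (b = k) *
      (T (elem_mat s i k) $$ (a, b) / of_nat (s * s))))"
    unfolding qform_def sum_lessThan_mult_split
    using sq by (intro sum.cong refl)
      (simp add: max_entangled_entry tensor_id_entry[where L = T, OF quantum_channelD(2)[OF T]] pair_index_less Tb)
  also have "\<dots> = (\<Sum>i<s. \<Sum>a<s. of_bool (a = i) * (\<Sum>k<s. T (elem_mat s i k) $$ (a, k) / of_nat (s * s)))"
    unfolding sum_distrib_left[symmetric]
    by (intro sum.cong refl arg_cong2[where f = "(*)"] sum_of_bool_eq_mult) simp
  also have "\<dots> = (\<Sum>i<s. \<Sum>k<s. T (elem_mat s i k) $$ (i, k) / of_nat (s * s))"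
    by (intro sum.cong refl sum_of_bool_eq_mult) simp
  finally show ?thesis by (simp add: diagonal_sum_def sum_divide_distrib)
qed

lemma channel_diag_entries:
  assumes T: "quantum_channel d e T" and "i < d"
  shows "\<And>a. a < e \<Longrightarrow> 0 \<le> Re (T (elem_mat d i i) $$ (a, a))"
    and "(\<Sum>a<e. Re (T (elem_mat d i i) $$ (a, a))) = 1"
proof -
  show "0 \<le> Re (T (elem_mat d i i) $$ (a, a))" if "a < e" for a
    using psd_diag_of_real(2)[OF psd_choi_submatrix[OF T, of 1 "\<lambda>_. i" "\<lambda>_. a"], of 0] assms(2) that by simp
  have "mat_trace (elem_mat d i i) = (\<Sum>j<d. of_bool (j = i) * 1)"
    by (simp add: mat_trace_eq[of _ d])
  also have "\<dots> = 1" using assms(2) by (rule sum_of_bool_eq_mult)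
  finally have "mat_trace (T (elem_mat d i i)) = 1"
    using quantum_channelD(4)[OF T, of "elem_mat d i i"] by simp
  then have "Re (\<Sum>a<e. T (elem_mat d i i) $$ (a, a)) = 1"
    using quantum_channelD(2)[OF T, of "elem_mat d i i"] by (simp add: mat_trace_eq)
  then show "(\<Sum>a<e. Re (T (elem_mat d i i) $$ (a, a))) = 1" by simp
qed

text \<open>The entanglement fidelity lies between 0 and 1. M is a principal submatrix of the Choi
  matrix and the diagonal sum is its form at the all-ones vector. The upper bound pairs M with the
  all-ones matrix: each of the two has trace at most s.\<close>

lemma diagonal_sum_bounds:
  assumes T: "quantum_channel s s T"
  shows "0 \<le> Re (diagonal_sum s T)" "Re (diagonal_sum s T) \<le> real (s * s)"
proof -
  define M where "M = mat s s (\<lambda>(x, y). T (elem_mat s x y) $$ (x, y))"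
  have M: "psd_mat s M"
    unfolding M_def by (rule psd_choi_submatrix[OF T, of s "\<lambda>x. x" "\<lambda>x. x"]) simp
  define J where "J = mat s s (\<lambda>_. 1 :: complex)"
  have J: "psd_mat s J"
    by (rule psd_gram_sum[where I = "{()}" and w = "\<lambda>_ _. 1"]) (simp_all add: J_def)
  have eq: "diagonal_sum s T = (\<Sum>i<s. \<Sum>j<s. M $$ (i, j) * J $$ (i, j))"
    by (simp add: diagonal_sum_def M_def J_def)
  have "diagonal_sum s T = qform s M (\<lambda>_. 1)"
    by (simp add: diagonal_sum_def qform_def M_def)
  then show "0 \<le> Re (diagonal_sum s T)"
    using psd_mat_qform[OF M, of "\<lambda>_. 1"] by (simp add: less_eq_complex_def)
  have diag: "Re (M $$ (i, i)) \<le> 1" if "i < s" for i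
    using channel_diag_entries[OF T that] that member_le_sum[of i "{..<s}" "\<lambda>a. Re (T (elem_mat s i i) $$ (a, a))"]
    by (simp add: M_def)
  have "Re (diagonal_sum s T) \<le> cmod (diagonal_sum s T)" by (rule complex_Re_le_cmod)
  also have "\<dots> \<le> (\<Sum>i<s. Re (M $$ (i, i))) * (\<Sum>i<s. Re (J $$ (i, i)))"
    unfolding eq by (rule psd_pairing_bound[OF M J])
  also have "(\<Sum>i<s. Re (J $$ (i, i))) = real s" by (simp add: J_def)
  also have "(\<Sum>i<s. Re (M $$ (i, i))) * real s \<le> (\<Sum>i<s. 1) * real s"
    using diag by (intro mult_right_mono sum_mono) auto
  finally show "Re (diagonal_sum s T) \<le> real (s * s)" by simp
qed

section \<open>Averaging over phase errors\<close>

definition phase_channel :: "nat \<Rightarrow> nat \<Rightarrow> complex mat \<Rightarrow> complex mat" where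
  "phase_channel n x = kraus_map (3 ^ n) (3 ^ n) {x} (\<lambda>x a c. 1 * phase_kraus n x a c)"

lemma phase_channel: "quantum_channel (3 ^ n) (3 ^ n) (phase_channel n x)"
  unfolding phase_channel_def by (rule phase_kraus_channel) simp

lemma phase_channel_entry:
  assumes "a < 3 ^ n" "b < 3 ^ n"
  shows "phase_channel n x X $$ (a, b) = chi n x a * cnj (chi n x b) * X $$ (a, b)"
  unfolding phase_channel_def phase_kraus_map_entry[OF assms] by simp

text \<open>For an entrywise middle channel the result is linear in the factors m, with coefficients
  that depend on encoder and decoder only. Hence a mixture of phase factors gives the same mixture
  of diagonal sums.\<close>

lemma diagonal_sum_comp:
  assumes F: "quantum_channel s d F" and D: "quantum_channel d s D"
    and N: "\<And>X. X \<in> carrier_mat d d \<Longrightarrow> N X \<in> carrier_mat d d"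
    and entry: "\<And>X a b. X \<in> carrier_mat d d \<Longrightarrow> a < d \<Longrightarrow> b < d \<Longrightarrow> N X $$ (a, b) = m a b * X $$ (a, b)"
  shows "diagonal_sum s (D \<circ> N \<circ> F) =
    (\<Sum>a<d. \<Sum>b<d. m a b * (\<Sum>i<s. \<Sum>k<s. F (elem_mat s i k) $$ (a, b) * D (elem_mat d a b) $$ (i, k)))"
proof -
  have Fc: "F (elem_mat s i k) \<in> carrier_mat d d" for i k
    by (rule quantum_channelD(2)[OF F]) simp
  have "diagonal_sum s (D \<circ> N \<circ> F) = (\<Sum>i<s. \<Sum>k<s. \<Sum>a<d. \<Sum>b<d.
      m a b * (F (elem_mat s i k) $$ (a, b) * D (elem_mat d a b) $$ (i, k)))"
    unfolding diagonal_sum_def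
  proof (intro sum.cong refl)
    fix i k assume "i \<in> {..<s}" "k \<in> {..<s}"
    then show "(D \<circ> N \<circ> F) (elem_mat s i k) $$ (i, k) =
        (\<Sum>a<d. \<Sum>b<d. m a b * (F (elem_mat s i k) $$ (a, b) * D (elem_mat d a b) $$ (i, k)))"
      by (simp add: linear_op_map_expand[OF quantum_channelD(1)[OF D] N[OF Fc]] entry[OF Fc] mult.assoc)
  qed
  also have "\<dots> = (\<Sum>(i, k, a, b)\<in>{..<s} \<times> {..<s} \<times> {..<d} \<times> {..<d}.
      m a b * (F (elem_mat s i k) $$ (a, b) * D (elem_mat d a b) $$ (i, k)))"
    by (simp only: sum.cartesian_product)
  also have "\<dots> = (\<Sum>(a, b, i, k)\<in>{..<d} \<times> {..<d} \<times> {..<s} \<times> {..<s}.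
      m a b * (F (elem_mat s i k) $$ (a, b) * D (elem_mat d a b) $$ (i, k)))"
    by (rule sum.reindex_bij_witness[where i = "\<lambda>(a, b, i, k). (i, k, a, b)"
          and j = "\<lambda>(i, k, a, b). (a, b, i, k)"]) auto
  finally show ?thesis by (simp only: sum.cartesian_product[symmetric] sum_distrib_left)
qed

text \<open>
  Averaging over all phase errors measures every qutrit in the computational basis. After such a
  measurement the transmission is classical, and s-dimensional entanglement survives with
  fidelity at most 1/s.
\<close>
lemma diagonal_sum_full_dephasing:
  assumes F: "quantum_channel s (3 ^ n) F" and D: "quantum_channel (3 ^ n) s D"
  shows "(\<Sum>x<3 ^ n. Re (diagonal_sum s (D \<circ> phase_channel n x \<circ> F))) \<le> 3 ^ n * real s"
proof -
  let ?N = "3 ^ n :: nat"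
  let ?W = "\<lambda>a b. \<Sum>i<s. \<Sum>k<s. F (elem_mat s i k) $$ (a, b) * D (elem_mat ?N a b) $$ (i, k)"
  have orth: "(\<Sum>x<?N. chi n x a * cnj (chi n x b)) = of_bool (b = a) * 3 ^ n" if "a < ?N" "b < ?N" for a b
    using chi_orthogonal[OF that] by (auto simp: chi_commute[of n _ a] chi_commute[of n _ b])
  have "(\<Sum>x<?N. diagonal_sum s (D \<circ> phase_channel n x \<circ> F))
      = (\<Sum>x<?N. \<Sum>a<?N. \<Sum>b<?N. (chi n x a * cnj (chi n x b)) * ?W a b)"
    by (intro sum.cong refl diagonal_sum_comp[OF F D] phase_channel_entry quantum_channelD(2)[OF phase_channel])
  also have "\<dots> = (\<Sum>a<?N. \<Sum>b<?N. \<Sum>x<?N. (chi n x a * cnj (chi n x b)) * ?W a b)"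
    by (subst sum.swap, rule sum.cong[OF refl], rule sum.swap)
  also have "\<dots> = (\<Sum>a<?N. \<Sum>b<?N. of_bool (b = a) * (3 ^ n * ?W a b))"
    by (intro sum.cong refl)
      (simp only: sum_distrib_right[symmetric] orth lessThan_iff mult.assoc[of "of_bool _", symmetric])
  also have "\<dots> = (\<Sum>a<?N. 3 ^ n * ?W a a)"
    by (intro sum.cong refl sum_of_bool_eq_mult) simp
  finally have eq: "(\<Sum>x<?N. diagonal_sum s (D \<circ> phase_channel n x \<circ> F)) = (\<Sum>a<?N. 3 ^ n * ?W a a)" .
  \<comment> \<open>For measurement outcome a, P is up to transposition the effect by which the
    encoded secret yields a, and Q is the state that the decoder prepares from a. Q has trace 1, and
    the traces of P over all a sum to s.\<close>
  have W: "Re (?W a a) \<le> (\<Sum>i<s. Re (F (elem_mat s i i) $$ (a, a)))" if a: "a < ?N" for a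
  proof -
    define P where "P = mat s s (\<lambda>(i, k). F (elem_mat s i k) $$ (a, a))"
    define Q where "Q = mat s s (\<lambda>(i, k). D (elem_mat ?N a a) $$ (i, k))"
    have P: "psd_mat s P"
      unfolding P_def by (rule psd_choi_submatrix[OF F, of s "\<lambda>x. x" "\<lambda>_. a"]) (use a in simp)
    have Q: "psd_mat s Q"
      unfolding Q_def by (rule psd_choi_submatrix[OF D, of s "\<lambda>_. a" "\<lambda>x. x"]) (use a in simp)
    have "Re (?W a a) = Re (\<Sum>i<s. \<Sum>k<s. P $$ (i, k) * Q $$ (i, k))"
      by (simp add: P_def Q_def)
    also have "\<dots> \<le> cmod (\<Sum>i<s. \<Sum>k<s. P $$ (i, k) * Q $$ (i, k))" by (rule complex_Re_le_cmod)
    also have "\<dots> \<le> (\<Sum>i<s. Re (P $$ (i, i))) * (\<Sum>i<s. Re (Q $$ (i, i)))"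
      by (rule psd_pairing_bound[OF P Q])
    also have "(\<Sum>i<s. Re (Q $$ (i, i))) = 1"
      using channel_diag_entries(2)[OF D a] by (simp add: Q_def)
    finally show ?thesis by (simp add: P_def)
  qed
  have "(\<Sum>x<?N. Re (diagonal_sum s (D \<circ> phase_channel n x \<circ> F))) = (\<Sum>a<?N. 3 ^ n * Re (?W a a))"
    using arg_cong[OF eq, of Re] by (simp del: sum_distrib_left)
  also have "\<dots> \<le> (\<Sum>a<?N. 3 ^ n * (\<Sum>i<s. Re (F (elem_mat s i i) $$ (a, a))))"
    by (intro sum_mono mult_left_mono W) auto
  also have "\<dots> = 3 ^ n * (\<Sum>i<s. \<Sum>a<?N. Re (F (elem_mat s i i) $$ (a, a)))"
    unfolding sum_distrib_left by (rule sum.swap)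
  also have "\<dots> = 3 ^ n * real s" by (simp add: channel_diag_entries(2)[OF F])
  finally show ?thesis .
qed

text \<open>Errors of probability above t are conceded fidelity 1. For all others the probability is
  replaced by t, and the sum of the fidelities over all errors is at most \<open>3 ^ n\<close> /
  s.\<close>

lemma dephasing_code_converse:
  assumes F: "quantum_channel s (3 ^ n) F" and D: "quantum_channel (3 ^ n) s D"
    and p: "0 \<le> p" "p \<le> 1" and s: "0 < s" and t: "0 \<le> t"
  shows "fidelity (ket_bra (max_entangled s))
      (tensor_map s s s s (\<lambda>Y. Y) (D \<circ> tensor_power_map 3 3 (dephasing p) n \<circ> F) (ket_bra (max_entangled s)))
    \<le> (\<Sum>x | x < 3 ^ n \<and> t < bern p n x. bern p n x) + t * 3 ^ n / real s"
proof -
  let ?N = "3 ^ n :: nat"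
  let ?W = "\<lambda>a b. \<Sum>i<s. \<Sum>k<s. F (elem_mat s i k) $$ (a, b) * D (elem_mat ?N a b) $$ (i, k)"
  let ?T = "D \<circ> tensor_power_map 3 3 (dephasing p) n \<circ> F"
  define h where "h x = Re (diagonal_sum s (D \<circ> phase_channel n x \<circ> F))" for x
  have Tx: "quantum_channel s s (D \<circ> phase_channel n x \<circ> F)" for x
    by (intro quantum_channel_comp[OF F] quantum_channel_comp[OF phase_channel D])
  have h: "0 \<le> h x" "h x \<le> real (s * s)" for x
    using diagonal_sum_bounds[OF Tx] by (simp_all add: h_def)
  have T: "quantum_channel s s ?T"
    by (intro quantum_channel_comp[OF F] quantum_channel_comp[OF dephasing_power_channel[OF p] D])
  have "diagonal_sum s ?T = (\<Sum>a<?N. \<Sum>b<?N. dephasing_factor p n a b * ?W a b)"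
    by (intro diagonal_sum_comp[OF F D] dephasing_power_entry dephasing_power_carrier)
  also have "\<dots> = (\<Sum>a<?N. \<Sum>b<?N. \<Sum>x<?N. of_real (bern p n x) * ((chi n x a * cnj (chi n x b)) * ?W a b))"
    unfolding dephasing_factor_def sum_distrib_right by (intro sum.cong refl) (simp only: mult.assoc sum_distrib_left)
  also have "\<dots> = (\<Sum>x<?N. \<Sum>a<?N. \<Sum>b<?N. of_real (bern p n x) * ((chi n x a * cnj (chi n x b)) * ?W a b))"
    by (rule sym, subst sum.swap, rule sum.cong[OF refl], rule sum.swap)
  also have "\<dots> = (\<Sum>x<?N. of_real (bern p n x) * diagonal_sum s (D \<circ> phase_channel n x \<circ> F))"
    unfolding sum_distrib_left[symmetric]
    by (intro sum.cong refl arg_cong2[where f = "(*)"] diagonal_sum_comp[OF F D, symmetric]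
        phase_channel_entry quantum_channelD(2)[OF phase_channel])
  finally have "Re (diagonal_sum s ?T) = (\<Sum>x<?N. bern p n x * h x)"
    by (simp add: h_def)
  also have "\<dots> \<le> (\<Sum>x<?N. (if t < bern p n x then bern p n x * real (s * s) else 0) + t * h x)"
  proof (rule sum_mono)
    fix x
    show "bern p n x * h x \<le> (if t < bern p n x then bern p n x * real (s * s) else 0) + t * h x"
      using h[of x] t bern_nonneg[OF p, of n x] mult_left_mono[OF h(2)[of x] bern_nonneg[OF p, of n x]]
      by (auto intro: mult_right_mono add_increasing2)
  qed
  also have "\<dots> = (\<Sum>x | x < ?N \<and> t < bern p n x. bern p n x) * real (s * s) + t * (\<Sum>x<?N. h x)"
  proof -
    have "(\<Sum>x<?N. if t < bern p n x then bern p n x * real (s * s) else 0)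
        = (\<Sum>x | x < ?N \<and> t < bern p n x. bern p n x * real (s * s))"
      by (subst sum.inter_filter[symmetric]) (auto intro!: sum.cong)
    then show ?thesis by (simp only: sum.distrib sum_distrib_left[symmetric] sum_distrib_right[symmetric])
  qed
  also have "\<dots> \<le> (\<Sum>x | x < ?N \<and> t < bern p n x. bern p n x) * real (s * s) + t * (3 ^ n * real s)"
    using diagonal_sum_full_dephasing[OF F D] t by (intro add_left_mono mult_left_mono) (simp_all add: h_def)
  finally have main: "Re (diagonal_sum s ?T)
      \<le> (\<Sum>x | x < ?N \<and> t < bern p n x. bern p n x) * real (s * s) + t * (3 ^ n * real s)" .
  let ?f = "fidelity (ket_bra (max_entangled s)) (tensor_map s s s s (\<lambda>Y. Y) ?T (ket_bra (max_entangled s)))"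
  have "complex_of_real ?f * of_nat (s * s) = diagonal_sum s ?T"
    using max_entangled_fidelity[OF T s] s by simp
  then have "?f * real (s * s) = Re (diagonal_sum s ?T)"
    by (metis Re_complex_of_real of_real_mult of_real_of_nat_eq)
  then have "?f * real (s * s) \<le> ((\<Sum>x | x < ?N \<and> t < bern p n x. bern p n x) + t * 3 ^ n / real s) * real (s * s)"
    using main s by (simp add: distrib_right)
  then show ?thesis using s by simp
qed

section \<open>Upper bound on the rate\<close>

lemma secret_dim_ge: "2 powr (real n * R) < 2 * real (secret_dim R n)" "0 < secret_dim R n"
proof -
  let ?f = "\<lfloor>2 powr (real n * R)\<rfloor>"
  have s: "real (secret_dim R n) = of_int (max 1 ?f)" by (simp add: secret_dim_def)
  have "2 powr (real n * R) < of_int (?f + 1)" by linarith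
  \<comment> \<open>The factor 2 absorbs the rounding and also covers the case in which the maximum
    is 1.\<close>
  also have "\<dots> \<le> 2 * of_int (max 1 ?f)" by linarith
  finally show "2 powr (real n * R) < 2 * real (secret_dim R n)" by (simp only: s)
  show "0 < secret_dim R n" by (simp add: secret_dim_def)
qed

lemma achievable_rate_le:
  assumes ach: "qss_achievable \<A> 3 (\<lambda>l. 3) (\<lambda>l. dephasing (q l)) R"
    and l: "l \<in> \<A>" and p: "0 \<le> q l" "q l \<le> 1"
  shows "R \<le> log 2 3 - binary_entropy (q l)"
proof (rule ccontr)
  assume contr: "\<not> R \<le> log 2 3 - binary_entropy (q l)"
  define H where "H = binary_entropy (q l)"
  \<comment> \<open>A quarter of the excess rate: one g is given up to the slack of achievability,
    one to the typicality threshold, and an exponent of -2 g per letter remains.\<close>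
  define g where "g = (R - (log 2 3 - H)) / 4"
  have g: "0 < g" using contr by (simp add: g_def H_def)
  have "\<forall>\<^sub>F n in sequentially. \<exists>F D. qss_code \<A> 3 (\<lambda>l. 3) (R - g) n F D \<and>
        (let s = secret_dim (R - g) n in
         \<forall>l \<in> \<A>. \<forall>\<phi> \<in> carrier_vec (s * s). \<phi> \<bullet>c \<phi> = 1 \<longrightarrow>
           fidelity (ket_bra \<phi>)
             (tensor_map s s s s (\<lambda>Y. Y) (D l \<circ> tensor_power_map 3 3 (dephasing (q l)) n \<circ> F)
                (ket_bra \<phi>))
           \<ge> 1 - 1 / 4)"
    by (rule ach[unfolded qss_achievable_def, THEN conjunct2, THEN spec, THEN mp, THEN spec, THEN mp])
      (use g in simp_all)
  moreover have "\<forall>\<^sub>F n in sequentially. info_variance (q l) / (real n * g\<^sup>2) < 1 / 4"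
    using g by real_asymp
  moreover have "\<forall>\<^sub>F n in sequentially. 2 * 2 powr (- (2 * g * real n)) < 1 / 2"
    using g by real_asymp
  ultimately have "\<forall>\<^sub>F n in sequentially. False"
    using eventually_gt_at_top[of 0]
  proof eventually_elim
    case (elim n)
    define s where "s = secret_dim (R - g) n"
    have s: "0 < s" "2 powr (real n * (R - g)) < 2 * real s"
      using secret_dim_ge by (simp_all add: s_def)
    obtain F D where F: "quantum_channel s (3 ^ n) F" and D: "quantum_channel (3 ^ n) s (D l)"
      and fid: "fidelity (ket_bra (max_entangled s)) (tensor_map s s s s (\<lambda>Y. Y)
        (D l \<circ> tensor_power_map 3 3 (dephasing (q l)) n \<circ> F) (ket_bra (max_entangled s))) \<ge> 1 - 1 / 4"
      using elim(1) l max_entangled_unit[OF s(1)] unfolding qss_code_def Let_def s_def[symmetric]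
      by (metis max_entangled_carrier)
    \<comment> \<open>Probabilities above t exceed the typical value by an exponential factor, so
      such errors weigh at most 1/4 in total. Of the promised fidelity 3/4 this leaves 1/2, against
      a term that tends to 0.\<close>
    define t where "t = 2 powr (- (real n * (H - g)))"
    have "3 / 4 \<le> (\<Sum>x | x < 3 ^ n \<and> t < bern (q l) n x. bern (q l) n x) + t * 3 ^ n / real s"
      using order_trans[OF fid dephasing_code_converse[OF F D p s(1), of t]] by (simp add: t_def)
    also have "(\<Sum>x | x < 3 ^ n \<and> t < bern (q l) n x. bern (q l) n x) \<le> 1 / 4"
      using order_trans[OF bern_large_weight[OF p elim(4) g] less_imp_le[OF elim(2)]] by (simp add: t_def H_def)
    finally have "1 / 2 \<le> t * 3 ^ n / real s" by linarith
    also have "t * 3 ^ n / real s \<le> t * 3 ^ n / (2 powr (real n * (R - g)) / 2)"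
      using s by (intro divide_left_mono mult_pos_pos) (auto simp: t_def)
    also have "(3 :: real) ^ n = 2 powr (real n * log 2 3)"
      by (simp add: powr_powr[symmetric] mult.commute[of "real n"] powr_realpow)
    also have "t * 2 powr (real n * log 2 3) / (2 powr (real n * (R - g)) / 2)
        = 2 * 2 powr (- (real n * (H - g)) + real n * log 2 3 - real n * (R - g))"
      unfolding t_def powr_add powr_diff by simp
    also have "- (real n * (H - g)) + real n * log 2 3 - real n * (R - g) = - (2 * g * real n)"
      by (simp add: g_def field_simps)
    finally show False using elim(3) by simp
  qed
  then show False by simp
qed

section \<open>Achievability\<close>

lemma qform_cong: "(\<And>i. i < d \<Longrightarrow> v i = v' i) \<Longrightarrow> qform d A v = qform d A v'"
  by (simp add: qform_def)

text \<open>A Kraus operator that is r times the identity contributes the square of r whatever the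
  unit vector \<phi> is, and the other Kraus operators contribute nonnegative amounts. So the bound
  does not depend on \<phi>.\<close>

lemma kraus_fidelity_ge:
  assumes T: "quantum_channel s s T" and I: "finite I" "S \<subseteq> I"
    and kraus: "\<And>X. X \<in> carrier_mat s s \<Longrightarrow> T X = kraus_map s s I K X"
    and scalar: "\<And>\<kappa> a m. \<kappa> \<in> S \<Longrightarrow> a < s \<Longrightarrow> m < s \<Longrightarrow> K \<kappa> a m = of_real (r \<kappa>) * of_bool (a = m)"
    and \<phi>: "\<phi> \<in> carrier_vec (s * s)" "\<phi> \<bullet>c \<phi> = 1"
  shows "(\<Sum>\<kappa>\<in>S. (r \<kappa>)\<^sup>2) \<le> fidelity (ket_bra \<phi>) (tensor_map s s s s (\<lambda>Y. Y) T (ket_bra \<phi>))"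
proof -
  let ?\<sigma> = "tensor_map s s s s (\<lambda>Y. Y) T (ket_bra \<phi>)"
  let ?w = "\<lambda>\<kappa> i. \<Sum>a<s. cnj (K \<kappa> a (i mod s)) * \<phi> $ (i div s * s + a)"
  let ?Q = "\<lambda>\<kappa>. qform (s * s) (ket_bra \<phi>) (?w \<kappa>)"
  have \<sigma>: "psd_mat (s * s) ?\<sigma>" by (rule quantum_channelD(3)[OF T psd_ket_bra[OF \<phi>(1)]])
  have "of_real (fidelity (ket_bra \<phi>) ?\<sigma>) = qform (s * s) ?\<sigma> (($) \<phi>)"
    by (rule fidelity_ket_bra[OF \<phi> \<sigma>])
  also have "\<dots> = qform (s * s) (tensor_map s s s s (\<lambda>Y. Y) (kraus_map s s I K) (ket_bra \<phi>)) (($) \<phi>)"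
    by (simp only: tensor_id_cong[where L = T and M = "kraus_map s s I K", OF kraus])
  also have "\<dots> = (\<Sum>\<kappa>\<in>I. ?Q \<kappa>)" by (rule qform_tensor_kraus)
  finally have fid: "fidelity (ket_bra \<phi>) ?\<sigma> = (\<Sum>\<kappa>\<in>I. Re (?Q \<kappa>))"
    by (metis Re_complex_of_real Re_sum)
  have Q: "Re (?Q \<kappa>) = (r \<kappa>)\<^sup>2" if \<kappa>: "\<kappa> \<in> S" for \<kappa>
  proof -
    have w: "?w \<kappa> i = of_real (r \<kappa>) * \<phi> $ i" if i: "i < s * s" for i
    proof -
      have s: "0 < s" using i by (cases s) auto
      have "?w \<kappa> i = (\<Sum>a<s. of_bool (a = i mod s) * (of_real (r \<kappa>) * \<phi> $ (i div s * s + a)))"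
        using s by (intro sum.cong refl) (simp add: scalar[OF \<kappa>])
      also have "\<dots> = of_real (r \<kappa>) * \<phi> $ (i div s * s + i mod s)"
        using s by (intro sum_of_bool_eq_mult) simp
      finally show ?thesis by simp
    qed
    have unit: "(\<Sum>i<s * s. \<phi> $ i * cnj (\<phi> $ i)) = 1"
      using \<phi> by (simp add: scalar_prod_def atLeast0LessThan)
    have "?Q \<kappa> = qform (s * s) (ket_bra \<phi>) (\<lambda>i. of_real (r \<kappa>) * \<phi> $ i)"
      by (rule qform_cong[OF w])
    also have "\<dots> = (\<Sum>i<s * s. \<Sum>j<s * s. of_real ((r \<kappa>)\<^sup>2) * ((\<phi> $ i * cnj (\<phi> $ i)) * (\<phi> $ j * cnj (\<phi> $ j))))"
      unfolding qform_def
      by (intro sum.cong refl) (simp add: ket_bra_entry[OF \<phi>(1)] power2_eq_square mult_ac)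
    also have "\<dots> = of_real ((r \<kappa>)\<^sup>2) * ((\<Sum>i<s * s. \<phi> $ i * cnj (\<phi> $ i)) * (\<Sum>i<s * s. \<phi> $ i * cnj (\<phi> $ i)))"
      by (subst sum_product) (simp only: sum_distrib_left)
    finally show ?thesis by (simp only: unit) simp
  qed
  have "(\<Sum>\<kappa>\<in>S. (r \<kappa>)\<^sup>2) = (\<Sum>\<kappa>\<in>S. Re (?Q \<kappa>))" by (simp add: Q)
  also have "\<dots> \<le> (\<Sum>\<kappa>\<in>I. Re (?Q \<kappa>))"
    using I psd_mat_qform[OF psd_ket_bra[OF \<phi>(1)]] by (intro sum_mono2) (auto simp: less_eq_complex_def)
  finally show ?thesis by (simp only: fid)
qed

text \<open>
  The basis vector m is encoded as the Fourier basis vector with label c m. The phase error e moves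
  it to the label c m + e, from which the decoder reads off m and e coherently. The labels outside
  the image of this map (the set R below) are all decoded to the basis vector 0.
\<close>
lemma phase_code:
  assumes s: "0 < s" and c: "\<And>m. m < s \<Longrightarrow> c m < 3 ^ n" and cinj: "inj_on c {..<s}" and fin: "finite E"
    and inj: "inj_on (\<lambda>(m, e). trit_add n (c m) e) ({..<s} \<times> E)"
  obtains F D where "quantum_channel s (3 ^ n) F" "quantum_channel (3 ^ n) s D"
    "\<And>p \<phi>. 0 \<le> p \<Longrightarrow> p \<le> 1 \<Longrightarrow> E \<subseteq> {..<3 ^ n} \<Longrightarrow> \<phi> \<in> carrier_vec (s * s) \<Longrightarrow> \<phi> \<bullet>c \<phi> = 1 \<Longrightarrow>
      (\<Sum>e\<in>E. bern p n e) \<le> fidelity (ket_bra \<phi>) (tensor_map s s s s (\<lambda>Y. Y)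
        (D \<circ> tensor_power_map 3 3 (dephasing p) n \<circ> F) (ket_bra \<phi>))"
proof -
  define N :: nat where "N = 3 ^ n"
  define z where "z = complex_of_real (1 / sqrt (real N))"
  have N: "0 < N" by (simp add: N_def)
  have zz: "z * cnj z = 1 / of_nat N" "cnj z * z = 1 / of_nat N"
    using N by (simp_all add: z_def flip: of_real_mult)
  have orth: "(\<Sum>r<N. chi n x r * cnj (chi n y r)) = of_nat N * of_bool (x = y)" if "x < N" "y < N" for x y
    using chi_orthogonal[of x n y] that by (simp add: N_def)
  define KF where "KF = (\<lambda>(_ :: unit) r m. z * chi n (c m) r)"
  define R where "R = {..<N} - (\<lambda>(m, e). trit_add n (c m) e) ` ({..<s} \<times> E)"
  define J where "J = E <+> R"
  define KD where "KD = case_sum (\<lambda>e m r. z * cnj (chi n (trit_add n (c m) e) r))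
    (\<lambda>g m r. of_bool (m = 0) * (z * cnj (chi n g r)))"
  define F where "F = kraus_map s N {()} KF"
  define D where "D = kraus_map N s J KD"
  have finR: "finite R" by (simp add: R_def)
  have F: "quantum_channel s N F"
    unfolding F_def
  proof (rule kraus_map_channel)
    fix m m' assume m: "m < s" "m' < s"
    have "(\<Sum>\<kappa>\<in>{()}. \<Sum>r<N. cnj (KF \<kappa> r m) * KF \<kappa> r m')
        = (cnj z * z) * (\<Sum>r<N. chi n (c m') r * cnj (chi n (c m) r))"
      by (simp add: KF_def sum_distrib_left mult_ac)
    also have "\<dots> = of_bool (c m' = c m)"
      unfolding zz using c[OF m(1)] c[OF m(2)] N by (simp add: orth N_def[symmetric])
    also have "\<dots> = of_bool (m = m')" using m cinj by (auto simp: inj_on_def)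
    finally show "(\<Sum>\<kappa>\<in>{()}. \<Sum>r<N. cnj (KF \<kappa> r m) * KF \<kappa> r m') = of_bool (m = m')" .
  qed
  have D: "quantum_channel N s D"
    unfolding D_def
  proof (rule kraus_map_channel)
    fix r r' assume r: "r < N" "r' < N"
    let ?t = "\<lambda>g. chi n g r * cnj (chi n g r')"
    \<comment> \<open>By injectivity each label c m + e arises from one pair only. Together with R
      these labels exhaust the Fourier basis, so trace preservation becomes the completeness of that
      basis.\<close>
    have E': "(\<Sum>e\<in>E. \<Sum>m<s. ?t (trit_add n (c m) e)) = sum ?t ((\<lambda>(m, e). trit_add n (c m) e) ` ({..<s} \<times> E))"
      by (subst sum.reindex[OF inj], subst sum.swap) (simp add: sum.cartesian_product split_def)
    have sub: "(\<lambda>(m, e). trit_add n (c m) e) ` ({..<s} \<times> E) \<subseteq> {..<N}"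
      using trit_add_less by (auto simp: N_def)
    have "(\<Sum>\<kappa>\<in>J. \<Sum>m<s. cnj (KD \<kappa> m r) * KD \<kappa> m r') =
        (\<Sum>e\<in>E. \<Sum>m<s. (cnj z * z) * ?t (trit_add n (c m) e)) + (\<Sum>g\<in>R. \<Sum>m<s. of_bool (m = 0) * ((cnj z * z) * ?t g))"
    proof -
      have "cnj (KD (Inl e) m r) * KD (Inl e) m r' = (cnj z * z) * ?t (trit_add n (c m) e)" for e m
        by (simp add: KD_def mult_ac)
      moreover have "cnj (KD (Inr g) m r) * KD (Inr g) m r' = of_bool (m = 0) * ((cnj z * z) * ?t g)" for g m
        by (cases "m = 0") (simp_all add: KD_def mult_ac)
      ultimately show ?thesis
        unfolding J_def sum.Plus[OF fin finR] by (simp only: o_def)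
    qed
    also have "(\<Sum>g\<in>R. \<Sum>m<s. of_bool (m = 0) * ((cnj z * z) * ?t g)) = (\<Sum>g\<in>R. (cnj z * z) * ?t g)"
      by (intro sum.cong refl sum_of_bool_eq_mult s)
    also have "(\<Sum>e\<in>E. \<Sum>m<s. (cnj z * z) * ?t (trit_add n (c m) e)) + (\<Sum>g\<in>R. (cnj z * z) * ?t g)
        = (cnj z * z) * (sum ?t ((\<lambda>(m, e). trit_add n (c m) e) ` ({..<s} \<times> E)) + sum ?t R)"
      by (simp only: sum_distrib_left[symmetric] distrib_left E')
    also have "sum ?t ((\<lambda>(m, e). trit_add n (c m) e) ` ({..<s} \<times> E)) + sum ?t R = sum ?t {..<N}"
      unfolding R_def using sum.subset_diff[OF sub, of ?t] by (simp add: add.commute)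
    also have "sum ?t {..<N} = of_nat N * of_bool (r = r')"
      using orth[OF r] by (simp only: chi_commute[of n _ r] chi_commute[of n _ r'])
    finally show "(\<Sum>\<kappa>\<in>J. \<Sum>m<s. cnj (KD \<kappa> m r) * KD \<kappa> m r') = of_bool (r = r')"
      unfolding zz using N by simp
  qed
  have fid: "(\<Sum>e\<in>E. bern p n e) \<le> fidelity (ket_bra \<phi>) (tensor_map s s s s (\<lambda>Y. Y)
        (D \<circ> tensor_power_map 3 3 (dephasing p) n \<circ> F) (ket_bra \<phi>))"
    if p: "0 \<le> p" "p \<le> 1" and EN: "E \<subseteq> {..<3 ^ n}" and \<phi>: "\<phi> \<in> carrier_vec (s * s)" "\<phi> \<bullet>c \<phi> = 1" for p \<phi>
  proof -
    let ?T = "D \<circ> tensor_power_map 3 3 (dephasing p) n \<circ> F"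
    define KN where "KN = (\<lambda>x a b. complex_of_real (sqrt (bern p n x)) * phase_kraus n x a b)"
    define K where "K = (\<lambda>(j, \<kappa>) a m. \<Sum>b<N. KD j a b * (case \<kappa> of (x, u) \<Rightarrow> \<lambda>b m. \<Sum>b'<N. KN x b b' * KF u b' m) b m)"
    \<comment> \<open>Kraus operators of the whole transmission are indexed by decoder branch, phase
      error and the single encoding operator. S selects those in which the decoder branch names the
      actual error.\<close>
    define S where "S = (\<lambda>e. (Inl e :: nat + nat, (e, ()))) ` E"
    have T: "quantum_channel s s ?T"
      using quantum_channel_comp[OF F quantum_channel_comp[OF _ D]] dephasing_power_channel[OF p, of n]
      by (simp add: N_def)
    have kraus: "?T X = kraus_map s s (J \<times> ({..<N} \<times> {()})) K X" if X: "X \<in> carrier_mat s s" for X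
    proof -
      have "F X \<in> carrier_mat (3 ^ n) (3 ^ n)" using quantum_channelD(2)[OF F X] by (simp add: N_def)
      then have "?T X = kraus_map N s J KD (kraus_map N N {..<N} KN (kraus_map s N {()} KF X))"
        using dephasing_power_kraus[OF p] by (simp add: D_def F_def KN_def N_def)
      then show ?thesis unfolding kraus_map_comp K_def .
    qed
    have scalar: "K \<kappa> a m = of_real (sqrt (bern p n (fst (snd \<kappa>)))) * of_bool (a = m)"
      if \<kappa>: "\<kappa> \<in> S" and am: "a < s" "m < s" for \<kappa> a m
    proof -
      obtain e where e: "e \<in> E" "\<kappa> = (Inl e, (e, ()))" using \<kappa> by (auto simp: S_def)
      have inner: "(\<Sum>b'<N. KN e b b' * KF () b' m) = of_real (sqrt (bern p n e)) * z * chi n (trit_add n (c m) e) b"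
        if b: "b < N" for b
      proof -
        have "(\<Sum>b'<N. KN e b b' * KF () b' m)
            = (\<Sum>b'<N. of_bool (b' = b) * (of_real (sqrt (bern p n e)) * z * (chi n (c m) b' * chi n e b')))"
          by (intro sum.cong refl) (auto simp: KN_def KF_def phase_kraus_def)
        also have "\<dots> = of_real (sqrt (bern p n e)) * z * (chi n (c m) b * chi n e b)"
          by (rule sum_of_bool_eq_mult[OF b])
        finally show ?thesis by (simp only: chi_trit_add)
      qed
      have "K \<kappa> a m = (\<Sum>b<N. KD (Inl e) a b * (\<Sum>b'<N. KN e b b' * KF () b' m))"
        by (simp add: K_def e)
      also have "\<dots> = (\<Sum>b<N. (of_real (sqrt (bern p n e)) * (z * z)) * (chi n (trit_add n (c m) e) b * cnj (chi n (trit_add n (c a) e) b)))"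
        by (intro sum.cong refl) (simp add: inner KD_def)
      also have "\<dots> = (of_real (sqrt (bern p n e)) * (z * z)) * (of_nat N * of_bool (trit_add n (c m) e = trit_add n (c a) e))"
        unfolding sum_distrib_left[symmetric] by (subst orth) (simp_all add: N_def trit_add_less)
      also have "z * z = 1 / of_nat N" using zz by (simp add: z_def)
      also have "(trit_add n (c m) e = trit_add n (c a) e) = (a = m)"
        using inj_onD[OF inj, of "(m, e)" "(a, e)"] am e by auto
      finally show ?thesis using N e by simp
    qed
    have "S \<subseteq> J \<times> ({..<N} \<times> {()})" using EN by (auto simp: S_def J_def N_def)
    then have "(\<Sum>\<kappa>\<in>S. (sqrt (bern p n (fst (snd \<kappa>))))\<^sup>2)
        \<le> fidelity (ket_bra \<phi>) (tensor_map s s s s (\<lambda>Y. Y) ?T (ket_bra \<phi>))"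
      using fin finR by (intro kraus_fidelity_ge[OF T _ _ kraus scalar \<phi>]) (auto simp: J_def)
    also have "(\<Sum>\<kappa>\<in>S. (sqrt (bern p n (fst (snd \<kappa>))))\<^sup>2) = (\<Sum>e\<in>E. bern p n e)"
      unfolding S_def by (subst sum.reindex) (auto simp: inj_on_def bern_nonneg[OF p])
    finally show ?thesis .
  qed
  show thesis using that F D fid by (simp add: N_def)
qed

section \<open>Decodable errors and the parameters of the code\<close>

lemma uncollided_decodable:
  assumes C: "trit_code n C" and E: "E \<subseteq> {..<3 ^ n}"
    and c: "c ` {..<s} \<subseteq> C" "inj_on c {..<s}"
  shows "inj_on (\<lambda>(m, e). trit_add n (c m) e) ({..<s} \<times> {e \<in> E. collisions n E C e = {}})"
proof (rule inj_onI)
  let ?A = "trit_add n" and ?S = "{..<s} \<times> {e \<in> E. collisions n E C e = {}}"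
  fix x y
  assume xy: "x \<in> ?S" "y \<in> ?S" "(case x of (m, e) \<Rightarrow> ?A (c m) e) = (case y of (m, e) \<Rightarrow> ?A (c m) e)"
  obtain m e m' e' where x: "x = (m, e)" and y: "y = (m', e')" by (cases x, cases y)
  have m: "m \<in> {..<s}" "m' \<in> {..<s}" and e: "e \<in> E" "e' \<in> E" "collisions n E C e = {}"
    and eq: "?A (c m) e = ?A (c m') e'"
    using xy by (auto simp: x y)
  have cm: "c m \<in> C" "c m' \<in> C" using m c by auto
  have lt: "c m < 3 ^ n" "c m' < 3 ^ n" "e < 3 ^ n" "e' < 3 ^ n" using cm C e E by (auto simp: trit_code_def)
  \<comment> \<open>d stands for c m - c m'. Equal labels force e' - e = d, which is a code word; as
    e has no collision, e' must be e.\<close>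
  define d where "d = ?A (c m) (?A (c m') (c m'))"
  have d: "d \<in> C" using cm C by (auto simp: trit_code_def d_def)
  have "?A e d = ?A (c m') (?A (c m') (?A (c m) e))" unfolding d_def by (simp only: trit_add_ac)
  also have "\<dots> = e'" unfolding eq using lt by (simp add: trit_add_triple_left)
  finally have "e' = ?A e d" by simp
  then have ee: "e' = e" using d e by (auto simp: collisions_def)
  have "c m = ?A e (?A e (?A (c m) e))"
    using trit_add_triple_left[OF lt(1), of e] by (simp only: trit_add_ac)
  also have "\<dots> = ?A e (?A e (?A e (c m')))" unfolding eq ee by (simp only: trit_add_ac)
  also have "\<dots> = c m'" using lt by (simp add: trit_add_triple_left)
  finally have "c m = c m'" .
  then show "x = y" using m c(2) ee by (auto simp: inj_on_def x y)
qed

text \<open>Markov's inequality: an error with a collision has a count of at least 1, so all such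
  errors together weigh at most the collision weight.\<close>

lemma uncollided_weight:
  assumes E: "finite E" and w: "\<And>e. e \<in> E \<Longrightarrow> 0 \<le> w e"
  shows "sum w E - collision_weight n E w C \<le> sum w {e \<in> E. collisions n E C e = {}}"
proof -
  have fin: "finite (collisions n E C e)" for e using E by (simp add: collisions_def)
  have "sum w E \<le> (\<Sum>e\<in>E. (if collisions n E C e = {} then w e else 0) + w e * real (card (collisions n E C e)))"
  proof (rule sum_mono)
    fix e assume e: "e \<in> E"
    show "w e \<le> (if collisions n E C e = {} then w e else 0) + w e * real (card (collisions n E C e))"
    proof (cases "collisions n E C e = {}")
      case False
      then have "1 \<le> real (card (collisions n E C e))"
        using fin[of e] by (simp add: Suc_leI card_gt_0_iff)
      then have "w e * 1 \<le> w e * real (card (collisions n E C e))" using w[OF e] by (rule mult_left_mono)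
      then show ?thesis using False by simp
    qed simp
  qed
  also have "\<dots> = sum w {e \<in> E. collisions n E C e = {}} + collision_weight n E w C"
    using E by (simp add: sum.distrib collision_weight_def sum.inter_filter)
  finally show ?thesis by simp
qed

text \<open>Linear codes have 3-power size while s is arbitrary. Rounding up costs a factor of at
  most 3, which does not affect the rate, and minimality keeps the dimension of the code at most
  n.\<close>

lemma pow3_between:
  fixes s :: nat
  assumes "0 < s"
  obtains k where "s \<le> 3 ^ k" "3 ^ k \<le> 3 * s" "\<And>n. s \<le> 3 ^ n \<Longrightarrow> k \<le> n"
proof -
  define k where "k = (LEAST k. s \<le> 3 ^ k)"
  have "s \<le> 3 ^ s" using less_exp[of s] power_mono[of 2 3 s] by simp
  then have k: "s \<le> 3 ^ k" unfolding k_def by (rule LeastI)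
  have least: "k \<le> n" if "s \<le> 3 ^ n" for n unfolding k_def using that by (rule Least_le)
  have "3 ^ k \<le> 3 * s"
  proof (cases k)
    case (Suc j)
    then show ?thesis using least[of j] by (cases "s \<le> 3 ^ j") auto
  qed (use assms in simp)
  then show thesis using that k least by blast
qed

lemma binary_entropy_bounds:
  assumes "0 \<le> p" "p \<le> 1"
  shows "0 \<le> binary_entropy p" "binary_entropy p \<le> 1"
proof -
  have nonneg: "x * log 2 x \<le> 0" if "0 \<le> x" "x \<le> 1" for x :: real
    using that by (cases "x = 0") (auto intro: mult_nonneg_nonpos)
  show "0 \<le> binary_entropy p"
    using nonneg[of p] nonneg[of "1 - p"] assms by (simp add: binary_entropy_def)
  \<comment> \<open>Gibbs' inequality against the uniform distribution on two points, from ln y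
    \<le> y - 1 at y = 1 / (2 x). The corrections (1/2 - x) / ln 2 for p and 1 - p cancel.\<close>
  have le: "- x * log 2 x \<le> x + (1 / 2 - x) / ln 2" if "0 \<le> x" for x :: real
  proof (cases "x = 0")
    case False
    then have x: "0 < x" using that by simp
    have "ln (1 / (2 * x)) \<le> 1 / (2 * x) - 1" using x by (intro ln_le_minus_one) simp
    then have "x * ln (1 / (2 * x)) \<le> x * (1 / (2 * x) - 1)" using x by (intro mult_left_mono) auto
    then have "- x * ln x \<le> x * ln 2 + (1 / 2 - x)"
      using x by (simp add: ln_div ln_mult algebra_simps)
    then have "- x * ln x / ln 2 \<le> (x * ln 2 + (1 / 2 - x)) / ln 2" by (intro divide_right_mono) auto
    then show ?thesis by (simp add: log_def add_divide_distrib)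
  qed simp
  have "binary_entropy p \<le> (p + (1 / 2 - p) / ln 2) + ((1 - p) + (1 / 2 - (1 - p)) / ln 2)"
    unfolding binary_entropy_def using le[of p] le[of "1 - p"] assms by linarith
  also have "\<dots> = 1" by (simp add: field_simps)
  finally show "binary_entropy p \<le> 1" .
qed

text \<open>A lower bound on the probability already limits the number of elements. More likely
  errors may stay, since there are few of them.\<close>

definition typical :: "real \<Rightarrow> real \<Rightarrow> nat \<Rightarrow> nat set" where
  "typical p \<eta> n = {x. x < 3 ^ n \<and> 2 powr (- (real n * (binary_entropy p + \<eta>))) \<le> bern p n x}"

lemma card_typical:
  assumes p: "0 \<le> p" "p \<le> 1"
  shows "real (card (typical p \<eta> n)) \<le> 2 powr (real n * (binary_entropy p + \<eta>))"
proof -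
  let ?t = "2 powr (- (real n * (binary_entropy p + \<eta>)))"
  have "real (card (typical p \<eta> n)) * ?t \<le> (\<Sum>x\<in>typical p \<eta> n. bern p n x)"
    by (rule sum_bounded_below) (simp add: typical_def)
  also have "\<dots> \<le> (\<Sum>x<3 ^ n. bern p n x)"
    using bern_nonneg[OF p] by (intro sum_mono2) (auto simp: typical_def)
  finally have "real (card (typical p \<eta> n)) * ?t \<le> 1" by (simp only: bern_sum)
  then have "real (card (typical p \<eta> n)) / 2 powr (real n * (binary_entropy p + \<eta>)) \<le> 1"
    by (simp only: powr_minus divide_inverse)
  then show ?thesis by (simp add: divide_le_eq_1_pos)
qed

section \<open>One code for all channels\<close>

lemma compound_code:
  assumes A: "finite \<A>" and q: "\<And>l. l \<in> \<A> \<Longrightarrow> 0 \<le> q l \<and> q l \<le> 1"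
    and H: "\<And>l. l \<in> \<A> \<Longrightarrow> binary_entropy (q l) \<le> H"
    and n: "0 < n" and \<eta>: "0 < \<eta>" and s: "0 < s" "s \<le> 3 ^ n"
  obtains F D where "quantum_channel s (3 ^ n) F" "quantum_channel (3 ^ n) s D"
    "\<And>l \<phi>. l \<in> \<A> \<Longrightarrow> \<phi> \<in> carrier_vec (s * s) \<Longrightarrow> \<phi> \<bullet>c \<phi> = 1 \<Longrightarrow>
      1 - info_variance (q l) / (real n * \<eta>\<^sup>2)
        - 9 / 2 * (real (card \<A>))\<^sup>2 * (real s * 2 powr (real n * (H + \<eta>)) / 3 ^ n)
      \<le> fidelity (ket_bra \<phi>) (tensor_map s s s s (\<lambda>Y. Y)
        (D \<circ> tensor_power_map 3 3 (dephasing (q l)) n \<circ> F) (ket_bra \<phi>))"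
proof -
  define E where "E = (\<Union>l\<in>\<A>. typical (q l) \<eta> n)"
  have EN: "E \<subseteq> {..<3 ^ n}" by (auto simp: E_def typical_def)
  then have finE: "finite E" by (rule finite_subset) simp
  \<comment> \<open>The sum of all error distributions dominates each of them, so a code with few
    collisions under w is good for every channel at once.\<close>
  define w where "w x = (\<Sum>l\<in>\<A>. bern (q l) n x)" for x
  have b: "0 \<le> bern (q l) n x" if "l \<in> \<A>" for l x using q[OF that] bern_nonneg by blast
  have w: "0 \<le> w x" for x unfolding w_def using b by (rule sum_nonneg)
  have bw: "bern (q l) n x \<le> w x" if "l \<in> \<A>" for l x
    unfolding w_def using that b A by (intro member_le_sum) auto
  have cardE: "real (card E) \<le> real (card \<A>) * 2 powr (real n * (H + \<eta>))"
  proof -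
    have "real (card E) \<le> (\<Sum>l\<in>\<A>. real (card (typical (q l) \<eta> n)))"
      unfolding E_def of_nat_sum[symmetric] of_nat_le_iff by (rule card_UN_le[OF A])
    also have "\<dots> \<le> (\<Sum>l\<in>\<A>. 2 powr (real n * (H + \<eta>)))"
    proof (rule sum_mono)
      fix l assume l: "l \<in> \<A>"
      have "real (card (typical (q l) \<eta> n)) \<le> 2 powr (real n * (binary_entropy (q l) + \<eta>))"
        using card_typical q[OF l] by blast
      also have "\<dots> \<le> 2 powr (real n * (H + \<eta>))" using H[OF l] by (simp add: mult_left_mono)
      finally show "real (card (typical (q l) \<eta> n)) \<le> 2 powr (real n * (H + \<eta>))" .
    qed
    finally show ?thesis by simp
  qed
  have sumw: "sum w E \<le> real (card \<A>)"
  proof -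
    have "sum w E \<le> sum w {..<3 ^ n}" using EN w by (intro sum_mono2) auto
    also have "\<dots> = (\<Sum>l\<in>\<A>. \<Sum>x<3 ^ n. bern (q l) n x)" unfolding w_def by (rule sum.swap)
    finally show ?thesis by (simp add: bern_sum)
  qed
  obtain k where k: "s \<le> 3 ^ k" "3 ^ k \<le> 3 * s" "k \<le> n" using pow3_between[OF s(1)] s(2) by metis
  obtain C where C: "trit_code n C" "card C = 3 ^ k"
    and coll: "collision_weight n E w C \<le> 3 / 2 * 3 ^ k * real (card E) * sum w E / 3 ^ n"
    by (rule trit_code_exists[where w = w, OF EN w k(3)])
  have finC: "finite C" and CN: "C \<subseteq> {..<3 ^ n}" using C(1) by (auto simp: trit_code_def intro: finite_subset)
  obtain c where c: "c ` {..<s} \<subseteq> C" "inj_on c {..<s}"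
    using card_le_inj[of "{..<s}" C] finC C(2) k(1) by auto
  define E' where "E' = {e \<in> E. collisions n E C e = {}}"
  have E'N: "E' \<subseteq> {..<3 ^ n}" and finE': "finite E'" using EN finE by (auto simp: E'_def)
  obtain F D where F: "quantum_channel s (3 ^ n) F" and D: "quantum_channel (3 ^ n) s D"
    and fid: "\<And>p \<phi>. 0 \<le> p \<Longrightarrow> p \<le> 1 \<Longrightarrow> E' \<subseteq> {..<3 ^ n} \<Longrightarrow> \<phi> \<in> carrier_vec (s * s) \<Longrightarrow> \<phi> \<bullet>c \<phi> = 1 \<Longrightarrow>
      (\<Sum>e\<in>E'. bern p n e) \<le> fidelity (ket_bra \<phi>) (tensor_map s s s s (\<lambda>Y. Y)
        (D \<circ> tensor_power_map 3 3 (dephasing p) n \<circ> F) (ket_bra \<phi>))"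
  proof (rule phase_code[OF s(1) _ c(2) finE'])
    show "c m < 3 ^ n" if "m < s" for m using that c(1) CN by auto
    show "inj_on (\<lambda>(m, e). trit_add n (c m) e) ({..<s} \<times> E')"
      unfolding E'_def by (rule uncollided_decodable[OF C(1) EN c])
  qed blast
  show thesis
  proof (rule that[OF F D])
    fix l and \<phi> :: "complex vec" assume l: "l \<in> \<A>" and \<phi>: "\<phi> \<in> carrier_vec (s * s)" "\<phi> \<bullet>c \<phi> = 1"
    let ?p = "q l"
    have p: "0 \<le> ?p" "?p \<le> 1" using q[OF l] by auto
    have "(\<Sum>x\<in>{..<3 ^ n} - E. bern ?p n x)
        \<le> (\<Sum>x | x < 3 ^ n \<and> bern ?p n x < 2 powr (- (real n * (binary_entropy ?p + \<eta>))). bern ?p n x)"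
      using b[OF l] l by (intro sum_mono2) (auto simp: E_def typical_def not_le)
    also have "\<dots> \<le> info_variance ?p / (real n * \<eta>\<^sup>2)" by (rule bern_small_weight[OF p n \<eta>])
    finally have "1 - info_variance ?p / (real n * \<eta>\<^sup>2) \<le> (\<Sum>x\<in>E. bern ?p n x)"
      using sum.subset_diff[OF EN, of "bern ?p n"] bern_sum[of ?p n] by simp
    moreover have "(\<Sum>x\<in>E. bern ?p n x) - collision_weight n E (bern ?p n) C \<le> (\<Sum>e\<in>E'. bern ?p n e)"
      unfolding E'_def by (rule uncollided_weight[OF finE b[OF l]])
    moreover have "collision_weight n E (bern ?p n) C \<le> collision_weight n E w C"
      unfolding collision_weight_def using bw[OF l] by (intro sum_mono mult_right_mono) auto
    moreover have "collision_weight n E w C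
        \<le> 9 / 2 * (real (card \<A>))\<^sup>2 * (real s * 2 powr (real n * (H + \<eta>)) / 3 ^ n)"
    proof -
      \<comment> \<open>The constant 9/2 is 3/2 from \<open>trit_code_exists\<close> times 3 from
        rounding s up to a power of 3. The number of channels enters once through the size of E and
        once through the total weight of w.\<close>
      have "(3::real) ^ k \<le> 3 * real s" using of_nat_mono[OF k(2), where 'a = real] by simp
      then have "3 ^ k * real (card E) * sum w E
          \<le> (3 * real s) * (real (card \<A>) * 2 powr (real n * (H + \<eta>))) * real (card \<A>)"
        using cardE sumw w by (intro mult_mono) (auto simp: sum_nonneg)
      then have "3 / 2 * (3 ^ k * real (card E) * sum w E) / 3 ^ n \<le> 3 / 2 *
          ((3 * real s) * (real (card \<A>) * 2 powr (real n * (H + \<eta>))) * real (card \<A>)) / 3 ^ n"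
        by (intro divide_right_mono mult_left_mono) auto
      then show ?thesis using coll by (simp add: power2_eq_square mult_ac)
    qed
    ultimately show "1 - info_variance ?p / (real n * \<eta>\<^sup>2)
        - 9 / 2 * (real (card \<A>))\<^sup>2 * (real s * 2 powr (real n * (H + \<eta>)) / 3 ^ n)
      \<le> fidelity (ket_bra \<phi>) (tensor_map s s s s (\<lambda>Y. Y)
        (D \<circ> tensor_power_map 3 3 (dephasing ?p) n \<circ> F) (ket_bra \<phi>))"
      using fid[OF p E'N \<phi>] by linarith
  qed
qed

lemma compound_capacity_achievable:
  assumes A: "finite \<A>" and q: "\<And>l. l \<in> \<A> \<Longrightarrow> 0 \<le> q l \<and> q l \<le> 1"
    and H: "\<And>l. l \<in> \<A> \<Longrightarrow> binary_entropy (q l) \<le> H" and H01: "0 \<le> H" "H \<le> 1"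
  shows "qss_achievable \<A> 3 (\<lambda>l. 3) (\<lambda>l. dephasing (q l)) (log 2 3 - H)"
  unfolding qss_achievable_def
proof (intro conjI allI impI)
  define c where "c = log 2 3 - H"
  \<comment> \<open>With \<open>H \<le> 1\<close> the claimed rate is strictly positive, which
    allows a positive g below.\<close>
  have "1 < log 2 (3 :: real)" by (simp add: less_log_iff)
  then have c: "0 < c" using H01 unfolding c_def by linarith
  then show "0 \<le> log 2 3 - H" by (simp add: c_def)
  fix \<epsilon> \<delta> :: real assume \<epsilon>: "0 < \<epsilon>" and \<delta>: "0 < \<delta>"
  \<comment> \<open>The rate is lowered by at least 2 g: one g pays for the size of the typical set,
    the other makes the collision term decay. The bound \<open>2 * g \<le> c\<close> keeps the
    exponent c - 2 g nonnegative, so that the estimate of s also covers the value 1 of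
    \<open>secret_dim\<close> when \<delta> exceeds the rate.\<close>
  define g where "g = min \<delta> c / 2"
  have g: "0 < g" "2 * g \<le> \<delta>" "2 * g \<le> c" using \<delta> c by (simp_all add: g_def)
  define a where "a = 9 / 2 * (real (card \<A>))\<^sup>2"
  have a: "0 \<le> a" by (simp add: a_def)
  have ev1: "\<forall>\<^sub>F n in sequentially. \<forall>l\<in>\<A>. info_variance (q l) / (real n * g\<^sup>2) < \<epsilon> / 2"
  proof (rule eventually_ball_finite[OF A], rule ballI)
    fix l
    have "(\<lambda>n. info_variance (q l) / (real n * g\<^sup>2)) \<longlonglongrightarrow> 0" using g by real_asymp
    then show "\<forall>\<^sub>F n in sequentially. info_variance (q l) / (real n * g\<^sup>2) < \<epsilon> / 2"
      using \<epsilon> by (intro order_tendstoD) auto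
  qed
  have "(\<lambda>n. a * 2 powr (- (g * real n))) \<longlonglongrightarrow> a * 0" using g by (intro tendsto_mult_left) real_asymp
  then have ev2: "\<forall>\<^sub>F n in sequentially. a * 2 powr (- (g * real n)) < \<epsilon> / 2"
    using \<epsilon> by (intro order_tendstoD) auto
  show "\<forall>\<^sub>F n in sequentially. \<exists>F D. qss_code \<A> 3 (\<lambda>l. 3) (log 2 3 - H - \<delta>) n F D \<and>
        (let s = secret_dim (log 2 3 - H - \<delta>) n in
         \<forall>l \<in> \<A>. \<forall>\<phi> \<in> carrier_vec (s * s). \<phi> \<bullet>c \<phi> = 1 \<longrightarrow>
           fidelity (ket_bra \<phi>)
             (tensor_map s s s s (\<lambda>Y. Y) (D l \<circ> tensor_power_map 3 3 (dephasing (q l)) n \<circ> F)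
                (ket_bra \<phi>))
           \<ge> 1 - \<epsilon>)"
    using ev1 ev2 eventually_gt_at_top[of 0]
  proof eventually_elim
    case (elim n)
    define s where "s = secret_dim (c - \<delta>) n"
    have s0: "0 < s" by (simp add: s_def secret_dim_ge)
    have pow3: "(3 :: real) ^ n = 2 powr (real n * log 2 3)"
      by (simp add: powr_powr[symmetric] mult.commute[of "real n"] powr_realpow)
    have s_le: "real s \<le> 2 powr (real n * (c - 2 * g))"
    proof -
      have "of_int \<lfloor>2 powr (real n * (c - \<delta>))\<rfloor> \<le> 2 powr (real n * (c - \<delta>))" by (rule of_int_floor_le)
      also have "\<dots> \<le> 2 powr (real n * (c - 2 * g))" using g by (simp add: mult_left_mono)
      finally have "of_int \<lfloor>2 powr (real n * (c - \<delta>))\<rfloor> \<le> 2 powr (real n * (c - 2 * g))" .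
      moreover have "1 \<le> 2 powr (real n * (c - 2 * g))" using g by (intro ge_one_powr_ge_zero) auto
      ultimately show ?thesis unfolding s_def secret_dim_def by (simp add: max_def)
    qed
    also have "\<dots> \<le> 2 powr (real n * log 2 3)" using g H01 by (simp add: mult_left_mono c_def)
    also have "\<dots> = real (3 ^ n)" by (simp add: pow3)
    finally have s3: "s \<le> 3 ^ n" by (simp only: of_nat_le_iff)
    obtain F D where F: "quantum_channel s (3 ^ n) F" and D: "quantum_channel (3 ^ n) s D"
      and fid: "\<And>l \<phi>. l \<in> \<A> \<Longrightarrow> \<phi> \<in> carrier_vec (s * s) \<Longrightarrow> \<phi> \<bullet>c \<phi> = 1 \<Longrightarrow>
      1 - info_variance (q l) / (real n * g\<^sup>2) - a * (real s * 2 powr (real n * (H + g)) / 3 ^ n)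
      \<le> fidelity (ket_bra \<phi>) (tensor_map s s s s (\<lambda>Y. Y)
        (D \<circ> tensor_power_map 3 3 (dephasing (q l)) n \<circ> F) (ket_bra \<phi>))"
      using compound_code[where q = q, OF A q H elim(3) g(1) s0 s3] unfolding a_def by blast
    have "real s * 2 powr (real n * (H + g)) / 3 ^ n
        \<le> 2 powr (real n * (c - 2 * g)) * 2 powr (real n * (H + g)) / 3 ^ n"
      using s_le by (intro divide_right_mono mult_right_mono) auto
    also have "\<dots> = 2 powr (real n * (c - 2 * g) + real n * (H + g) - real n * log 2 3)"
      unfolding pow3 by (simp add: powr_add powr_diff)
    also have "real n * (c - 2 * g) + real n * (H + g) - real n * log 2 3 = - (g * real n)"
      by (simp add: c_def algebra_simps)
    finally have "a * (real s * 2 powr (real n * (H + g)) / 3 ^ n) \<le> a * 2 powr (- (g * real n))"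
      using a by (rule mult_left_mono)
    then have small: "a * (real s * 2 powr (real n * (H + g)) / 3 ^ n) < \<epsilon> / 2" using elim(2) by linarith
    have "qss_code \<A> 3 (\<lambda>l. 3) (c - \<delta>) n F (\<lambda>l. D)"
      using F D by (simp add: qss_code_def s_def)
    moreover have "1 - \<epsilon> \<le> fidelity (ket_bra \<phi>) (tensor_map s s s s (\<lambda>Y. Y)
        (D \<circ> tensor_power_map 3 3 (dephasing (q l)) n \<circ> F) (ket_bra \<phi>))"
      if "l \<in> \<A>" "\<phi> \<in> carrier_vec (s * s)" "\<phi> \<bullet>c \<phi> = 1" for l \<phi>
    proof -
      have "info_variance (q l) / (real n * g\<^sup>2) < \<epsilon> / 2" using elim(1) that(1) by blast
      then show ?thesis using fid[OF that] small by linarith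
    qed
    ultimately show ?case
      unfolding Let_def c_def[symmetric] s_def[symmetric] by (intro exI[of _ F] exI[of _ "\<lambda>l. D"]) blast
  qed
qed

theorem mainTheorem4:
  fixes q :: "participant set \<Rightarrow> real"
  assumes "\<And>l. l \<in> threshold_2_3 \<Longrightarrow> 0 \<le> q l \<and> q l \<le> 1"
  shows "qss_capacity threshold_2_3 3 (\<lambda>l. 3) (\<lambda>l. dephasing (q l)) =
    ereal (log 2 3 - Max (binary_entropy `
      {q {Part_a, Part_b}, q {Part_a, Part_c}, q {Part_b, Part_c}, q {Part_a, Part_b, Part_c}}))"
proof -
  have image: "{q {Part_a, Part_b}, q {Part_a, Part_c}, q {Part_b, Part_c}, q {Part_a, Part_b, Part_c}}
      = q ` threshold_2_3"
    by (simp add: threshold_2_3_def)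
  define H where "H = Max (binary_entropy ` q ` threshold_2_3)"
  have fin: "finite threshold_2_3" and ne: "threshold_2_3 \<noteq> {}" by (simp_all add: threshold_2_3_def)
  have H: "binary_entropy (q l) \<le> H" if "l \<in> threshold_2_3" for l
    unfolding H_def using fin that by (intro Max_ge) auto
  \<comment> \<open>For the converse a single qualified set suffices: one whose channel attains the
    largest entropy.\<close>
  have "H \<in> binary_entropy ` q ` threshold_2_3"
    unfolding H_def using fin ne by (intro Max_in) auto
  then obtain l where l: "l \<in> threshold_2_3" "H = binary_entropy (q l)" by blast
  have q: "0 \<le> q l" "q l \<le> 1" using assms[OF l(1)] by auto
  have "qss_achievable threshold_2_3 3 (\<lambda>l. 3) (\<lambda>l. dephasing (q l)) (log 2 3 - H)"
    using binary_entropy_bounds[OF q] l(2)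
    by (intro compound_capacity_achievable fin assms H) auto
  moreover have "R \<le> log 2 3 - H"
    if "qss_achievable threshold_2_3 3 (\<lambda>l. 3) (\<lambda>l. dephasing (q l)) R" for R
    using achievable_rate_le[OF that l(1) q] l(2) by simp
  ultimately have "qss_capacity threshold_2_3 3 (\<lambda>l. 3) (\<lambda>l. dephasing (q l)) = ereal (log 2 3 - H)"
    unfolding qss_capacity_def by (intro antisym SUP_least SUP_upper) auto
  then show ?thesis by (simp only: image H_def)
qed

end
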